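(* Consider the stable ($\rho<1$) $M/G/1$ retrial queue with Bernoulli schedule in steady state, and suppose that the service time $T_\beta$ satisfies $P\{T_\beta>t\}\sim t^{-a}L(t)$ as $t\to\infty$, where $a>1$ and $L$ is slowly varying at $\infty$. Then, as $j\to\infty$, $$P\{R_{orb}>j\mid I_{ser}=0\}\;\sim\;\frac{\lambda\,\lambda_2^{a}}{a\,\mu\,(1-\rho)^2(1-\rho_1)^{a-1}}\; j^{-a}L(j).$$
   Context: Model ($M/G/1$ retrial queue with Bernoulli schedule). Customers arrive according to a Poisson process with rate $\lambda>0$ at a single-server system that has a (priority) queue of infinite capacity and an orbit. A customer who finds the server idle on arrival is served immediately. A customer who finds the server busy joins the queue (first-in-first-out) with probability $q$, or the orbit with probability $p=1-q$, where $0<q<1$. At a service completion, if the queue is non-empty the customer at its head starts service; otherwise the server becomes idle. Each customer in the orbit independently retries according to a Poisson process with rate $\mu>0$ until finding the server idle, and is then served immediately. Customers leave after service. All service times are i.i.d. copies of $T_\beta$ with distribution function $F_\beta$, $F_\beta(0)=0$, finite mean $\beta_1$, and Laplace-Stieltjes transform (LST) $\beta(s)=E(e^{-sT_\beta})$; arrivals, services, routing choices and retrials are independent. Parameters: $\lambda_1=\lambda q$, $\lambda_2=\lambda p$, $\rho_1=\lambda_1\beta_1$, $\rho_2=\lambda_2\beta_1$, $\rho=\rho_1+\rho_2=\lambda\beta_1$. The system is stable if and only if $\rho<1$, which is assumed. In steady state, $R_{que}$ is the number of customers in the queue (excluding the one in service), $R_{orb}$ is the number of customers in the orbit, and $I_{ser}=1$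 or $0$ according to whether the server is busy or idle. Known facts taken as the starting point (Choi and Park): $P\{I_{ser}=0\}=1-\rho$ and $$E(z_2^{R_{orb}}\mid I_{ser}=0)=R_0(z_2):=\exp\Big\{-\frac{\lambda}{\mu}\int_{z_2}^1\frac{1-h(u)}{h(u)-u}\,du\Big\},$$ where $h(z)$ is uniquely determined by $h(z)=\beta(\lambda-\lambda_1h(z)-\lambda_2z)$. Equivalently, $h(z)=\alpha(\lambda_2-\lambda_2z)$, where $\alpha$ is the LST of the busy period of the standard $M/G/1$ queue with arrival rate $\lambda_1$ and service time $T_\beta$, satisfying $\alpha(s)=\beta(s+\lambda_1-\lambda_1\alpha(s))$. A measurable $L:(0,\infty)\to(0,\infty)$ is slowly varying at $\infty$ if $\lim_{t\to\infty}L(xt)/L(t)=1$ for all $x>0$. The notation $f\sim g$ means $f/g\to1$. *)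

theory Defs
  imports "HOL-Probability.Probability" "HOL-Library.Landau_Symbols"
begin

definition slowly_varying :: "(real \<Rightarrow> real) \<Rightarrow> bool" where
  "slowly_varying L \<longleftrightarrow>
     L \<in> borel_measurable (restrict_space borel {0<..}) \<and>
     (\<forall>t>0. L t > 0) \<and>
     (\<forall>x>0. ((\<lambda>t. L (x * t) / L t) \<longlongrightarrow> 1) at_top)"

text \<open>
  The M/G/1 retrial queue with Bernoulli schedule as a Markov process. A state (i, m, n, x) consists
  of the server status i (1 busy, 0 idle), the number m of customers in the queue (the one in
  service excluded), the number n of customers in the orbit, and the remaining time x of the
  service in progress; m and x are 0 while the server is idle. The remaining service time is the
  supplementary variable that makes the process Markov for general service times. The identities and
  the order of the waiting customers need not be recorded: the services are i.i.d., so a service time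
  may be drawn at the moment the service starts.
\<close>

type_synonym state = "nat \<times> nat \<times> nat \<times> real"

definition queue_states :: "state set" where
  "queue_states = {(i, m, n, x). (i = 0 \<and> m = 0 \<and> x = 0) \<or> (i = 1 \<and> x > 0)}"

definition queue_space :: "state measure" where
  "queue_space = restrict_space
     (count_space UNIV \<Otimes>\<^sub>M count_space UNIV \<Otimes>\<^sub>M count_space UNIV \<Otimes>\<^sub>M borel) queue_states"

text \<open>
  Generator for arrival rate lam, probability q of joining the queue, retrial rate mu per customer in
  the orbit, and service time law B. In an idle state with n customers in the orbit, a service starts
  at rate lam (arrival, orbit unchanged) or n mu (retrial, one customer leaves the orbit); the new
  service time has law B. In a busy state the remaining service time decreases at unit speed and
  arrivals join the queue at rate lam q or the orbit at rate lam (1 - q). For n = 0 the truncated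
  difference n - 1 is harmless, since it is multiplied by n. The service completion, which happens
  when x reaches 0, is encoded in the boundary conditions of the test functions below.
\<close>

fun queue_generator ::
  "real \<Rightarrow> real \<Rightarrow> real \<Rightarrow> real measure \<Rightarrow> (state \<Rightarrow> real) \<Rightarrow> state \<Rightarrow> real" where
  "queue_generator lam q mu B f (i, m, n, x) =
     (if i = 0 then
        lam * ((\<integral>y. f (1, 0, n, y) \<partial>B) - f (0, 0, n, 0)) +
        real n * mu * ((\<integral>y. f (1, 0, n - 1, y) \<partial>B) - f (0, 0, n, 0))
      else
        - deriv (\<lambda>u. f (1, m, n, u)) x +
        lam * q * (f (1, m + 1, n, x) - f (1, m, n, x)) +
        lam * (1 - q) * (f (1, m, n + 1, x) - f (1, m, n, x)))"

text \<open>
  Test functions: bounded, smooth in the remaining service time, with bounded image under the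
  generator. Busy states with x = 0 are not visited; there f is its limit as x decreases to 0,
  which must agree with the state after the service completion: the server becomes idle if the queue
  is empty, and otherwise starts to serve the customer at the head of the queue.
\<close>

definition test_function ::
  "real \<Rightarrow> real \<Rightarrow> real \<Rightarrow> real measure \<Rightarrow> (state \<Rightarrow> real) \<Rightarrow> bool" where
  "test_function lam q mu B f \<longleftrightarrow>
     bounded (f ` queue_states) \<and>
     (\<forall>m n. (\<lambda>x. f (1, m, n, x)) \<in> borel_measurable borel \<and>
            continuous_on {0..} (\<lambda>x. f (1, m, n, x)) \<and>
            (\<lambda>x. f (1, m, n, x)) differentiable_on {0<..} \<and>
            continuous_on {0<..} (deriv (\<lambda>x. f (1, m, n, x)))) \<and>
     (\<forall>n. f (1, 0, n, 0) = f (0, 0, n, 0)) \<and>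
     (\<forall>m n. f (1, Suc m, n, 0) = (\<integral>y. f (1, m, n, y) \<partial>B)) \<and>
     bounded (queue_generator lam q mu B f ` queue_states)"

text \<open>
  P t s is the law at time t of the process started in s. The last condition is the Kolmogorov
  (Dynkin) equation, which says that the process has the dynamics described by the generator.
\<close>

definition retrial_queue_semigroup ::
  "real \<Rightarrow> real \<Rightarrow> real \<Rightarrow> real measure \<Rightarrow> (real \<Rightarrow> state \<Rightarrow> state measure) \<Rightarrow> bool" where
  "retrial_queue_semigroup lam q mu B P \<longleftrightarrow>
     (\<lambda>(t, s). P t s) \<in> restrict_space borel {0..} \<Otimes>\<^sub>M queue_space \<rightarrow>\<^sub>M prob_algebra queue_space \<and>
     (\<forall>s\<in>queue_states. P 0 s = return queue_space s) \<and>
     (\<forall>t\<ge>0. \<forall>u\<ge>0. \<forall>s\<in>queue_states. P (t + u) s = P t s \<bind> P u) \<and>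
     (\<forall>f. test_function lam q mu B f \<longrightarrow>
        (\<forall>t\<ge>0. \<forall>s\<in>queue_states.
           (\<integral>z. f z \<partial>P t s) =
             f s + (LBINT r:{0..t}. (\<integral>z. queue_generator lam q mu B f z \<partial>P r s))))"

text \<open>Steady state: a law that is invariant under the dynamics of the queue.\<close>

definition steady_state_law :: "(real \<Rightarrow> state \<Rightarrow> state measure) \<Rightarrow> state measure \<Rightarrow> bool" where
  "steady_state_law P D \<longleftrightarrow> D \<in> space (prob_algebra queue_space) \<and> (\<forall>t\<ge>0. D \<bind> P t = D)"

end

theory Submission
  imports Defs
begin

text \<open>
  Testing stationarity against \<open>f (i, m, n, x) = v^m z^n exp (- s x)\<close>, where \<open>v\<close> is the transform of the service
  time at \<open>s\<close>, and choosing \<open>s = \<lambda> - \<lambda>\<^sub>1 v - \<lambda>\<^sub>2 z\<close>, removes the busy states and leaves the differential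
  equation \<open>\<phi>' = (\<lambda> / \<mu>) \<kappa> \<phi>\<close> for the generating function of the orbit size in idle states. With \<open>b j = P (N > j)\<close>
  for the number \<open>N\<close> of arrivals during a service, \<open>B\<close> the generating function of \<open>b\<close>, and \<open>w\<close> the generating function
  of the number \<open>\<xi>\<close> of orbit customers descending from one arrival (\<open>w = q A(w) + p z\<close>), one has
  \<open>\<kappa> = p B(w) / (1 - B(w))\<close>. So \<open>\<kappa>\<close> is a mixture, with explicit weights \<open>e j\<close>, of the laws of the sums
  \<open>\<xi>\<^sub>1 + \<dots> + \<xi>\<^sub>j\<close>, and \<open>e j\<close> is asymptotic to \<open>b j / (1 - \<rho>)^2\<close>. The tail of \<open>\<kappa>\<close> is one order heavier than that
  of \<open>\<xi>\<close>, so a crude bound for \<open>\<xi>\<close>, obtained from \<open>P (\<xi> > n) \<le> \<kappa> n\<close> by a self-improving recursion, and the law of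
  large numbers determine it: it is the tail of \<open>e\<close> at \<open>n / E \<xi>\<close>. Finally the differential equation says that the
  size-biased law of the orbit is the convolution of \<open>\<kappa>\<close> with the law of the orbit, whose tail is lighter.
\<close>

section \<open>Regularly varying sequences\<close>

text \<open>The obstacle is a circle: the tail of \<kappa> requires control of sums of copies of
  \<xi>, hence of the tail of \<xi>, but \<xi> is known only through an implicit equation. It is
  broken by \<open>1 - w = p (1 - z) / (1 - q B(w))\<close>: this makes P(\<xi> > n) a mixture of
  the same kind as \<kappa>, with weights that are no larger from index 1 on. Since P(\<xi> > n)
  decreases in n, averaging it over [n/2, n] gains a factor of order 1/n against the tail sum of
  \<kappa>, and this gain makes the recursion contract. All weights are nonnegative, so series are
  rearranged freely and the argument stays with coefficients instead of inverting transforms.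

  Origin of the constant: a Poisson count concentrates at its mean, so \<open>b n\<close> is
  asymptotic to \<open>lam powr a\<close> times P(T > n); summing \<open>b\<close> over a tail
  contributes \<open>n / (a - 1)\<close>; evaluating that tail at \<open>n / E \<xi>\<close>
  contributes \<open>m powr (a - 1)\<close> with \<open>m = p / (1 - q * rho)\<close>; the weights
  and \<kappa> contribute \<open>p / (1 - rho)^2\<close>; the differential equation contributes
  \<open>lam / mu\<close>; removing the size bias contributes \<open>(a - 1) / (a * n)\<close>. The
  powers of \<open>p\<close> and \<open>lam\<close> combine to \<open>lam2 powr a\<close>, and
  \<open>q * rho\<close> is \<open>rho1\<close>.\<close>

lemma tannery_seq:
  fixes f :: "nat \<Rightarrow> nat \<Rightarrow> real"
  assumes lim: "\<And>k. (\<lambda>n. f k n) \<longlonglongrightarrow> g k"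
    and bound: "\<And>n k. n \<ge> n0 \<Longrightarrow> \<bar>f k n\<bar> \<le> M k"
    and M: "summable M"
  shows "(\<lambda>n. \<Sum>k. f k n) \<longlonglongrightarrow> (\<Sum>k. g k)" "summable g"
proof -
  have "eventually (\<lambda>(k,n). norm (f k n) \<le> M k) (at_top \<times>\<^sub>F sequentially)"
    unfolding eventually_prod_filter
    by (rule exI[of _ "\<lambda>_. True"], rule exI[of _ "\<lambda>n. n \<ge> n0"]) (use bound in auto)
  from tannerys_theorem[OF lim this M] show "(\<lambda>n. \<Sum>k. f k n) \<longlonglongrightarrow> (\<Sum>k. g k)" "summable g"
    by (auto intro: summable_norm_cancel)
qed

text \<open>Tonelli for double series, obtained from \<open>tannery_seq\<close>: the partial sums of
  row \<open>i\<close> are dominated by the row total \<open>s i\<close>.\<close>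

lemma sums_swap_nonneg:
  fixes f :: "nat \<Rightarrow> nat \<Rightarrow> real"
  assumes nonneg: "\<And>i j. f i j \<ge> 0" and row: "\<And>i. (\<lambda>j. f i j) sums s i" and s: "s sums S"
  shows "(\<lambda>j. \<Sum>i. f i j) sums S" and "\<And>j. summable (\<lambda>i. f i j)"
proof -
  have le: "f i j \<le> s i" for i j
  proof -
    have "f i j = sum (f i) {j}" by simp
    also have "\<dots> \<le> suminf (f i)"
      by (rule sum_le_suminf) (use row nonneg in \<open>auto simp: sums_iff\<close>)
    finally show ?thesis using row by (simp add: sums_iff)
  qed
  show sm: "summable (\<lambda>i. f i j)" for j
    by (rule summable_comparison_test'[where N=0 and g=s]) (use s le nonneg in \<open>auto simp: sums_iff\<close>)
  define F where "F i n = (\<Sum>j<n. f i j)" for i n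
  have "(\<lambda>n. \<Sum>i. F i n) \<longlonglongrightarrow> (\<Sum>i. s i)"
  proof (rule tannery_seq(1))
    show "(\<lambda>n. F i n) \<longlonglongrightarrow> s i" for i using row[of i] by (simp add: F_def sums_def)
    show "\<bar>F i n\<bar> \<le> s i" for i n
    proof -
      have "F i n \<le> suminf (f i)" unfolding F_def
        by (rule sum_le_suminf) (use row nonneg in \<open>auto simp: sums_iff\<close>)
      moreover have "F i n \<ge> 0" unfolding F_def by (rule sum_nonneg) (use nonneg in auto)
      ultimately show ?thesis using row by (simp add: sums_iff)
    qed
    show "summable s" using s by (simp add: sums_iff)
  qed
  moreover have "(\<Sum>i. F i n) = (\<Sum>j<n. \<Sum>i. f i j)" for n
    unfolding F_def by (rule suminf_sum) (rule sm)
  ultimately have "(\<lambda>n. \<Sum>j<n. \<Sum>i. f i j) \<longlonglongrightarrow> suminf s" by simp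
  then show "(\<lambda>j. \<Sum>i. f i j) sums S" unfolding sums_def using s by (simp add: sums_iff)
qed

text \<open>Regular variation of index -\<alpha>, restricted to decreasing sequences. Monotonicity
  is built in because it lets a ratio be evaluated along any index sequence \<open>k n\<close> with
  \<open>k n / n\<close> tending to \<open>u\<close>, not only along the floors.\<close>

definition reg_var :: "real \<Rightarrow> (nat \<Rightarrow> real) \<Rightarrow> bool" where
  "reg_var \<alpha> x \<longleftrightarrow> decseq x \<and> (\<forall>n. x n > 0) \<and>
     (\<forall>u>0. (\<lambda>n. x (nat \<lfloor>u * real n\<rfloor>) / x n) \<longlonglongrightarrow> u powr -\<alpha>)"

lemma reg_var_pos: "reg_var \<alpha> x \<Longrightarrow> x n > 0"
  by (simp add: reg_var_def)

lemma reg_var_mono: "reg_var \<alpha> x \<Longrightarrow> m \<le> n \<Longrightarrow> x n \<le> x m"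
  by (simp add: reg_var_def decseqD)

text \<open>For large n monotonicity traps \<open>F (k n)\<close> between the values of
  \<open>F\<close> at \<open>(u + d') * n\<close> and \<open>(u - d') * n\<close>, whose ratios to
  \<open>F n\<close> have known limits; continuity of \<open>v powr -\<alpha>\<close> at
  \<open>u\<close> closes the gap.\<close>

lemma antimono_ratio_sequence:
  fixes F :: "real \<Rightarrow> real"
  assumes F: "antimono F" "\<And>t. F t > 0"
    and limR: "\<And>v. v > 0 \<Longrightarrow> (\<lambda>n. F (v * real n) / F (real n)) \<longlonglongrightarrow> v powr -\<alpha>"
    and k: "(\<lambda>n. k n / real n) \<longlonglongrightarrow> u" and u: "u > 0"
  shows "(\<lambda>n. F (k n) / F (real n)) \<longlonglongrightarrow> u powr -\<alpha>"
proof -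
  have cont: "isCont (\<lambda>v. v powr -\<alpha>) u" using u by (intro continuous_intros) auto
  show ?thesis
  proof (rule LIMSEQ_I)
    fix e :: real assume e: "e > 0"
    obtain d where d: "d > 0" "\<And>v. \<bar>v - u\<bar> < d \<Longrightarrow> \<bar>v powr -\<alpha> - u powr -\<alpha>\<bar> < e / 2"
      using cont e unfolding continuous_at_eps_delta
      by (metis half_gt_zero dist_real_def)
    define d' where "d' = min (d/2) (u/2)"
    have d': "d' > 0" "d' < d" "d' < u" using d u by (auto simp: d'_def)
    have 1: "\<forall>\<^sub>F n in sequentially. \<bar>F ((u-d') * real n) / F (real n) - (u-d') powr -\<alpha>\<bar> < e/2"
      using tendstoD[OF limR[of "u - d'"], of "e/2"] d' e by (simp add: dist_real_def)
    have 2: "\<forall>\<^sub>F n in sequentially. \<bar>F ((u+d') * real n) / F (real n) - (u+d') powr -\<alpha>\<bar> < e/2"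
      using tendstoD[OF limR[of "u + d'"], of "e/2"] d' e u by (simp add: dist_real_def)
    have 3: "\<forall>\<^sub>F n in sequentially. \<bar>k n / real n - u\<bar> < d'"
      using tendstoD[OF k, of d'] d' by (simp add: dist_real_def)
    have "\<forall>\<^sub>F n in sequentially. \<bar>F (k n) / F (real n) - u powr -\<alpha>\<bar> < e"
      using 1 2 3 eventually_gt_at_top[of 0]
    proof eventually_elim
      case (elim n)
      have n: "real n > 0" using elim(4) by simp
      have "k n / real n < u + d'" "u - d' < k n / real n" using elim(3) by linarith+
      then have a: "(u - d') * real n \<le> k n" "k n \<le> (u + d') * real n"
        using n by (simp_all add: pos_less_divide_eq pos_divide_less_eq less_imp_le)
      have "F (k n) / F (real n) \<le> F ((u-d') * real n) / F (real n)"
        using antimonoD[OF F(1) a(1)] F(2)[of n] by (intro divide_right_mono) (auto intro: less_imp_le)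
      moreover have "F (k n) / F (real n) \<ge> F ((u+d') * real n) / F (real n)"
        using antimonoD[OF F(1) a(2)] F(2)[of n] by (intro divide_right_mono) (auto intro: less_imp_le)
      moreover have "\<bar>(u-d') powr -\<alpha> - u powr -\<alpha>\<bar> < e / 2" "\<bar>(u+d') powr -\<alpha> - u powr -\<alpha>\<bar> < e / 2"
        using d(2)[of "u-d'"] d(2)[of "u+d'"] d' by auto
      ultimately show ?case using elim(1,2) by linarith
    qed
    then show "\<exists>no. \<forall>n\<ge>no. norm (F (k n) / F (real n) - u powr - \<alpha>) < e"
      by (simp add: eventually_sequentially)
  qed
qed

lemma reg_var_ratio:
  assumes x: "reg_var \<alpha> x" and k: "(\<lambda>n. real (k n) / real n) \<longlonglongrightarrow> u" and u: "u > 0"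
  shows "(\<lambda>n. x (k n) / x n) \<longlonglongrightarrow> u powr -\<alpha>"
proof -
  have "(\<lambda>n. x (nat \<lfloor>real (k n)\<rfloor>) / x (nat \<lfloor>real n\<rfloor>)) \<longlonglongrightarrow> u powr -\<alpha>"
  proof (rule antimono_ratio_sequence[where F = "\<lambda>t. x (nat \<lfloor>t\<rfloor>)", OF _ _ _ k u])
    show "antimono (\<lambda>t. x (nat \<lfloor>t\<rfloor>))"
      by (intro antimonoI reg_var_mono[OF x] nat_mono floor_mono)
  qed (use x in \<open>auto simp: reg_var_def\<close>)
  then show ?thesis by simp
qed

lemma tendsto_floor_ratio:
  assumes "u > 0"
  shows "(\<lambda>n. real (nat \<lfloor>u * real n\<rfloor>) / real n) \<longlonglongrightarrow> u"
proof (rule tendsto_sandwich)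
  show "\<forall>\<^sub>F n in sequentially. u - 1 / real n \<le> real (nat \<lfloor>u * real n\<rfloor>) / real n"
    using eventually_gt_at_top[of 0]
  proof eventually_elim
    case (elim n)
    have "u * real n - 1 \<le> real (nat \<lfloor>u * real n\<rfloor>)" by linarith
    then have "(u * real n - 1) / real n \<le> real (nat \<lfloor>u * real n\<rfloor>) / real n"
      by (rule divide_right_mono) simp
    then show ?case using elim by (simp add: diff_divide_distrib)
  qed
  show "\<forall>\<^sub>F n in sequentially. real (nat \<lfloor>u * real n\<rfloor>) / real n \<le> u"
    using eventually_gt_at_top[of 0]
  proof eventually_elim
    case (elim n)
    have "u * real n \<ge> 0" using assms by simp
    then have "u * real n \<ge> real (nat \<lfloor>u * real n\<rfloor>)" by linarith
    then show ?case using elim by (simp add: field_simps)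
  qed
  have "(\<lambda>n. u - 1 / real n) \<longlonglongrightarrow> u - 0" by (intro tendsto_intros lim_1_over_n)
  then show "(\<lambda>n. u - 1 / real n) \<longlonglongrightarrow> u" by simp
qed simp

lemma filterlim_nat_floor:
  assumes "u > 0"
  shows "filterlim (\<lambda>n. nat \<lfloor>u * real n\<rfloor>) at_top sequentially"
proof -
  have "filterlim (\<lambda>n. u * real n) at_top sequentially"
    using assms by (intro filterlim_tendsto_pos_mult_at_top[OF tendsto_const] filterlim_real_sequentially) auto
  then show ?thesis
    by (intro filterlim_compose[OF filterlim_nat_sequentially] filterlim_compose[OF filterlim_floor_sequentially]) 
qed

lemma reg_var_shift:
  assumes "reg_var \<alpha> x"
  shows "(\<lambda>n. x (n - i) / x n) \<longlonglongrightarrow> 1"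
proof -
  have "(\<lambda>n. real (n - i) / real n) \<longlonglongrightarrow> 1"
  proof (rule Lim_transform_eventually)
    have "(\<lambda>n. 1 - real i * (1 / real n)) \<longlonglongrightarrow> 1 - real i * 0"
      by (intro tendsto_intros lim_1_over_n)
    then show "(\<lambda>n. 1 - real i * (1 / real n)) \<longlonglongrightarrow> 1" by simp
    show "\<forall>\<^sub>F n in sequentially. 1 - real i * (1 / real n) = real (n - i) / real n"
      using eventually_gt_at_top[of i] by eventually_elim (simp add: field_simps of_nat_diff)
  qed
  from reg_var_ratio[OF assms this] show ?thesis by simp
qed

lemma pow2_bracket:
  fixes n k :: nat
  assumes "n > 0" "n \<le> k"
  obtains i where "2^i * n \<le> k" "k < 2^Suc i * n"
proof -
  have ex: "\<exists>i. k < 2^i * n"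
  proof
    have "k < 2^k" by simp
    also have "2^k \<le> 2^k * n" using assms by simp
    finally show "k < 2^k*n" .
  qed
  define j where "j = (LEAST i. k < 2^i * n)"
  have j: "k < 2^j*n" unfolding j_def by (rule LeastI_ex[OF ex])
  have "j \<noteq> 0" using j assms by (cases j) auto
  then obtain i where ji: "j = Suc i" by (cases j) auto
  have "\<not> k < 2^i*n" using not_less_Least[of i "\<lambda>i. k < 2^i * n"] ji by (simp add: j_def)
  then show thesis using j ji that[of i] by simp
qed

text \<open>One half of Potter's bounds. The ratio \<open>x (2 * n) / x n\<close> is eventually
  below \<open>2 powr -\<alpha>'\<close>; this is iterated along doublings, and rounding
  \<open>k\<close> down to a power of two times \<open>n\<close> costs at most the factor
  \<open>2 powr \<alpha>'\<close>.\<close>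

lemma reg_var_potter_upper:
  assumes x: "reg_var \<alpha> x" and "\<alpha>' < \<alpha>" "0 \<le> \<alpha>'"
  obtains n0 where "n0 > 0" "\<And>n k. n0 \<le> n \<Longrightarrow> n \<le> k \<Longrightarrow> x k \<le> 2 powr \<alpha>' * (real k / real n) powr -\<alpha>' * x n"
proof -
  have pos: "x n > 0" for n using x by (simp add: reg_var_pos)
  have "(\<lambda>n. x (nat \<lfloor>2 * real n\<rfloor>) / x n) \<longlonglongrightarrow> 2 powr -\<alpha>"
    using x by (auto simp: reg_var_def)
  moreover have "(2::real) powr -\<alpha> < 2 powr -\<alpha>'" using assms by simp
  ultimately have "\<forall>\<^sub>F n in sequentially. x (nat \<lfloor>2 * real n\<rfloor>) / x n < 2 powr -\<alpha>'"
    by (rule order_tendstoD)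
  moreover have "nat \<lfloor>2 * real n\<rfloor> = 2 * n" for n by linarith
  ultimately have "\<forall>\<^sub>F n in sequentially. x (2 * n) / x n < 2 powr -\<alpha>'" by simp
  then have "\<forall>\<^sub>F n in sequentially. x (2 * n) \<le> 2 powr -\<alpha>' * x n"
    by eventually_elim (use pos in \<open>simp add: pos_divide_less_eq less_imp_le\<close>)
  then obtain n1 where n1: "\<And>n. n \<ge> n1 \<Longrightarrow> x (2 * n) \<le> 2 powr -\<alpha>' * x n"
    by (auto simp: eventually_sequentially)
  define n0 where "n0 = Suc n1"
  have iter: "x (2^k * n) \<le> (2 powr -\<alpha>')^k * x n" if "n \<ge> n0" for n k
  proof (induction k)
    case (Suc k)
    have "n \<le> 2^k * n" by simp
    then have "2^k * n \<ge> n1" using that unfolding n0_def by linarith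
    from n1[OF this] have "x (2^Suc k * n) \<le> 2 powr -\<alpha>' * x (2^k * n)" by (simp add: mult.assoc)
    also have "\<dots> \<le> 2 powr -\<alpha>' * ((2 powr -\<alpha>')^k * x n)" by (intro mult_left_mono Suc.IH) auto
    finally show ?case by (simp add: mult_ac)
  qed simp
  show thesis
  proof
    show "n0 > 0" by (simp add: n0_def)
    fix n k assume nk: "n0 \<le> n" "n \<le> k"
    have n: "n > 0" using nk by (simp add: n0_def)
    obtain i where i: "2^i * n \<le> k" "k < 2^Suc i * n" using pow2_bracket[OF n nk(2)] .
    have "x k \<le> x (2^i*n)" using x i by (intro reg_var_mono[OF x])
    also have "\<dots> \<le> (2 powr -\<alpha>')^i * x n" by (rule iter[OF nk(1)])
    also have "(2 powr -\<alpha>')^i = 2 powr \<alpha>' * (2^Suc i) powr -\<alpha>'"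
    proof -
      have "(2::real)^Suc i = 2 powr real (Suc i)" by (subst powr_realpow) auto
      then have "2 powr \<alpha>' * (2^Suc i) powr -\<alpha>' = 2 powr (\<alpha>' + real (Suc i) * - \<alpha>')"
        by (simp only: powr_powr powr_add)
      also have "\<dots> = 2 powr (-\<alpha>' * real i)" by (simp add: algebra_simps)
      also have "\<dots> = (2 powr -\<alpha>') powr real i" by (simp only: powr_powr)
      also have "\<dots> = (2 powr -\<alpha>')^i" by (subst powr_realpow) auto
      finally show ?thesis by simp
    qed
    also have "(2^Suc i) powr -\<alpha>' \<le> (real k / real n) powr -\<alpha>'"
    proof (rule powr_mono2')
      show "0 < real k / real n" using n nk by simp
      have "real k < real (2^Suc i*n)" using i(2) of_nat_less_iff by blast
      then show "real k / real n \<le> 2^Suc i" using n by (simp add: field_simps)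
    qed (use assms in auto)
    finally show "x k \<le> 2 powr \<alpha>' * (real k / real n) powr -\<alpha>' * x n" using pos[of n]
      by (simp add: mult_left_mono mult_right_mono)
  qed
qed

text \<open>The other half of Potter's bounds, by the same doublings. It is arranged to hold for all
  \<open>1 \<le> j \<le> n\<close> and not only eventually, because it is applied to quotients
  \<open>n div Suc k\<close> of every size.\<close>

lemma reg_var_potter_lower:
  assumes x: "reg_var \<alpha> x" and "\<alpha> < \<alpha>'" "0 \<le> \<alpha>'"
  obtains C where "C > 0" "\<And>j n. 1 \<le> j \<Longrightarrow> j \<le> n \<Longrightarrow> x j \<le> C * (real n / real j) powr \<alpha>' * x n"
proof -
  have pos: "x n > 0" for n using x by (simp add: reg_var_pos)
  have "(\<lambda>n. x (nat \<lfloor>2 * real n\<rfloor>) / x n) \<longlonglongrightarrow> 2 powr -\<alpha>"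
    using x by (auto simp: reg_var_def)
  moreover have "(2::real) powr -\<alpha>' < 2 powr -\<alpha>" using assms by simp
  ultimately have "\<forall>\<^sub>F n in sequentially. x (nat \<lfloor>2 * real n\<rfloor>) / x n > 2 powr -\<alpha>'"
    by (rule order_tendstoD)
  moreover have "nat \<lfloor>2 * real n\<rfloor> = 2 * n" for n by linarith
  ultimately have "\<forall>\<^sub>F n in sequentially. x (2 * n) / x n > 2 powr -\<alpha>'" by simp
  then have "\<forall>\<^sub>F n in sequentially. x n \<le> 2 powr \<alpha>' * x (2 * n)"
  proof eventually_elim
    case (elim n)
    then have "2 powr -\<alpha>' * x n < x (2 * n)" using pos[of n] by (simp only: pos_less_divide_eq)
    then have "2 powr \<alpha>' * (2 powr -\<alpha>' * x n) \<le> 2 powr \<alpha>' * x (2 * n)" by (intro mult_left_mono) auto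
    moreover have "2 powr \<alpha>' * (2 powr -\<alpha>' * x n) = x n" by (simp add: powr_minus)
    ultimately show ?case by (simp only:)
  qed
  then obtain n1 where n1: "\<And>n. n \<ge> n1 \<Longrightarrow> x n \<le> 2 powr \<alpha>' * x (2 * n)"
    by (auto simp: eventually_sequentially)
  define n0 where "n0 = Suc n1"
  have iter: "x n \<le> (2 powr \<alpha>')^k * x (2^k * n)" if "n \<ge> n0" for n k
  proof (induction k)
    case (Suc k)
    have "n \<le> 2^k * n" by simp
    then have "2^k * n \<ge> n1" using that unfolding n0_def by linarith
    from n1[OF this] have *: "x (2^k * n) \<le> 2 powr \<alpha>' * x (2^Suc k * n)" by (simp add: mult.assoc)
    note Suc.IH
    also have "(2 powr \<alpha>')^k * x (2^k * n) \<le> (2 powr \<alpha>')^k * (2 powr \<alpha>' * x (2^Suc k * n))"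
      by (intro mult_left_mono *) auto
    finally show ?case by (simp add: mult_ac)
  qed simp
  have main: "x j \<le> 2 powr \<alpha>' * (real n / real j) powr \<alpha>' * x n" if jn: "n0 \<le> j" "j \<le> n" for j n
  proof -
    have j0: "j > 0" using jn by (simp add: n0_def)
    obtain i where i: "2^i * j \<le> n" "n < 2^Suc i * j" using pow2_bracket[OF j0 jn(2)] .
    have "x j \<le> (2 powr \<alpha>')^Suc i * x (2^Suc i * j)" by (rule iter[OF jn(1)])
    also have "x (2^Suc i * j) \<le> x n" using i by (intro reg_var_mono[OF x]) simp
    also have "(2 powr \<alpha>')^Suc i = 2 powr \<alpha>' * (2^i) powr \<alpha>'"
    proof -
      have "((2::real)^i) = 2 powr real i" by (subst powr_realpow) auto
      then have "(2^i) powr \<alpha>' = (2 powr \<alpha>') powr real i" by (simp add: powr_powr mult.commute)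
      also have "\<dots> = (2 powr \<alpha>')^i" by (subst powr_realpow) auto
      finally show ?thesis by simp
    qed
    also have "(2^i) powr \<alpha>' \<le> (real n / real j) powr \<alpha>'"
    proof (rule powr_mono2)
      have "real (2^i*j) \<le> real n" using i(1) of_nat_le_iff by blast
      then show "2^i \<le> real n / real j" using j0 by (simp add: field_simps)
    qed (use assms in auto)
    finally show ?thesis using pos[of n] by (simp add: mult_left_mono mult_right_mono)
  qed
  \<comment> \<open>\<open>C0\<close> pays for the finitely many indices below \<open>n0\<close>:
    there \<open>x j \<le> x 0 = C0 * x n0\<close>, and the bound already proved applies from
    \<open>n0\<close> on.\<close>
  define C0 where "C0 = x 0 / x n0"
  have C0: "C0 \<ge> 1" unfolding C0_def using reg_var_mono[OF x, of 0 n0] pos[of n0] by simp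
  have x0: "x 0 = C0 * x n0" using pos[of n0] by (simp add: C0_def)
  have two: "(2::real) powr \<alpha>' \<ge> 1" using assms by (simp add: ge_one_powr_ge_zero)
  show thesis
  proof
    show "C0 * 2 powr \<alpha>' > 0" using C0 by simp
    fix j n :: nat assume jn: "1 \<le> j" "j \<le> n"
    consider "n0 \<le> j" | "j < n0" "n0 \<le> n" | "n < n0" by linarith
    then show "x j \<le> C0 * 2 powr \<alpha>' * (real n / real j) powr \<alpha>' * x n"
    proof cases
      case 1
      have "x j \<le> 1 * (2 powr \<alpha>' * (real n / real j) powr \<alpha>' * x n)" using main[OF 1 jn(2)] by simp
      also have "\<dots> \<le> C0 * (2 powr \<alpha>' * (real n / real j) powr \<alpha>' * x n)"
        by (rule mult_right_mono) (use C0 pos[of n] in auto)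
      finally show ?thesis by (simp add: mult_ac)
    next
      case 2
      have "x j \<le> x 0" by (intro reg_var_mono[OF x]) simp
      also have "\<dots> \<le> C0 * (2 powr \<alpha>' * (real n / real n0) powr \<alpha>' * x n)"
        unfolding x0 using C0 by (intro mult_left_mono main) (use 2 in auto)
      also have "\<dots> \<le> C0 * (2 powr \<alpha>' * (real n / real j) powr \<alpha>' * x n)"
        using 2 jn C0 pos[of n] assms
        by (intro mult_left_mono mult_right_mono powr_mono2 divide_left_mono) auto
      finally show ?thesis by (simp add: mult_ac)
    next
      case 3
      have "x j \<le> x 0" by (intro reg_var_mono[OF x]) simp
      also have "\<dots> \<le> C0 * (1 * x n)" unfolding x0 using C0 3
        by (intro mult_left_mono) (auto intro!: reg_var_mono[OF x])
      also have "\<dots> \<le> C0 * ((2 powr \<alpha>' * (real n / real j) powr \<alpha>') * x n)"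
      proof (intro mult_left_mono mult_right_mono)
        have "(real n / real j) powr \<alpha>' \<ge> 1" using jn assms by (intro ge_one_powr_ge_zero) auto
        then show "1 \<le> 2 powr \<alpha>' * (real n / real j) powr \<alpha>'" using two
          by (metis mult_mono mult_1 zero_le_one order_trans)
      qed (use C0 pos[of n] in auto)
      finally show ?thesis by (simp add: mult_ac)
    qed
  qed
qed

text \<open>The self-improving step. Since \<open>\<eta> n * x (k n) / x n\<close> tends to 0, it is
  below 1/2 in absolute value from some index on, and strong induction reproduces the bound. Taking
  \<open>Y \<ge> 2 * C\<close> leaves room for the inhomogeneous term; the sum of the first ratios
  in \<open>Y\<close> starts the induction.\<close>

lemma reg_var_recursion:
  assumes x: "reg_var \<alpha> x" and K: "\<And>n. K n \<ge> 0" and \<eta>: "\<eta> \<longlonglongrightarrow> 0"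
    and k: "\<And>n. n \<ge> n0 \<Longrightarrow> k n < n" and kr: "(\<lambda>n. real (k n) / real n) \<longlonglongrightarrow> u" "u > 0"
    and rec: "\<And>n. n \<ge> n0 \<Longrightarrow> K n \<le> \<eta> n * K (k n) + C * x n" and C: "C \<ge> 0"
  obtains Y where "Y \<ge> 0" "\<And>n. K n \<le> Y * x n"
proof -
  have pos: "x n > 0" for n using x by (simp add: reg_var_pos)
  have "(\<lambda>n. \<bar>\<eta> n\<bar> * (x (k n) / x n)) \<longlonglongrightarrow> \<bar>0\<bar> * u powr -\<alpha>"
    by (intro tendsto_intros \<eta> reg_var_ratio[OF x kr])
  then have "\<forall>\<^sub>F n in sequentially. \<bar>\<eta> n\<bar> * (x (k n) / x n) < 1/2"
    by (rule order_tendstoD) simp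
  then obtain n1 where n1: "\<And>n. n \<ge> n1 \<Longrightarrow> \<bar>\<eta> n\<bar> * (x (k n) / x n) < 1/2"
    by (auto simp: eventually_sequentially)
  define m where "m = max n0 n1"
  define Y where "Y = 2 * C + (\<Sum>n<m. K n / x n)"
  have sn: "(\<Sum>n<m. K n / x n) \<ge> 0" by (intro sum_nonneg divide_nonneg_pos K pos)
  have Y0: "Y \<ge> 0" "Y \<ge> 2 * C" using C sn by (auto simp: Y_def)
  have "K n \<le> Y * x n" for n
  proof (induction n rule: less_induct)
    case (less n)
    show ?case
    proof (cases "n < m")
      case True
      have "K n / x n \<le> (\<Sum>n<m. K n / x n)"
        by (rule member_le_sum) (use True K pos in \<open>auto intro: divide_nonneg_pos\<close>)
      also have "\<dots> \<le> Y" using C by (simp add: Y_def)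
      finally show ?thesis using pos[of n] by (simp add: pos_divide_le_eq)
    next
      case False
      then have n: "n \<ge> n0" "n \<ge> n1" by (auto simp: m_def)
      have "K n \<le> \<eta> n * K (k n) + C * x n" using rec n by blast
      also have "\<eta> n * K (k n) \<le> \<bar>\<eta> n\<bar> * (Y * x (k n))"
        using less[OF k[OF n(1)]] K by (intro mult_mono) auto
      also have "\<dots> = Y * (\<bar>\<eta> n\<bar> * (x (k n) / x n)) * x n" using pos[of n] by simp
      also have "\<dots> \<le> Y * (1/2) * x n"
        using n1[OF n(2)] Y0 pos[of n] by (intro mult_right_mono mult_left_mono) auto
      also have "C * x n \<le> Y / 2 * x n" using Y0 pos[of n] by (intro mult_right_mono) auto
      finally show ?thesis by (simp add: algebra_simps)
    qed
  qed
  with Y0 show thesis using that by blast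
qed

lemma reg_var_equiv:
  assumes x: "reg_var \<alpha> x" and y: "decseq y" "\<And>n. y n > 0" and lim: "(\<lambda>n. y n / x n) \<longlonglongrightarrow> c" and c: "c > 0"
  shows "reg_var \<alpha> y"
  unfolding reg_var_def
proof (intro conjI allI impI)
  have pos: "x n > 0" for n using x by (simp add: reg_var_pos)
  fix u :: real assume u: "u > 0"
  let ?k = "\<lambda>n. nat \<lfloor>u * real n\<rfloor>"
  have "(\<lambda>n. (y (?k n) / x (?k n)) * (x (?k n) / x n) / (y n / x n)) \<longlonglongrightarrow> c * u powr -\<alpha> / c"
    using x u c by (intro tendsto_intros lim filterlim_compose[OF lim filterlim_nat_floor]) (auto simp: reg_var_def)
  moreover have "(\<lambda>n. (y (?k n) / x (?k n)) * (x (?k n) / x n) / (y n / x n)) = (\<lambda>n. y (?k n) / y n)"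
  proof
    fix n
    have "x n \<noteq> 0" "x (?k n) \<noteq> 0" "y n \<noteq> 0" using pos[of n] pos[of "?k n"] y(2)[of n] by auto
    then show "(y (?k n) / x (?k n)) * (x (?k n) / x n) / (y n / x n) = y (?k n) / y n" by simp
  qed
  moreover have "c * u powr -\<alpha> / c = u powr -\<alpha>" using c by simp
  ultimately show "(\<lambda>n. y (?k n) / y n) \<longlonglongrightarrow> u powr -\<alpha>" by (simp only:)
qed (use y in auto)

text \<open>The summand at \<open>n\<close> belongs to the tail, so for a law with weights
  \<open>x\<close> the probability of exceeding \<open>n\<close> is
  \<open>tail_sum x (Suc n)\<close>.\<close>

definition tail_sum :: "(nat \<Rightarrow> real) \<Rightarrow> nat \<Rightarrow> real" where
  "tail_sum x n = (\<Sum>k. x (k + n))"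

lemma tail_sum_eq: "summable x \<Longrightarrow> tail_sum x n = suminf x - (\<Sum>k<n. x k)"
  unfolding tail_sum_def by (rule suminf_minus_initial_segment)

lemma tail_sum_Suc: "summable x \<Longrightarrow> tail_sum x n = x n + tail_sum x (Suc n)"
  by (simp add: tail_sum_eq)

lemma tail_sum_nonneg: "summable x \<Longrightarrow> (\<And>n. x n \<ge> 0) \<Longrightarrow> tail_sum x n \<ge> 0"
  unfolding tail_sum_def by (intro suminf_nonneg summable_ignore_initial_segment)

lemma tail_sum_antimono:
  assumes "summable x" "\<And>n. x n \<ge> 0" shows "decseq (tail_sum x)"
proof (rule decseq_SucI)
  show "tail_sum x (Suc n) \<le> tail_sum x n" for n
    using assms(2)[of n] tail_sum_Suc[OF assms(1), of n] by linarith
qed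

lemma tail_sum_pos: "summable x \<Longrightarrow> (\<And>n. x n > 0) \<Longrightarrow> tail_sum x n > 0"
  unfolding tail_sum_def by (intro suminf_pos summable_ignore_initial_segment) auto

text \<open>Limit comparison carried to tails: from some index on \<open>y\<close> differs from
  \<open>c * x\<close> by at most \<open>e/2 * x\<close>, and this error is summed. The case
  \<open>c = 0\<close> is included.\<close>

lemma tail_sum_equiv:
  assumes x: "summable x" "\<And>n. x n > 0" and lim: "(\<lambda>n. y n / x n) \<longlonglongrightarrow> c"
  shows "summable y" "(\<lambda>n. tail_sum y n / tail_sum x n) \<longlonglongrightarrow> c"
proof -
  have ev: "\<exists>n0. \<forall>n\<ge>n0. \<bar>y n - c * x n\<bar> \<le> e * x n" if "e > 0" for e
  proof -
    have "\<forall>\<^sub>F n in sequentially. dist (y n / x n) c < e" using tendstoD[OF lim that] .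
    then have "\<forall>\<^sub>F n in sequentially. \<bar>y n - c * x n\<bar> \<le> e * x n"
    proof eventually_elim
      case (elim n)
      have "y n - c * x n = (y n / x n - c) * x n" using x(2)[of n] by (simp add: left_diff_distrib)
      then have "\<bar>y n - c * x n\<bar> = \<bar>y n / x n - c\<bar> * x n"
        using x(2)[of n] by (simp add: abs_mult)
      also have "\<dots> \<le> e * x n" using elim x(2)[of n] by (intro mult_right_mono) (auto simp: dist_real_def)
      finally show ?case .
    qed
    then show ?thesis by (simp add: eventually_sequentially)
  qed
  obtain n1 where n1: "\<And>n. n \<ge> n1 \<Longrightarrow> \<bar>y n - c * x n\<bar> \<le> 1 * x n" using ev[of 1] by auto
  have "summable (\<lambda>n. y n - c * x n)"
    by (rule summable_comparison_test'[where g = x and N = n1]) (use n1 x in auto)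
  from summable_add[OF this summable_mult[OF x(1), of c]] show sy: "summable y" by simp
  show "(\<lambda>n. tail_sum y n / tail_sum x n) \<longlonglongrightarrow> c"
  proof (rule LIMSEQ_I)
    fix e :: real assume e: "e > 0"
    obtain n0 where n0: "\<And>n. n \<ge> n0 \<Longrightarrow> \<bar>y n - c * x n\<bar> \<le> e/2 * x n" using ev[of "e/2"] e by auto
    have "norm (tail_sum y n / tail_sum x n - c) < e" if "n \<ge> n0" for n
    proof -
      have tp: "tail_sum x n > 0" by (intro tail_sum_pos x)
      have sx: "summable (\<lambda>k. x (k + n))" and syn: "summable (\<lambda>k. y (k + n))"
        using x(1) sy by (auto intro: summable_ignore_initial_segment)
      have "tail_sum y n - c * tail_sum x n = (\<Sum>k. y (k + n) - c * x (k + n))"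
        unfolding tail_sum_def by (subst suminf_mult[symmetric, OF sx], subst suminf_diff) (use sx syn in \<open>auto intro: summable_mult\<close>)
      also have "\<bar>\<dots>\<bar> \<le> (\<Sum>k. \<bar>y (k + n) - c * x (k + n)\<bar>)"
        by (rule summable_rabs, rule summable_comparison_test'[where g = "\<lambda>k. e/2 * x (k+n)" and N = 0])
           (use sx n0 that in \<open>auto intro: summable_mult simp: trans_le_add2 trans_le_add1\<close>)
      also have "\<dots> \<le> (\<Sum>k. e/2 * x (k + n))"
        by (intro suminf_le summable_mult sx, use n0 that in force,
            rule summable_comparison_test'[where g = "\<lambda>k. e/2 * x (k+n)" and N = 0])
           (use sx n0 that in \<open>auto intro: summable_mult simp: trans_le_add2 trans_le_add1\<close>)
      also have "\<dots> = e/2 * tail_sum x n" unfolding tail_sum_def by (rule suminf_mult[OF sx])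
      finally have "\<bar>tail_sum y n - c * tail_sum x n\<bar> \<le> e/2 * tail_sum x n" .
      moreover have "tail_sum y n / tail_sum x n - c = (tail_sum y n - c * tail_sum x n) / tail_sum x n"
        using tp by (simp add: field_simps)
      ultimately have "norm (tail_sum y n / tail_sum x n - c) \<le> e/2"
        using tp by (simp add: pos_divide_le_eq)
      then show ?thesis using e by simp
    qed
    then show "\<exists>no. \<forall>n\<ge>no. norm (tail_sum y n / tail_sum x n - c) < e" by blast
  qed
qed

text \<open>A Riemann sum of \<open>v powr -\<alpha>\<close> over \<open>[1, \<infinity>)\<close> with mesh \<open>1 / N\<close>, compared with the integral by telescoping.\<close>

lemma riemann_powr_bounds:
  fixes \<alpha> :: real
  assumes \<alpha>: "\<alpha> > 1" and N: "N > (0::nat)"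
  defines "S \<equiv> (\<Sum>i. (1 + real i / real N) powr -\<alpha>)"
  shows "summable (\<lambda>i. (1 + real i / real N) powr -\<alpha>)"
    and "1 / (\<alpha> - 1) \<le> S / real N" and "(S - 1) / real N \<le> 1 / (\<alpha> - 1)"
proof -
  define G where "G v = v powr (1 - \<alpha>) / (\<alpha> - 1)" for v :: real
  define v where "v i = 1 + real i / real N" for i
  define h where "h = 1 / real N"
  have h: "h > 0" using N by (simp add: h_def)
  have vS: "v (Suc i) = v i + h" for i by (simp add: v_def h_def add_divide_distrib)
  have v1: "v i \<ge> 1" for i by (simp add: v_def)
  have mvt: "h * v (Suc i) powr -\<alpha> \<le> G (v i) - G (v (Suc i)) \<and> G (v i) - G (v (Suc i)) \<le> h * v i powr -\<alpha>" for i
  proof -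
    have "\<exists>z>v i. z < v (Suc i) \<and> G (v (Suc i)) - G (v i) = (v (Suc i) - v i) * (- (z powr -\<alpha>))"
    proof (rule MVT2)
      show "v i < v (Suc i)" using h by (simp add: vS)
      fix z assume "v i \<le> z" "z \<le> v (Suc i)"
      then have z: "z > 0" using v1[of i] by linarith
      have "DERIV G z :> (1 - \<alpha>) * z powr (1 - \<alpha> - 1) / (\<alpha> - 1)"
        unfolding G_def by (rule DERIV_cdivide, rule has_real_derivative_powr[OF z])
      moreover have "(1 - \<alpha>) * z powr (1 - \<alpha> - 1) / (\<alpha> - 1) = - (z powr -\<alpha>)"
      proof -
        have "(1 - \<alpha>) / (\<alpha> - 1) = -1" using \<alpha> by (simp add: divide_eq_eq)
        moreover have "(1 - \<alpha>) * z powr (1 - \<alpha> - 1) / (\<alpha> - 1) = (1 - \<alpha>) / (\<alpha> - 1) * z powr -\<alpha>" by simp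
        ultimately show ?thesis by simp
      qed
      ultimately show "DERIV G z :> - (z powr -\<alpha>)" by simp
    qed
    then obtain z where z: "z > v i" "z < v (Suc i)" "G (v i) - G (v (Suc i)) = h * z powr -\<alpha>"
      by (auto simp: vS algebra_simps)
    have "z powr -\<alpha> \<le> v i powr -\<alpha>" "v (Suc i) powr -\<alpha> \<le> z powr -\<alpha>"
      using z v1[of i] \<alpha> by (auto intro!: powr_mono2')
    then show ?thesis using z(3) h by simp
  qed
  have lim: "(\<lambda>i. G (v i)) \<longlonglongrightarrow> 0"
  proof -
    have "filterlim v at_top sequentially"
    proof -
      have "filterlim (\<lambda>i. 1 + h * real i) at_top sequentially"
        by (intro filterlim_tendsto_add_at_top[OF tendsto_const]
             filterlim_tendsto_pos_mult_at_top[OF tendsto_const h filterlim_real_sequentially])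
      then show ?thesis by (simp add: v_def[abs_def] h_def)
    qed
    then have "(\<lambda>i. v i powr (1 - \<alpha>)) \<longlonglongrightarrow> 0"
      using \<alpha> by (intro tendsto_neg_powr) auto
    from tendsto_divide[OF this tendsto_const, of "\<alpha> - 1"] show ?thesis using \<alpha> by (simp add: G_def)
  qed
  have tel: "(\<lambda>i. G (v i) - G (v (Suc i))) sums (1 / (\<alpha> - 1))"
    using telescope_sums'[OF lim] by (simp add: G_def v_def)
  have "summable (\<lambda>i. h * v (Suc i) powr -\<alpha>)"
    by (rule summable_comparison_test'[where N=0 and g="\<lambda>i. G (v i) - G (v (Suc i))"])
       (use tel mvt h in \<open>auto simp: sums_iff\<close>)
  from summable_mult[OF this, of "1 / h"] have sm': "summable (\<lambda>i. v (Suc i) powr -\<alpha>)" using h by simp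
  have sm: "summable (\<lambda>i. v i powr -\<alpha>)" using sm' summable_Suc_iff[of "\<lambda>i. v i powr -\<alpha>"] by blast
  then show "summable (\<lambda>i. (1 + real i / real N) powr -\<alpha>)" by (simp add: v_def)
  have S: "S = (\<Sum>i. v i powr -\<alpha>)" by (simp add: S_def v_def)
  have "1 / (\<alpha> - 1) \<le> (\<Sum>i. h * v i powr -\<alpha>)"
  proof (rule sums_le[OF _ tel summable_sums])
    show "summable (\<lambda>i. h * v i powr -\<alpha>)" by (intro summable_mult sm)
  qed (use mvt in blast)
  also have "\<dots> = S / real N" by (subst suminf_mult[OF sm]) (simp add: S h_def)
  finally show "1 / (\<alpha> - 1) \<le> S / real N" .
  have "(\<Sum>i. h * v (Suc i) powr -\<alpha>) \<le> 1 / (\<alpha> - 1)"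
  proof (rule sums_le[OF _ summable_sums tel])
    show "summable (\<lambda>i. h * v (Suc i) powr -\<alpha>)" by (intro summable_mult sm')
  qed (use mvt in blast)
  moreover have "(\<Sum>i. h * v (Suc i) powr -\<alpha>) = h * (S - 1)"
  proof -
    have "v 0 powr -\<alpha> = 1" by (simp add: v_def)
    then have "(\<Sum>i. v (Suc i) powr -\<alpha>) = S - 1" unfolding S using suminf_split_head[OF sm] by simp
    then show ?thesis using suminf_mult[OF sm'] by simp
  qed
  ultimately show "(S - 1) / real N \<le> 1 / (\<alpha> - 1)" by (simp add: h_def)
qed

text \<open>Potter's bound with an exponent strictly between 1 and \<alpha> compares
  \<open>x\<close> with a convergent power series of the form
  \<open>k powr -\<alpha>'\<close>.\<close>

lemma reg_var_summable:
  assumes x: "reg_var \<alpha> x" and \<alpha>: "\<alpha> > 1"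
  shows "summable x"
proof -
  define \<alpha>' where "\<alpha>' = (1 + \<alpha>) / 2"
  have \<alpha>': "1 < \<alpha>'" "\<alpha>' < \<alpha>" "0 \<le> \<alpha>'" using \<alpha> by (auto simp: \<alpha>'_def)
  obtain n0 where n0: "n0 > 0" "\<And>n k. n0 \<le> n \<Longrightarrow> n \<le> k \<Longrightarrow> x k \<le> 2 powr \<alpha>' * (real k / real n) powr -\<alpha>' * x n"
    using reg_var_potter_upper[OF x \<alpha>'(2,3)] by blast
  have "summable (\<lambda>k. 2 powr \<alpha>' * (real n0 powr \<alpha>') * x n0 * real k powr -\<alpha>')"
    using \<alpha>' by (intro summable_mult) (simp add: summable_real_powr_iff)
  then show ?thesis
  proof (rule summable_comparison_test'[where N = n0])
    fix k assume k: "k \<ge> n0"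
    have "x k \<le> 2 powr \<alpha>' * (real k / real n0) powr -\<alpha>' * x n0" using n0(2)[of n0 k] k by simp
    also have "(real k / real n0) powr -\<alpha>' = real n0 powr \<alpha>' * real k powr -\<alpha>'"
      by (subst powr_divide) (auto simp: powr_minus divide_inverse)
    finally show "norm (x k) \<le> 2 powr \<alpha>' * (real n0 powr \<alpha>') * x n0 * real k powr -\<alpha>'"
      using reg_var_pos[OF x, of k] by (simp add: mult_ac)
  qed
qed

text \<open>Karamata's theorem for sequences. The tail is cut into blocks of length about n/N; by
  monotonicity each block is between block length times its end values, and after division by
  \<open>x n\<close> these values converge to \<open>(1 + i / N) powr -\<alpha>\<close>. Potter's
  bound dominates the sum over blocks, which leaves a Riemann sum for the integral of
  \<open>v powr -\<alpha>\<close> over \<open>[1, \<infinity>)\<close>.\<close>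

lemma reg_var_karamata:
  assumes x: "reg_var \<alpha> x" and \<alpha>: "\<alpha> > 1"
  shows "(\<lambda>n. tail_sum x n / (real n * x n)) \<longlonglongrightarrow> 1 / (\<alpha> - 1)"
proof -
  have pos: "x n > 0" for n using x by (simp add: reg_var_pos)
  have smx: "summable x" by (rule reg_var_summable[OF x \<alpha>])
  define \<alpha>' where "\<alpha>' = (1 + \<alpha>) / 2"
  have \<alpha>': "1 < \<alpha>'" "\<alpha>' < \<alpha>" "0 \<le> \<alpha>'" using \<alpha> by (auto simp: \<alpha>'_def)
  obtain n0 where n0: "n0 > 0" "\<And>n k. n0 \<le> n \<Longrightarrow> n \<le> k \<Longrightarrow> x k \<le> 2 powr \<alpha>' * (real k / real n) powr -\<alpha>' * x n"
    using reg_var_potter_upper[OF x \<alpha>'(2,3)] by blast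
  \<comment> \<open>In the limit the lower and the upper block sum miss the integral by at most
    \<open>1 / N\<close> each; the second \<open>1 / N\<close> makes the inequalities strict, so
    that they hold eventually.\<close>
  have block: "\<forall>\<^sub>F n in sequentially. \<bar>tail_sum x n / (real n * x n) - 1 / (\<alpha> - 1)\<bar> \<le> 2 / real N" if N: "N > 0" for N :: nat
  proof -
    \<comment> \<open>Adding 1 ensures \<open>n \<le> N * l n\<close>, so block \<open>i\<close>
      starts no earlier than at \<open>(1 + i / N) * n\<close>; the domination needs this.\<close>
    define l where "l n = n div N + 1" for n
    define f where "f i n = x (n + i * l n) / x n" for i n
    define S where "S = (\<Sum>i. (1 + real i / real N) powr -\<alpha>)"
    have l_pos: "l n > 0" for n by (simp add: l_def)
    have l_lim: "(\<lambda>n. real (l n) / real n) \<longlonglongrightarrow> 1 / real N"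
    proof (rule tendsto_sandwich)
      show "\<forall>\<^sub>F n in sequentially. 1 / real N \<le> real (l n) / real n"
        using eventually_gt_at_top[of 0]
      proof eventually_elim
        case (elim n)
        have "n \<le> N * l n" using N unfolding l_def
          by (metis add.commute dividend_less_div_times less_imp_le_nat mult.commute mult_Suc_right plus_1_eq_Suc)
        then have "real n \<le> real N * real (l n)" by (metis of_nat_le_iff of_nat_mult)
        then show ?case using N elim by (simp add: field_simps)
      qed
      show "\<forall>\<^sub>F n in sequentially. real (l n) / real n \<le> 1 / real N + 1 / real n"
        using eventually_gt_at_top[of 0]
      proof eventually_elim
        case (elim n)
        have "real (n div N * N) \<le> real n" by (simp only: of_nat_le_iff div_times_less_eq_dividend)
        then have "real (n div N) \<le> real n / real N" using N by (simp add: le_divide_eq)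
        then have "real (l n) \<le> real n / real N + 1" by (simp add: l_def)
        then have "real (l n) / real n \<le> (real n / real N + 1) / real n" by (rule divide_right_mono) simp
        also have "\<dots> = 1 / real N + 1 / real n" using elim by (simp add: add_divide_distrib)
        finally show ?case .
      qed
      have "(\<lambda>n. 1 / real N + 1 / real n) \<longlonglongrightarrow> 1 / real N + 0" by (intro tendsto_intros lim_1_over_n)
      then show "(\<lambda>n. 1 / real N + 1 / real n) \<longlonglongrightarrow> 1 / real N" by simp
    qed simp
    have smS: "summable (\<lambda>i. (1 + real i / real N) powr -\<alpha>')" by (rule riemann_powr_bounds(1)[OF \<alpha>'(1) N])
    have smM: "summable (\<lambda>i. 2 powr \<alpha>' * (1 + real i / real N) powr -\<alpha>')" by (rule summable_mult[OF smS])
    have f_bound: "\<bar>f i n\<bar> \<le> 2 powr \<alpha>' * (1 + real i / real N) powr -\<alpha>'" if n: "n0 \<le> n" for i n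
    proof -
      have n': "n > 0" using n n0(1) by linarith
      have "x (n + i * l n) \<le> 2 powr \<alpha>' * (real (n + i * l n) / real n) powr -\<alpha>' * x n"
        using n0(2)[OF n, of "n + i * l n"] by simp
      also have "(real (n + i * l n) / real n) powr -\<alpha>' \<le> (1 + real i / real N) powr -\<alpha>'"
      proof (rule powr_mono2')
        have "n \<le> N * l n" using N unfolding l_def
          by (metis add.commute dividend_less_div_times less_imp_le_nat mult.commute mult_Suc_right plus_1_eq_Suc)
        then have "real n \<le> real N * real (l n)" by (metis of_nat_le_iff of_nat_mult)
        then have "real i * (1 / real N) \<le> real i * (real (l n) / real n)"
          using N n' by (intro mult_left_mono) (auto simp: field_simps)
        then show "1 + real i / real N \<le> real (n + i * l n) / real n" using n' by (simp add: add_divide_distrib)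
      qed (use \<alpha>' N in \<open>auto intro: add_pos_nonneg\<close>)
      finally show ?thesis unfolding f_def using pos[of n] pos[of "n + i * l n"]
        by (simp add: pos_divide_le_eq mult_left_mono mult_right_mono)
    qed
    have f_lim: "(\<lambda>n. f i n) \<longlonglongrightarrow> (1 + real i / real N) powr -\<alpha>" for i
      unfolding f_def
    proof (rule reg_var_ratio[OF x])
      have "(\<lambda>n. 1 + real i * (real (l n) / real n)) \<longlonglongrightarrow> 1 + real i * (1 / real N)"
        by (intro tendsto_intros l_lim)
      moreover have "\<forall>\<^sub>F n in sequentially. 1 + real i * (real (l n) / real n) = real (n + i * l n) / real n"
        using eventually_gt_at_top[of 0] by eventually_elim (simp add: add_divide_distrib)
      ultimately show "(\<lambda>n. real (n + i * l n) / real n) \<longlonglongrightarrow> 1 + real i / real N"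
        by (simp add: Lim_transform_eventually)
    qed (use N in \<open>auto intro: add_pos_nonneg\<close>)
    have F: "(\<lambda>n. \<Sum>i. f i n) \<longlonglongrightarrow> S" unfolding S_def
      by (rule tannery_seq(1)[OF f_lim f_bound smM])
    have bounds: "real (l n) / real n * ((\<Sum>i. f i n) - 1) \<le> tail_sum x n / (real n * x n)"
      "tail_sum x n / (real n * x n) \<le> real (l n) / real n * (\<Sum>i. f i n)" if n: "n \<ge> n0" for n
    proof -
      have n': "n > 0" using n n0(1) by linarith
      have smf: "summable (\<lambda>i. f i n)"
        by (rule summable_comparison_test'[OF smM, where N=0]) (use f_bound n in auto)
      have sf: "summable (\<lambda>i. x (n + i * l n))"
        using summable_mult[OF smf, of "x n"] pos[of n] by (simp add: f_def)
      have sf_val: "(\<Sum>i. x (n + i * l n)) = x n * (\<Sum>i. f i n)"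
        using suminf_mult[OF smf, of "x n"] pos[of n] by (simp add: f_def)
      have sm: "summable (\<lambda>k. x (k + n))" using smx by (rule summable_ignore_initial_segment)
      have grp: "(\<lambda>i. sum (\<lambda>k. x (k + n)) {i * l n..<i * l n + l n}) sums tail_sum x n"
        unfolding tail_sum_def using summable_sums[OF sm] by (rule sums_group) (rule l_pos)
      have up: "sum (\<lambda>k. x (k + n)) {i * l n..<i * l n + l n} \<le> real (l n) * x (n + i * l n)" for i
        using sum_bounded_above[of "{i * l n..<i * l n + l n}" "\<lambda>k. x (k + n)" "x (n + i * l n)"]
          reg_var_mono[OF x] by simp
      have lo: "sum (\<lambda>k. x (k + n)) {i * l n..<i * l n + l n} \<ge> real (l n) * x (n + Suc i * l n)" for i
        using sum_bounded_below[of "{i * l n..<i * l n + l n}" "x (n + Suc i * l n)" "\<lambda>k. x (k + n)"]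
          reg_var_mono[OF x] by simp
      have sf': "summable (\<lambda>i. x (n + Suc i * l n))"
        using sf summable_Suc_iff[of "\<lambda>i. x (n + i * l n)"] by blast
      have "tail_sum x n \<le> (\<Sum>i. real (l n) * x (n + i * l n))"
        by (rule sums_le[OF up grp summable_sums]) (intro summable_mult sf)
      also have "\<dots> = real (l n) * (x n * (\<Sum>i. f i n))" using suminf_mult[OF sf] sf_val by simp
      finally show "tail_sum x n / (real n * x n) \<le> real (l n) / real n * (\<Sum>i. f i n)"
        using pos[of n] n' by (simp add: pos_divide_le_eq mult_ac)
      have "(\<Sum>i. real (l n) * x (n + Suc i * l n)) \<le> tail_sum x n"
        by (rule sums_le[OF lo summable_sums grp]) (intro summable_mult sf')
      also have "(\<Sum>i. real (l n) * x (n + Suc i * l n)) = real (l n) * (\<Sum>i. x (n + Suc i * l n))"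
        by (rule suminf_mult[OF sf'])
      also have "(\<Sum>i. x (n + Suc i * l n)) = x n * (\<Sum>i. f i n) - x n"
        using suminf_split_head[OF sf] sf_val by simp
      finally have "real (l n) * (x n * ((\<Sum>i. f i n) - 1)) \<le> tail_sum x n" by (simp add: right_diff_distrib)
      then have "real (l n) * (x n * ((\<Sum>i. f i n) - 1)) / (real n * x n) \<le> tail_sum x n / (real n * x n)"
        by (rule divide_right_mono) (use pos[of n] in auto)
      then show "real (l n) / real n * ((\<Sum>i. f i n) - 1) \<le> tail_sum x n / (real n * x n)"
        using pos[of n] n' by simp
    qed
    have "(\<lambda>n. real (l n) / real n * ((\<Sum>i. f i n) - 1)) \<longlonglongrightarrow> 1 / real N * (S - 1)"
      by (intro tendsto_intros l_lim F)
    moreover have "1 / real N * (S - 1) > 1 / (\<alpha> - 1) - 2 / real N"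
    proof -
      have "1 / real N * (S - 1) = S / real N - 1 / real N" by (simp add: diff_divide_distrib)
      moreover have "1 / (\<alpha> - 1) \<le> S / real N" using riemann_powr_bounds(2)[OF \<alpha> N] by (simp add: S_def)
      moreover have "2 / real N = 1 / real N + 1 / real N" "1 / real N > 0" using N by auto
      ultimately show ?thesis by linarith
    qed
    ultimately have ev1: "\<forall>\<^sub>F n in sequentially. real (l n) / real n * ((\<Sum>i. f i n) - 1) > 1 / (\<alpha> - 1) - 2 / real N"
      by (rule order_tendstoD)
    have "(\<lambda>n. real (l n) / real n * (\<Sum>i. f i n)) \<longlonglongrightarrow> 1 / real N * S"
      by (intro tendsto_intros l_lim F)
    moreover have "1 / real N * S < 1 / (\<alpha> - 1) + 2 / real N"
    proof -
      have "(S - 1) / real N \<le> 1 / (\<alpha> - 1)" using riemann_powr_bounds(3)[OF \<alpha> N] by (simp add: S_def)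
      moreover have "1 / real N * S = (S - 1) / real N + 1 / real N" by (simp add: diff_divide_distrib)
      moreover have "2 / real N = 1 / real N + 1 / real N" "1 / real N > 0" using N by auto
      ultimately show ?thesis by linarith
    qed
    ultimately have ev2: "\<forall>\<^sub>F n in sequentially. real (l n) / real n * (\<Sum>i. f i n) < 1 / (\<alpha> - 1) + 2 / real N"
      by (rule order_tendstoD)
    show ?thesis using ev1 ev2 eventually_ge_at_top[of n0]
    proof eventually_elim
      case (elim n)
      show ?case using bounds[OF elim(3)] elim(1,2) by (simp only: abs_le_iff) linarith
    qed
  qed
  show ?thesis
  proof (rule LIMSEQ_I)
    fix e :: real assume e: "e > 0"
    obtain N where N: "2 / e < real N" using reals_Archimedean2 by blast
    have "0 < 2 / e" using e by simp
    then have "real N > 0" using N by linarith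
    then have N0: "N > 0" "2 / real N < e" using N e by (simp_all add: pos_divide_less_eq mult.commute)
    have "\<forall>\<^sub>F n in sequentially. norm (tail_sum x n / (real n * x n) - 1 / (\<alpha> - 1)) < e"
      using block[OF N0(1)] by eventually_elim (use N0(2) in simp)
    then show "\<exists>no. \<forall>n\<ge>no. norm (tail_sum x n / (real n * x n) - 1 / (\<alpha> - 1)) < e"
      by (simp add: eventually_sequentially)
  qed
qed

text \<open>By Karamata the tail is a constant times \<open>n * x n\<close> up to a factor tending
  to 1, and the extra factor \<open>n\<close> raises \<open>u powr -\<alpha>\<close> to
  \<open>u powr (1 - \<alpha>)\<close>.\<close>

lemma reg_var_tail_sum:
  assumes x: "reg_var \<alpha> x" and \<alpha>: "\<alpha> > 1"
  shows "reg_var (\<alpha> - 1) (tail_sum x)"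
  unfolding reg_var_def
proof (intro conjI allI impI)
  have pos: "x n > 0" for n using x by (simp add: reg_var_pos)
  have smx: "summable x" by (rule reg_var_summable[OF x \<alpha>])
  show "decseq (tail_sum x)" by (rule tail_sum_antimono[OF smx]) (use pos in \<open>auto intro: less_imp_le\<close>)
  show tpos: "tail_sum x n > 0" for n by (rule tail_sum_pos[OF smx pos])
  fix u :: real assume u: "u > 0"
  let ?k = "\<lambda>n. nat \<lfloor>u * real n\<rfloor>"
  let ?t = "\<lambda>n. tail_sum x n / (real n * x n)"
  have "(\<lambda>n. ?t (?k n) * (real (?k n) / real n) * (x (?k n) / x n) / ?t n) \<longlonglongrightarrow>
      1 / (\<alpha> - 1) * u * u powr -\<alpha> / (1 / (\<alpha> - 1))"
    using x u \<alpha> by (intro tendsto_intros reg_var_karamata tendsto_floor_ratio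
        filterlim_compose[OF reg_var_karamata filterlim_nat_floor]) (auto simp: reg_var_def)
  moreover have "1 / (\<alpha> - 1) * u * u powr -\<alpha> / (1 / (\<alpha> - 1)) = u powr -(\<alpha> - 1)"
  proof -
    have "u powr -(\<alpha> - 1) = u powr (1 + -\<alpha>)" by simp
    also have "\<dots> = u * u powr -\<alpha>" using u by (simp only: powr_add) simp
    finally show ?thesis using \<alpha> by simp
  qed
  moreover have "\<forall>\<^sub>F n in sequentially. ?t (?k n) * (real (?k n) / real n) * (x (?k n) / x n) / ?t n
      = tail_sum x (?k n) / tail_sum x n"
    using eventually_gt_at_top[of 0] eventually_compose_filterlim[OF eventually_gt_at_top[of 0] filterlim_nat_floor[OF u]]
  proof eventually_elim
    case (elim n)
    have "?t m * (real m / real n) * (x m / x n) / ?t n = tail_sum x m / tail_sum x n" if "m > 0" for m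
    proof -
      have "x n \<noteq> 0" "x m \<noteq> 0" "tail_sum x n \<noteq> 0" "real m \<noteq> 0" "real n \<noteq> 0"
        using pos[of n] pos[of m] tpos[of n] elim that by auto
      then show ?thesis by simp
    qed
    from this[OF elim(2)] show ?case .
  qed
  ultimately show "(\<lambda>n. tail_sum x (?k n) / tail_sum x n) \<longlonglongrightarrow> u powr -(\<alpha> - 1)"
    using Lim_transform_eventually by fastforce
qed

text \<open>Comparison sequence for the correction term of a summation by parts in
  \<open>tail_of_size_biased\<close>. The shift by 1 keeps it positive and decreasing from index 0
  on.\<close>

lemma reg_var_divide_Suc_power2:
  assumes x: "reg_var \<alpha> x"
  shows "reg_var (\<alpha> + 2) (\<lambda>n. x n / (real n + 1)\<^sup>2)"
  unfolding reg_var_def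
proof (intro conjI allI impI)
  have pos: "x n > 0" for n using x by (simp add: reg_var_pos)
  show "decseq (\<lambda>n. x n / (real n + 1)\<^sup>2)"
  proof (rule decseq_SucI)
    fix n
    show "x (Suc n) / (real (Suc n) + 1)\<^sup>2 \<le> x n / (real n + 1)\<^sup>2"
      using reg_var_mono[OF x, of n "Suc n"] pos[of "Suc n"] by (intro frac_le power_mono) auto
  qed
  show "0 < x n / (real n + 1)\<^sup>2" for n using pos by simp
  fix u :: real assume u: "u > 0"
  let ?k = "\<lambda>n. nat \<lfloor>u * real n\<rfloor>"
  have r: "(\<lambda>n. (real (?k n) + 1) / (real n + 1)) \<longlonglongrightarrow> u"
  proof -
    have "(\<lambda>n. (real (?k n) / real n + 1 / real n) / (1 + 1 / real n)) \<longlonglongrightarrow> (u + 0) / (1 + 0)"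
      by (intro tendsto_intros tendsto_floor_ratio u lim_1_over_n) auto
    moreover have "\<forall>\<^sub>F n in sequentially. (real (?k n) / real n + 1 / real n) / (1 + 1 / real n) = (real (?k n) + 1) / (real n + 1)"
      using eventually_gt_at_top[of 0]
    proof eventually_elim
      case (elim n)
      have "(real (?k n) / real n + 1 / real n) = (real (?k n) + 1) / real n" "1 + 1 / real n = (real n + 1) / real n"
        using elim by (auto simp: add_divide_distrib)
      then show ?case using elim by simp
    qed
    ultimately show ?thesis using Lim_transform_eventually by fastforce
  qed
  have "(\<lambda>n. (x (?k n) / x n) / ((real (?k n) + 1) / (real n + 1))\<^sup>2) \<longlonglongrightarrow> u powr -\<alpha> / u\<^sup>2"
    using x u by (intro tendsto_intros r) (auto simp: reg_var_def)
  moreover have "u powr -\<alpha> / u\<^sup>2 = u powr -(\<alpha> + 2)"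
  proof -
    have "u powr -(\<alpha> + 2) = u powr (-\<alpha> - 2)" by simp
    also have "\<dots> = u powr -\<alpha> / u powr 2" by (rule powr_diff)
    also have "u powr 2 = u\<^sup>2" using u by (simp add: powr_numeral)
    finally show ?thesis by simp
  qed
  moreover have "(\<lambda>n. (x (?k n) / x n) / ((real (?k n) + 1) / (real n + 1))\<^sup>2)
      = (\<lambda>n. x (?k n) / (real (?k n) + 1)\<^sup>2 / (x n / (real n + 1)\<^sup>2))"
    by (simp add: power_divide field_simps)
  ultimately show "(\<lambda>n. x (?k n) / (real (?k n) + 1)\<^sup>2 / (x n / (real n + 1)\<^sup>2)) \<longlonglongrightarrow> u powr -(\<alpha> + 2)"
    by (simp only:)
qed

section \<open>Size-biased laws\<close>

lemma bounded_ratio: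
  assumes "(\<lambda>n. y n / x n) \<longlonglongrightarrow> (c::real)" "\<And>n. x n > 0"
  obtains C where "C > 0" "\<And>n::nat. \<bar>y n\<bar> \<le> C * x n"
proof -
  from assms(1) have "Bseq (\<lambda>n. y n / x n)" by (intro convergent_imp_Bseq) (auto simp: convergent_def)
  then obtain C where C: "C > 0" "\<And>n. norm (y n / x n) \<le> C" by (auto elim: BseqE)
  show thesis
  proof
    show "\<bar>y n\<bar> \<le> C * x n" for n using C(2)[of n] assms(2)[of n] by (simp add: abs_divide pos_divide_le_eq)
  qed (fact C(1))
qed

lemma tendsto_diff_floor_ratio:
  assumes "0 < u" "u < 1"
  shows "(\<lambda>n. real (n - nat \<lfloor>u * real n\<rfloor>) / real n) \<longlonglongrightarrow> 1 - u"
proof -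
  have "(\<lambda>n. 1 - real (nat \<lfloor>u * real n\<rfloor>) / real n) \<longlonglongrightarrow> 1 - u"
    by (intro tendsto_intros tendsto_floor_ratio assms)
  moreover have "\<forall>\<^sub>F n in sequentially. 1 - real (nat \<lfloor>u * real n\<rfloor>) / real n = real (n - nat \<lfloor>u * real n\<rfloor>) / real n"
    using eventually_gt_at_top[of 0]
  proof eventually_elim
    case (elim n)
    have "u * real n \<le> 1 * real n" using assms by (intro mult_right_mono) auto
    then have "nat \<lfloor>u * real n\<rfloor> \<le> n" by linarith
    then show ?case using elim by (simp add: of_nat_diff diff_divide_distrib del: of_nat_nat)
  qed
  ultimately show ?thesis using Lim_transform_eventually by fastforce
qed

lemma div2_ratio:
  shows "(\<lambda>n. real (n - n div 2) / real n) \<longlonglongrightarrow> 1 / 2" and "(\<lambda>n. real (n div 2) / real n) \<longlonglongrightarrow> 1 / 2"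
proof -
  have e: "nat \<lfloor>1/2 * real n\<rfloor> = n div 2" for n using floor_divide_of_nat_eq[of n 2, where 'a=real] by simp
  show "(\<lambda>n. real (n - n div 2) / real n) \<longlonglongrightarrow> 1 / 2" using tendsto_diff_floor_ratio[of "1/2"] unfolding e by simp
  show "(\<lambda>n. real (n div 2) / real n) \<longlonglongrightarrow> 1 / 2" using tendsto_floor_ratio[of "1/2"] unfolding e by simp
qed

text \<open>In the tail of a convolution the truncated difference \<open>x - k\<close> is the right index: for \<open>k > x\<close> it is \<open>0\<close>.\<close>

lemma tail_sum_convolution:
  fixes \<kappa> r :: "nat \<Rightarrow> real"
  assumes \<kappa>: "\<And>n. \<kappa> n \<ge> 0" "summable \<kappa>" and r: "\<And>n. r n \<ge> 0" "summable r"
  defines "y \<equiv> \<lambda>n. \<Sum>i\<le>n. \<kappa> i * r (n - i)"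
  shows "summable y" and "tail_sum y x = (\<Sum>k. r k * tail_sum \<kappa> (x - k))"
    and "summable (\<lambda>k. r k * tail_sum \<kappa> (x - k))"
proof -
  show sy: "summable y"
    unfolding y_def by (rule summable_Cauchy_product) (use \<kappa> r in auto)
  have K_dec: "tail_sum \<kappa> i \<le> tail_sum \<kappa> 0" for i
    using tail_sum_antimono[OF \<kappa>(2,1)] by (simp add: decseqD)
  show smK: "summable (\<lambda>k. r k * tail_sum \<kappa> (x - k))"
    by (rule summable_comparison_test'[where g = "\<lambda>k. r k * tail_sum \<kappa> 0" and N = 0])
       (use r K_dec tail_sum_nonneg[OF \<kappa>(2,1)] in \<open>auto intro: summable_mult2 mult_left_mono\<close>)
  define f where "f k j = (if k \<le> x + j then r k * \<kappa> (x + j - k) else 0)" for k j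
  have row: "(\<lambda>j. f k j) sums (r k * tail_sum \<kappa> (x - k))" for k
  proof (cases "k \<le> x")
    case True
    have "(\<lambda>j. \<kappa> (j + (x - k))) sums tail_sum \<kappa> (x - k)"
      unfolding tail_sum_def by (intro summable_sums summable_ignore_initial_segment \<kappa>)
    from sums_mult[OF this, of "r k"] show ?thesis
      using True by (simp add: f_def add.commute)
  next
    case False
    have "(\<lambda>j. f k (j + (k - x))) sums (r k * tail_sum \<kappa> 0)"
      using False sums_mult[OF summable_sums[OF \<kappa>(2)], of "r k"] by (simp add: f_def tail_sum_def)
    moreover have "f k j = 0" if "j < k - x" for j using that False by (auto simp: f_def)
    ultimately have "f k sums (r k * tail_sum \<kappa> 0)" by (subst (asm) sums_zero_iff_shift) auto
    then show ?thesis using False by simp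
  qed
  have "(\<lambda>j. \<Sum>k. f k j) sums (\<Sum>k. r k * tail_sum \<kappa> (x - k))"
    by (rule sums_swap_nonneg(1)[OF _ row summable_sums[OF smK]]) (use \<kappa> r in \<open>auto simp: f_def\<close>)
  moreover have "(\<Sum>k. f k j) = y (j + x)" for j
  proof -
    have "(\<Sum>k. f k j) = (\<Sum>k\<in>{..x + j}. f k j)"
      by (rule suminf_finite) (auto simp: f_def)
    also have "\<dots> = (\<Sum>k\<le>x + j. r k * \<kappa> (x + j - k))" by (rule sum.cong) (auto simp: f_def)
    also have "\<dots> = (\<Sum>i\<le>x + j. \<kappa> i * r (x + j - i))"
      by (rule sum.reindex_bij_witness[of _ "\<lambda>i. x + j - i" "\<lambda>i. x + j - i"]) auto
    finally show ?thesis by (simp add: y_def add.commute)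
  qed
  ultimately show "tail_sum y x = (\<Sum>k. r k * tail_sum \<kappa> (x - k))"
    unfolding tail_sum_def[of y] by (simp add: sums_iff)
qed

text \<open>Write \<open>M\<close> for the tail of the size-biased weights, \<open>K\<close> for
  that of \<kappa> and \<open>R\<close> for that of \<open>r\<close>. Convolving with a law on the
  naturals only moves mass to the right, which gives \<open>M \<ge> \<nu> * K\<close>; conversely a
  shift beyond \<open>l\<close> has probability \<open>R l\<close>. A Markov inequality bounds
  \<open>R l\<close> by \<open>M l / Suc l\<close>, which turns the upper bound into a recursion for
  \<open>M\<close> with vanishing coefficient. Hence \<open>M = O(X)\<close>, so \<open>R\<close> at
  \<epsilon> n is of order \<open>X n / n\<close> and drops out.\<close>

lemma size_biased_tail:
  fixes \<kappa> r X :: "nat \<Rightarrow> real"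
  assumes X: "reg_var \<beta> X"
    and \<kappa>: "\<And>n. \<kappa> n \<ge> 0" "summable \<kappa>" and lim: "(\<lambda>n. tail_sum \<kappa> n / X n) \<longlonglongrightarrow> c"
    and r: "\<And>n. r n \<ge> 0" "r sums 1" and \<nu>: "\<nu> > 0"
    and rec: "\<And>n. real (Suc n) * r (Suc n) = \<nu> * (\<Sum>i\<le>n. \<kappa> i * r (n - i))"
  shows "(\<lambda>n. tail_sum (\<lambda>n. real (Suc n) * r (Suc n)) n / X n) \<longlonglongrightarrow> \<nu> * c"
    and "summable (\<lambda>n. real (Suc n) * r (Suc n))"
proof -
  have pos: "X n > 0" for n using X by (simp add: reg_var_pos)
  define y where "y = (\<lambda>n. \<Sum>i\<le>n. \<kappa> i * r (n - i))"
  define z where "z = (\<lambda>n. real (Suc n) * r (Suc n))"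
  have zy: "z = (\<lambda>n. \<nu> * y n)" using rec by (auto simp: z_def y_def)
  have sr: "summable r" "suminf r = 1" using r(2) by (auto simp: sums_iff)
  note conv = tail_sum_convolution[OF \<kappa> r(1) sr(1), folded y_def]
  show smz: "summable z" unfolding zy by (intro summable_mult conv)
  define K where "K = tail_sum \<kappa>"
  define M where "M = tail_sum z"
  have K0: "K n \<ge> 0" for n unfolding K_def by (rule tail_sum_nonneg[OF \<kappa>(2,1)])
  have z0: "z n \<ge> 0" for n using r(1) by (simp add: z_def)
  have M0: "M n \<ge> 0" for n unfolding M_def by (rule tail_sum_nonneg[OF smz z0])
  have Kdec: "K n \<le> K m" if "m \<le> n" for m n
    using tail_sum_antimono[OF \<kappa>(2,1)] that unfolding K_def by (simp add: decseqD)
  have M: "M x = \<nu> * (\<Sum>k. r k * K (x - k))" for x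
  proof -
    have "tail_sum (\<lambda>n. \<nu> * y n) x = \<nu> * tail_sum y x"
      unfolding tail_sum_def by (rule suminf_mult) (intro summable_ignore_initial_segment conv)
    then show ?thesis unfolding M_def zy K_def conv(2) .
  qed
  have smK: "summable (\<lambda>k. r k * K (x - k))" for x unfolding K_def by (rule conv(3))
  define R where "R n = tail_sum r (Suc n)" for n
  have lower: "M x \<ge> \<nu> * K x" for x
  proof -
    have "(\<Sum>k. r k * K x) \<le> (\<Sum>k. r k * K (x - k))"
      by (intro suminf_le smK summable_mult2 sr) (use r Kdec in \<open>auto intro: mult_left_mono\<close>)
    moreover have "(\<Sum>k. r k * K x) = K x" using suminf_mult2[OF sr(1), of "K x"] sr(2) by simp
    ultimately show ?thesis unfolding M using \<nu> by simp
  qed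
  \<comment> \<open>Shifts \<open>k \<le> l\<close> leave the argument of \<open>K\<close> at least
    \<open>x - l\<close>; larger shifts have total weight \<open>R l\<close>, and there
    \<open>K\<close> is bounded by \<open>K 0\<close>.\<close>
  have upper: "M x \<le> \<nu> * (K (x - l) + K 0 * R l)" for x l
  proof -
    have "(\<Sum>k. r k * K (x - k)) = (\<Sum>k. r (k + Suc l) * K (x - (k + Suc l))) + (\<Sum>k<Suc l. r k * K (x - k))"
      by (rule suminf_split_initial_segment[OF smK])
    also have "(\<Sum>k<Suc l. r k * K (x - k)) \<le> (\<Sum>k<Suc l. r k * K (x - l))"
      by (intro sum_mono mult_left_mono Kdec r) auto
    also have "\<dots> = (\<Sum>k<Suc l. r k) * K (x - l)" by (rule sum_distrib_right[symmetric])
    also have "(\<Sum>k<Suc l. r k) \<le> 1"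
      unfolding sr(2)[symmetric] by (rule sum_le_suminf) (use sr r in auto)
    also have "(\<Sum>k. r (k + Suc l) * K (x - (k + Suc l))) \<le> (\<Sum>k. r (k + Suc l) * K 0)"
      by (rule suminf_le)
         (use r Kdec smK sr in \<open>auto intro!: mult_left_mono summable_mult2 simp: summable_iff_shift[of r]
            summable_iff_shift[of "\<lambda>k. r k * K (x - k)" "Suc l"] simp del: add_Suc_right\<close>)
    also have "\<dots> = R l * K 0" unfolding R_def tail_sum_def
      by (rule suminf_mult2[symmetric]) (use sr in \<open>simp only: summable_iff_shift\<close>)
    finally have "(\<Sum>k. r k * K (x - k)) \<le> R l * K 0 + 1 * K (x - l)" using K0 by (simp add: mult_right_mono)
    then show ?thesis unfolding M using \<nu> by (intro mult_left_mono) (auto simp: mult.commute add.commute)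
  qed
  \<comment> \<open>Markov's inequality: every summand of \<open>R l\<close> has index at least
    \<open>Suc l\<close>.\<close>
  have R_le: "R l \<le> M l / real (Suc l)" for l
  proof -
    have "real (Suc l) * R l = (\<Sum>k. real (Suc l) * r (k + Suc l))"
      unfolding R_def tail_sum_def by (rule suminf_mult[symmetric]) (use sr in \<open>simp only: summable_iff_shift\<close>)
    also have "\<dots> \<le> (\<Sum>k. z (k + l))"
    proof (rule suminf_le)
      show "real (Suc l) * r (k + Suc l) \<le> z (k + l)" for k
        using r(1) by (auto simp: z_def intro: mult_right_mono)
      show "summable (\<lambda>k. real (Suc l) * r (k + Suc l))"
        by (intro summable_mult summable_ignore_initial_segment[OF sr(1), of "Suc l"])
      show "summable (\<lambda>k. z (k + l))" by (rule summable_ignore_initial_segment[OF smz])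
    qed
    finally show ?thesis by (simp add: M_def tail_sum_def field_simps)
  qed
  obtain C1 where C1: "C1 > 0" "\<And>n. \<bar>K n\<bar> \<le> C1 * X n" using bounded_ratio[OF lim pos] unfolding K_def by blast
  obtain C2 where C2: "C2 > 0" "\<And>n. \<bar>X (n - n div 2)\<bar> \<le> C2 * X n"
    using bounded_ratio[OF reg_var_ratio[OF X div2_ratio(1)] pos] by auto
  \<comment> \<open>The upper bound with \<open>l = n div 2\<close>; regular variation returns
    \<open>X (n - n div 2)\<close> to a multiple of \<open>X n\<close>.\<close>
  have Mrec: "M n \<le> (\<nu> * K 0 / real (Suc (n div 2))) * M (n div 2) + (\<nu> * C1 * C2) * X n" for n
  proof -
    have "M n \<le> \<nu> * (K (n - n div 2) + K 0 * R (n div 2))" by (rule upper)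
    also have "\<dots> \<le> \<nu> * (C1 * (C2 * X n) + K 0 * (M (n div 2) / real (Suc (n div 2))))"
    proof (intro mult_left_mono add_mono R_le K0)
      have "K (n - n div 2) \<le> C1 * X (n - n div 2)" using C1(2)[of "n - n div 2"] by simp
      also have "\<dots> \<le> C1 * (C2 * X n)" using C1(1) C2(2)[of n] by (intro mult_left_mono) auto
      finally show "K (n - n div 2) \<le> C1 * (C2 * X n)" .
    qed (use \<nu> in auto)
    finally show ?thesis by (simp add: algebra_simps)
  qed
  have \<eta>: "(\<lambda>n. \<nu> * K 0 / real (Suc (n div 2))) \<longlonglongrightarrow> 0"
  proof -
    have "filterlim (\<lambda>n::nat. Suc (n div 2)) at_top sequentially"
      by (rule filterlim_compose[OF filterlim_Suc filterlim_at_top_div_const_nat]) simp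
    then have "filterlim (\<lambda>n::nat. real (Suc (n div 2))) at_top sequentially"
      by (rule filterlim_compose[OF filterlim_real_sequentially])
    then show ?thesis by (rule real_tendsto_divide_at_top[OF tendsto_const])
  qed
  obtain Y where Y: "Y \<ge> 0" "\<And>n. M n \<le> Y * X n"
    using reg_var_recursion[of \<beta> X M "\<lambda>n. \<nu> * K 0 / real (Suc (n div 2))" 1 "\<lambda>n. n div 2" "1/2" "\<nu> * C1 * C2",
      OF X M0 \<eta> _ div2_ratio(2) _ Mrec] C1 C2 \<nu> by auto
  show "(\<lambda>n. tail_sum z n / X n) \<longlonglongrightarrow> \<nu> * c"
  proof (rule LIMSEQ_I)
    fix e :: real assume e: "e > 0"
    have "((\<lambda>\<epsilon>. \<nu> * (c * (1 - \<epsilon>) powr -\<beta>)) \<longlongrightarrow> \<nu> * (c * (1 - 0) powr -\<beta>)) (at_right 0)"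
      by (intro tendsto_intros) auto
    then have "\<forall>\<^sub>F \<epsilon> in at_right 0. \<nu> * (c * (1 - \<epsilon>) powr -\<beta>) < \<nu> * c + e"
      by (rule order_tendstoD) (use e in simp)
    moreover have "\<forall>\<^sub>F \<epsilon> in at_right 0. \<epsilon> \<in> {0<..<1::real}" by (rule eventually_at_right_real) simp
    ultimately have "\<forall>\<^sub>F \<epsilon> in at_right 0. \<nu> * (c * (1 - \<epsilon>) powr -\<beta>) < \<nu> * c + e \<and> \<epsilon> \<in> {0<..<1}"
      by (rule eventually_conj)
    from eventually_happens'[OF trivial_limit_at_right_real this]
    obtain \<epsilon> where \<epsilon>: "0 < \<epsilon>" "\<epsilon> < 1" "\<nu> * (c * (1 - \<epsilon>) powr -\<beta>) < \<nu> * c + e" by auto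
    define l where "l n = nat \<lfloor>\<epsilon> * real n\<rfloor>" for n
    have l_top: "filterlim l at_top sequentially" unfolding l_def by (rule filterlim_nat_floor[OF \<epsilon>(1)])
    have lr: "(\<lambda>n. real (n - l n) / real n) \<longlonglongrightarrow> 1 - \<epsilon>" unfolding l_def by (rule tendsto_diff_floor_ratio[OF \<epsilon>(1,2)])
    have lt: "filterlim (\<lambda>n. n - l n) at_top sequentially"
    proof -
      have "filterlim (\<lambda>n. nat \<lfloor>(1 - \<epsilon>) * real n\<rfloor>) at_top sequentially" by (rule filterlim_nat_floor) (use \<epsilon> in simp)
      then show ?thesis
      proof (rule filterlim_at_top_mono)
        have "nat \<lfloor>(1 - \<epsilon>) * real n\<rfloor> \<le> n - l n" for n
        proof -
          have "real (l n) \<le> \<epsilon> * real n" using \<epsilon> unfolding l_def by (simp add: of_nat_nat)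
          moreover have "(1 - \<epsilon>) * real n = real n - \<epsilon> * real n" by (simp add: left_diff_distrib)
          ultimately show ?thesis by linarith
        qed
        then show "\<forall>\<^sub>F n in sequentially. nat \<lfloor>(1 - \<epsilon>) * real n\<rfloor> \<le> n - l n" by simp
      qed
    qed
    have "(\<lambda>n. \<nu> * (K (n - l n) / X (n - l n) * (X (n - l n) / X n) + K 0 * Y * (1 / real (Suc (l n))) * (X (l n) / X n)))
       \<longlonglongrightarrow> \<nu> * (c * (1 - \<epsilon>) powr -\<beta> + K 0 * Y * 0 * \<epsilon> powr -\<beta>)"
    proof (intro tendsto_intros)
      show "(\<lambda>n. K (n - l n) / X (n - l n)) \<longlonglongrightarrow> c" unfolding K_def by (rule filterlim_compose[OF lim lt])
      show "(\<lambda>n. X (n - l n) / X n) \<longlonglongrightarrow> (1 - \<epsilon>) powr - \<beta>" by (rule reg_var_ratio[OF X lr]) (use \<epsilon> in simp)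
      show "(\<lambda>n. X (l n) / X n) \<longlonglongrightarrow> \<epsilon> powr - \<beta>" unfolding l_def using X \<epsilon> by (simp add: reg_var_def)
      show "(\<lambda>n. 1 / real (Suc (l n))) \<longlonglongrightarrow> 0"
        by (rule real_tendsto_divide_at_top[OF tendsto_const], rule filterlim_compose[OF filterlim_real_sequentially],
            rule filterlim_compose[OF filterlim_Suc l_top])
    qed
    then have "\<forall>\<^sub>F n in sequentially. \<nu> * (K (n - l n) / X (n - l n) * (X (n - l n) / X n) + K 0 * Y * (1 / real (Suc (l n))) * (X (l n) / X n)) < \<nu> * c + e"
      by (rule order_tendstoD) (use \<epsilon> in simp)
    moreover have "\<forall>\<^sub>F n in sequentially. \<nu> * (K n / X n) > \<nu> * c - e"
      by (rule order_tendstoD[OF tendsto_mult[OF tendsto_const lim[folded K_def]]]) (use e in simp)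
    ultimately have "\<forall>\<^sub>F n in sequentially. norm (tail_sum z n / X n - \<nu> * c) < e"
    proof eventually_elim
      case (elim n)
      have "M n \<le> \<nu> * (K (n - l n) + K 0 * R (l n))" by (rule upper)
      also have "\<dots> \<le> \<nu> * (K (n - l n) + K 0 * (Y * X (l n) / real (Suc (l n))))"
        by (intro mult_left_mono add_left_mono K0 order_trans[OF R_le] divide_right_mono Y) (use \<nu> in auto)
      finally have "M n / X n \<le> \<nu> * (K (n - l n) + K 0 * (Y * X (l n) / real (Suc (l n)))) / X n"
        by (rule divide_right_mono) (use pos[of n] in simp)
      also have "\<dots> = \<nu> * (K (n - l n) / X (n - l n) * (X (n - l n) / X n) + K 0 * Y * (1 / real (Suc (l n))) * (X (l n) / X n))"
      proof -
        have "(K (n - l n) + K 0 * (Y * X (l n) / real (Suc (l n)))) / X n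
            = K (n - l n) / X (n - l n) * (X (n - l n) / X n) + K 0 * Y * (1 / real (Suc (l n))) * (X (l n) / X n)"
          using pos[of "n - l n"] by (simp add: add_divide_distrib)
        then show ?thesis by (metis times_divide_eq_right)
      qed
      also have "\<dots> < \<nu> * c + e" by (rule elim(1))
      finally have 1: "M n / X n < \<nu> * c + e" .
      have "\<nu> * K n / X n \<le> M n / X n" by (rule divide_right_mono[OF lower]) (use pos[of n] in simp)
      then have "\<nu> * c - e < M n / X n" using elim(2) by simp
      then show ?case using 1 by (simp only: M_def real_norm_def abs_less_iff) linarith
    qed
    then show "\<exists>no. \<forall>n\<ge>no. norm (tail_sum z n / X n - \<nu> * c) < e" by (simp add: eventually_sequentially)
  qed
qed

text \<open>Summation by parts: \<open>r (Suc n)\<close> is the increment of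
  \<open>M n / Suc n\<close> minus \<open>z n = M (Suc n) / (Suc n * Suc (Suc n))\<close>. The
  correction \<open>z\<close> behaves like \<open>c * X n / n^2\<close>, of index
  \<open>\<beta> + 2\<close>, so by Karamata its tail is \<open>c / (\<beta> + 1) * X n / n\<close>.
  What remains is \<open>c * (1 - 1 / (\<beta> + 1))\<close>.\<close>

lemma tail_of_size_biased:
  fixes r X :: "nat \<Rightarrow> real"
  assumes X: "reg_var \<beta> X" and \<beta>: "\<beta> > 0" and r: "\<And>n. r n \<ge> 0" "summable r"
    and sm: "summable (\<lambda>n. real (Suc n) * r (Suc n))"
    and lim: "(\<lambda>n. tail_sum (\<lambda>n. real (Suc n) * r (Suc n)) n / X n) \<longlonglongrightarrow> c"
  shows "(\<lambda>n. tail_sum r (Suc n) / (X n / real n)) \<longlonglongrightarrow> c * \<beta> / (\<beta> + 1)"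
proof -
  have pos: "X n > 0" for n using X by (simp add: reg_var_pos)
  define M where "M = tail_sum (\<lambda>n. real (Suc n) * r (Suc n))"
  define g where "g n = M n / real (Suc n)" for n
  define z where "z n = M (Suc n) / (real (Suc n) * real (Suc (Suc n)))" for n
  define x where "x n = X n / (real n + 1)\<^sup>2" for n
  have x: "reg_var (\<beta> + 2) x" unfolding x_def[abs_def] by (rule reg_var_divide_Suc_power2[OF X])
  have xpos: "x n > 0" for n using x by (simp add: reg_var_pos)
  have smx: "summable x" by (rule reg_var_summable[OF x]) (use \<beta> in simp)
  have Mlim: "(\<lambda>n. M n / X n) \<longlonglongrightarrow> c" unfolding M_def by (rule lim)
  have rz: "r (Suc n) = (g n - g (Suc n)) - z n" for n
  proof -
    have "M n = real (Suc n) * r (Suc n) + M (Suc n)" unfolding M_def by (rule tail_sum_Suc[OF sm])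
    then have "r (Suc n) = (M n - M (Suc n)) / real (Suc n)" by simp
    also have "\<dots> = M n / real (Suc n) - M (Suc n) / real (Suc n)" by (rule diff_divide_distrib)
    also have "M (Suc n) / real (Suc n) = M (Suc n) / real (Suc (Suc n)) + M (Suc n) / (real (Suc n) * real (Suc (Suc n)))"
    proof -
      have "m / a = m / (a + 1) + m / (a * (a + 1))" if "a > 0" for m a :: real
        using that by (simp add: divide_simps) (simp add: algebra_simps)
      from this[of "real (Suc n)" "M (Suc n)"] show ?thesis by (simp only: of_nat_Suc[of "Suc n"] add.commute)
    qed
    finally show ?thesis unfolding g_def z_def by simp
  qed
  have s1: "(\<lambda>n. real (Suc n) / real n) \<longlonglongrightarrow> 1"
    by (rule Lim_transform_eventually[OF _ eventually_mono[OF eventually_gt_at_top[of 0]]])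
       (use tendsto_add[OF lim_1_over_n tendsto_const[of "1::real"]] in \<open>auto simp: add_divide_distrib\<close>)
  have XS: "(\<lambda>n. X (Suc n) / X n) \<longlonglongrightarrow> 1" using reg_var_ratio[OF X s1] by simp
  have "(\<lambda>n. M (Suc n) / X (Suc n) * (X (Suc n) / X n) / (real (Suc (Suc n)) / real (Suc n))) \<longlonglongrightarrow> c * 1 / 1"
    by (intro tendsto_intros XS LIMSEQ_Suc[OF Mlim] LIMSEQ_Suc[OF s1]) auto
  moreover have "(\<lambda>n. M (Suc n) / X (Suc n) * (X (Suc n) / X n) / (real (Suc (Suc n)) / real (Suc n))) = (\<lambda>n. z n / x n)"
  proof
    fix n
    have "X (Suc n) \<noteq> 0" using pos[of "Suc n"] by simp
    moreover have e1: "real n + 1 = real (Suc n)" by simp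
    ultimately show "M (Suc n) / X (Suc n) * (X (Suc n) / X n) / (real (Suc (Suc n)) / real (Suc n)) = z n / x n"
      unfolding z_def x_def e1 by (simp add: power2_eq_square del: of_nat_Suc)
  qed
  ultimately have zx: "(\<lambda>n. z n / x n) \<longlonglongrightarrow> c" by simp
  note tz = tail_sum_equiv[OF smx xpos zx]
  have g0: "g \<longlonglongrightarrow> 0"
  proof -
    have "M \<longlonglongrightarrow> (\<Sum>n. real (Suc n) * r (Suc n)) - (\<Sum>n. real (Suc n) * r (Suc n))"
      unfolding M_def tail_sum_eq[OF sm] by (intro tendsto_intros summable_LIMSEQ[OF sm])
    then have "M \<longlonglongrightarrow> 0" by simp
    from tendsto_mult[OF this LIMSEQ_inverse_real_of_nat] show ?thesis by (simp add: g_def[abs_def] divide_inverse)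
  qed
  have eq: "tail_sum r (Suc n) = g n - tail_sum z n" for n
  proof -
    have "(\<lambda>k. g (k + n)) \<longlonglongrightarrow> 0" using g0 by (rule LIMSEQ_ignore_initial_segment)
    from telescope_sums'[OF this] have 1: "(\<lambda>k. g (k + n) - g (Suc (k + n))) sums g n" by simp
    have 2: "(\<lambda>k. z (k + n)) sums tail_sum z n" unfolding tail_sum_def
      by (intro summable_sums summable_ignore_initial_segment tz)
    from sums_diff[OF 1 2] show ?thesis unfolding tail_sum_def[of r] using rz by (simp add: sums_iff)
  qed
  have "(\<lambda>n. M n / X n / (real (Suc n) / real n) - tail_sum z n / tail_sum x n * (tail_sum x n / (real n * x n)) / (real (Suc n) / real n)^2)
     \<longlonglongrightarrow> c / 1 - c * (1 / (\<beta> + 2 - 1)) / 1^2"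
    by (intro tendsto_intros Mlim s1 tz reg_var_karamata[OF x]) (use \<beta> in auto)
  moreover have "c / 1 - c * (1 / (\<beta> + 2 - 1)) / 1^2 = c * \<beta> / (\<beta> + 1)"
    using \<beta> by (simp add: field_simps)
  moreover have "\<forall>\<^sub>F n in sequentially. M n / X n / (real (Suc n) / real n) - tail_sum z n / tail_sum x n * (tail_sum x n / (real n * x n)) / (real (Suc n) / real n)^2
      = tail_sum r (Suc n) / (X n / real n)"
    using eventually_gt_at_top[of 0]
  proof eventually_elim
    case (elim n)
    have nz: "tail_sum x n \<noteq> 0" "X n \<noteq> 0" "real n \<noteq> 0" using tail_sum_pos[OF smx xpos, of n] pos[of n] elim by auto
    have e1: "real n + 1 = real (Suc n)" by simp
    have "tail_sum z n / tail_sum x n * (tail_sum x n / (real n * x n)) / (real (Suc n) / real n)^2 = tail_sum z n / (X n / real n)"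
      using nz unfolding x_def e1 by (simp add: power2_eq_square del: of_nat_Suc)
    moreover have "M n / X n / (real (Suc n) / real n) = g n / (X n / real n)" by (simp add: g_def)
    ultimately show ?case unfolding eq by (simp only: diff_divide_distrib)
  qed
  ultimately show ?thesis using Lim_transform_eventually by fastforce
qed

section \<open>Convolution powers of a regularly varying sequence\<close>

lemma fps_power_nonneg:
  fixes x :: "nat \<Rightarrow> real"
  assumes "\<And>n. x n \<ge> 0"
  shows "fps_nth (Abs_fps x ^ k) n \<ge> 0"
proof (induction k arbitrary: n)
  case (Suc k)
  show ?case unfolding power_Suc fps_mult_nth by (intro sum_nonneg mult_nonneg_nonneg Suc.IH) (use assms in auto)
qed (auto simp: fps_one_nth)

text \<open>Convolution powers are encoded as coefficients of powers of a formal power series, so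
  that their algebra is available without convergence; this lemma returns to numerical generating
  functions by Cauchy products.\<close>

lemma fps_power_sums:
  fixes x :: "nat \<Rightarrow> real"
  assumes x: "\<And>n. x n \<ge> 0" and z: "z \<ge> 0" and s: "(\<lambda>n. x n * z ^ n) sums s"
  shows "(\<lambda>n. fps_nth (Abs_fps x ^ k) n * z ^ n) sums (s ^ k)"
proof (induction k)
  case 0
  have "(\<lambda>n. fps_nth (1 :: real fps) n * z ^ n) sums (\<Sum>n\<in>{0}. fps_nth (1 :: real fps) n * z ^ n)"
    by (rule sums_finite) (auto simp: fps_one_nth)
  then show ?case by simp
next
  case (Suc k)
  have "(\<lambda>n. \<Sum>i\<le>n. (x i * z ^ i) * (fps_nth (Abs_fps x ^ k) (n - i) * z ^ (n - i))) sums
     ((\<Sum>n. x n * z ^ n) * (\<Sum>n. fps_nth (Abs_fps x ^ k) n * z ^ n))"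
    by (rule Cauchy_product_sums)
       (use s Suc x z fps_power_nonneg[OF x] in \<open>auto simp: sums_iff abs_mult power_abs\<close>)
  moreover have "(\<Sum>i\<le>n. (x i * z ^ i) * (fps_nth (Abs_fps x ^ k) (n - i) * z ^ (n - i))) = fps_nth (Abs_fps x ^ Suc k) n * z ^ n" for n
    unfolding power_Suc fps_mult_nth sum_distrib_right atLeast0AtMost
    by (rule sum.cong) (auto simp: power_add[symmetric])
  ultimately show ?case using s Suc by (simp add: sums_iff)
qed

lemma suminf_If_atMost: "(\<Sum>i. if i \<le> h then g i else 0) = (\<Sum>i\<le>h. g i :: real)" for h :: nat
  by (subst suminf_finite[of "{..h}"]) (auto intro: sum.cong)

lemma suminf_If_lessThan: "(\<Sum>i. if i < h then g i else 0) = (\<Sum>i<h. g i :: real)" for h :: nat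
  by (subst suminf_finite[of "{..<h}"]) (auto intro: sum.cong)

text \<open>Principle of one big term: the index sum \<open>n\<close> is carried by only one of the
  two factors. If \<open>b\<close> has the small index, \<open>x (n - i)\<close> behaves like
  \<open>X * b n\<close> and the sum over \<open>i\<close> gives \<open>\<rho> * X\<close>; if
  \<open>x\<close> has the small index, \<open>b (n - i)\<close> behaves like \<open>b n\<close> and
  the sum gives \<open>s\<close>. The case \<open>X = 0\<close> is allowed and starts the induction
  for convolution powers.\<close>

lemma reg_var_convolution:
  fixes b x :: "nat \<Rightarrow> real"
  assumes b: "reg_var \<alpha> b" "b sums \<rho>" and x: "\<And>n. x n \<ge> 0" "x sums s" and lim: "(\<lambda>n. x n / b n) \<longlonglongrightarrow> X"
  shows "(\<lambda>n. (\<Sum>i\<le>n. b i * x (n - i)) / b n) \<longlonglongrightarrow> \<rho> * X + s"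
proof -
  have pos: "b n > 0" for n using b by (simp add: reg_var_pos)
  obtain C1 where C1: "C1 > 0" "\<And>n. \<bar>x n\<bar> \<le> C1 * b n" using bounded_ratio[OF lim pos] by blast
  obtain C2 where C2: "C2 > 0" "\<And>n. \<bar>b (n - n div 2)\<bar> \<le> C2 * b n"
    using bounded_ratio[OF reg_var_ratio[OF b(1) div2_ratio(1)] pos] by auto
  obtain C3 where C3: "C3 > 0" "\<And>n. \<bar>b (n div 2)\<bar> \<le> C3 * b n"
    using bounded_ratio[OF reg_var_ratio[OF b(1) div2_ratio(2)] pos] by auto
  have sub_top: "filterlim (\<lambda>n. n - i) at_top sequentially" for i :: nat by (rule filterlim_minus_const_nat_at_top)
  have d2: "filterlim (\<lambda>n::nat. n div 2) at_top sequentially" by (rule filterlim_at_top_div_const_nat) simp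
  have d2': "filterlim (\<lambda>n::nat. n - n div 2) at_top sequentially"
    by (rule filterlim_at_top_mono[OF d2]) (auto intro!: always_eventually)
  \<comment> \<open>The convolution is cut at \<open>n div 2\<close> so that the large index stays
    at least about n/2; there the bounds \<open>C2\<close> and \<open>C3\<close> supply a domination
    that does not depend on \<open>n\<close>. The second half is reindexed by the argument of
    \<open>x\<close>.\<close>
  define f1 where "f1 i n = (if i \<le> n div 2 then b i * x (n - i) / b n else 0)" for i n
  define f2 where "f2 i n = (if i < n - n div 2 then x i * b (n - i) / b n else 0)" for i n
  have 1: "(\<lambda>n. \<Sum>i. f1 i n) \<longlonglongrightarrow> (\<Sum>i. b i * X)"
  proof (rule tannery_seq(1))
    show "(\<lambda>n. f1 i n) \<longlonglongrightarrow> b i * X" for i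
    proof (rule Lim_transform_eventually)
      have "(\<lambda>n. b i * (x (n - i) / b (n - i)) * (b (n - i) / b n)) \<longlonglongrightarrow> b i * X * 1"
        by (intro tendsto_intros filterlim_compose[OF lim sub_top] reg_var_shift[OF b(1)])
      then show "(\<lambda>n. b i * (x (n - i) / b (n - i)) * (b (n - i) / b n)) \<longlonglongrightarrow> b i * X" by simp
      show "\<forall>\<^sub>F n in sequentially. b i * (x (n - i) / b (n - i)) * (b (n - i) / b n) = f1 i n"
        using eventually_compose_filterlim[OF eventually_ge_at_top[of i] d2]
      proof eventually_elim
        case (elim n)
        have "b (n - i) \<noteq> 0" using pos[of "n - i"] by simp
        then show ?case using elim by (simp add: f1_def)
      qed
    qed
    show "\<bar>f1 i n\<bar> \<le> b i * (C1 * C2)" for i n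
    proof (cases "i \<le> n div 2")
      case True
      have "x (n - i) \<le> C1 * b (n - i)" using C1(2)[of "n - i"] by simp
      also have "b (n - i) \<le> b (n - n div 2)" using True by (intro reg_var_mono[OF b(1)]) simp
      also have "\<dots> \<le> C2 * b n" using C2(2)[of n] by simp
      finally have "b i * x (n - i) \<le> b i * (C1 * (C2 * b n))" using C1(1) pos[of i] by (intro mult_left_mono) auto
      then show ?thesis using True pos[of n] pos[of i] x(1)[of "n - i"] by (simp add: f1_def pos_divide_le_eq mult_ac)
    qed (use C1 C2 pos[of i] in \<open>simp add: f1_def\<close>)
    show "summable (\<lambda>i. b i * (C1 * C2))" using b(2) by (intro summable_mult2) (simp add: sums_iff)
  qed
  have 2: "(\<lambda>n. \<Sum>i. f2 i n) \<longlonglongrightarrow> (\<Sum>i. x i)"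
  proof (rule tannery_seq(1))
    show "(\<lambda>n. f2 i n) \<longlonglongrightarrow> x i" for i
    proof (rule Lim_transform_eventually)
      have "(\<lambda>n. x i * (b (n - i) / b n)) \<longlonglongrightarrow> x i * 1"
        by (intro tendsto_intros reg_var_shift[OF b(1)])
      then show "(\<lambda>n. x i * (b (n - i) / b n)) \<longlonglongrightarrow> x i" by simp
      show "\<forall>\<^sub>F n in sequentially. x i * (b (n - i) / b n) = f2 i n"
        using eventually_compose_filterlim[OF eventually_gt_at_top[of i] d2']
        by eventually_elim (simp add: f2_def)
    qed
    show "\<bar>f2 i n\<bar> \<le> x i * C3" for i n
    proof (cases "i < n - n div 2")
      case True
      have "b (n - i) \<le> b (n div 2)" using True by (intro reg_var_mono[OF b(1)]) simp
      also have "\<dots> \<le> C3 * b n" using C3(2)[of n] by simp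
      finally have "x i * b (n - i) \<le> x i * (C3 * b n)" using x(1)[of i] by (intro mult_left_mono) auto
      then show ?thesis using True pos[of n] pos[of "n-i"] x(1)[of i] by (simp add: f2_def pos_divide_le_eq mult_ac)
    qed (use C3 x(1)[of i] in \<open>simp add: f2_def\<close>)
    show "summable (\<lambda>i. x i * C3)" using x(2) by (intro summable_mult2) (simp add: sums_iff)
  qed
  have split: "(\<Sum>i. f1 i n) + (\<Sum>i. f2 i n) = (\<Sum>i\<le>n. b i * x (n - i)) / b n" for n
  proof -
    let ?g = "\<lambda>i. b i * x (n - i) / b n"
    have "(\<Sum>i<n - n div 2. x i * b (n - i) / b n) = (\<Sum>i\<in>{n div 2<..n}. ?g i)"
      by (rule sum.reindex_bij_witness[of _ "\<lambda>i. n - i" "\<lambda>i. n - i"]) auto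
    then have "(\<Sum>i. f1 i n) + (\<Sum>i. f2 i n) = (\<Sum>i\<le>n div 2. ?g i) + (\<Sum>i\<in>{n div 2<..n}. ?g i)"
      unfolding f1_def f2_def suminf_If_atMost suminf_If_lessThan by simp
    also have "\<dots> = (\<Sum>i\<in>{..n div 2} \<union> {n div 2<..n}. ?g i)" by (rule sum.union_disjoint[symmetric]) auto
    also have "{..n div 2} \<union> {n div 2<..n} = {..n}" by auto
    finally show ?thesis by (simp add: sum_divide_distrib)
  qed
  have "(\<Sum>i. b i * X) = \<rho> * X" using sums_mult2[OF b(2), of X] by (simp add: sums_iff)
  moreover have "(\<Sum>i. x i) = s" using x(2) by (simp add: sums_iff)
  ultimately show ?thesis using tendsto_add[OF 1 2] unfolding split by simp
qed

text \<open>Any of the \<open>k\<close> factors can carry the large index, while the other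
  \<open>k - 1\<close> contribute their total mass \<rho>. At \<open>k = 0\<close> the truncated
  exponent is harmless because of the factor \<open>k\<close>.\<close>

lemma conv_power_limit:
  fixes b :: "nat \<Rightarrow> real"
  assumes b: "reg_var \<alpha> b" "b sums \<rho>"
  shows "(\<lambda>n. fps_nth (Abs_fps b ^ k) n / b n) \<longlonglongrightarrow> real k * \<rho> ^ (k - 1)"
proof (induction k)
  case 0
  have "\<forall>\<^sub>F n in sequentially. 0 = fps_nth (Abs_fps b ^ 0) n / b n"
    using eventually_gt_at_top[of 0] by eventually_elim (simp add: fps_one_nth)
  then show ?case by (auto intro: Lim_transform_eventually)
next
  case (Suc k)
  have nonneg: "b n \<ge> 0" for n using reg_var_pos[OF b(1), of n] by simp
  have "(\<lambda>n. fps_nth (Abs_fps b ^ k) n) sums \<rho> ^ k"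
    using fps_power_sums[of b 1 \<rho> k] nonneg b by simp
  from reg_var_convolution[OF b fps_power_nonneg[OF nonneg] this Suc]
  have "(\<lambda>n. fps_nth (Abs_fps b ^ Suc k) n / b n) \<longlonglongrightarrow> \<rho> * (real k * \<rho> ^ (k - 1)) + \<rho> ^ k"
    by (simp add: fps_mult_nth atLeast0AtMost)
  moreover have "\<rho> * (real k * \<rho> ^ (k - 1)) + \<rho> ^ k = real (Suc k) * \<rho> ^ (Suc k - 1)"
    by (cases k) (auto simp: algebra_simps)
  ultimately show ?case by simp
qed

text \<open>One of the \<open>k + 1\<close> summands is at least \<open>n / (k + 1)\<close>, and given the others it is determined.\<close>

lemma conv_power_bound:
  fixes b :: "nat \<Rightarrow> real"
  assumes b: "decseq b" "\<And>n. b n \<ge> 0" "b sums \<rho>"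
  shows "fps_nth (Abs_fps b ^ Suc k) n \<le> real (Suc k) * \<rho> ^ k * b (n div Suc k)"
proof (induction k arbitrary: n)
  case 0
  then show ?case by simp
next
  case (Suc k)
  define P where "P = Abs_fps b ^ Suc k"
  have P0: "fps_nth P i \<ge> 0" for i unfolding P_def by (rule fps_power_nonneg[OF b(2)])
  have Psum: "(\<lambda>n. fps_nth P n) sums \<rho> ^ Suc k"
    unfolding P_def using fps_power_sums[of b 1 \<rho> "Suc k"] b by simp
  have \<rho>: "\<rho> \<ge> 0" using b(2,3) by (auto simp: sums_iff intro: suminf_nonneg)
  let ?m = "n div Suc (Suc k)"
  have term_le: "b i * fps_nth P (n - i) \<le> b ?m * fps_nth P (n - i) + real (Suc k) * \<rho> ^ k * b ?m * b i" if "i \<le> n" for i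
  proof (cases "i \<ge> ?m")
    case True
    have "b i * fps_nth P (n - i) \<le> b ?m * fps_nth P (n - i)"
      by (intro mult_right_mono P0) (use b(1) True in \<open>simp add: decseqD\<close>)
    moreover have "real (Suc k) * \<rho> ^ k * b ?m * b i \<ge> 0" using \<rho> b(2) by simp
    ultimately show ?thesis by linarith
  next
    case False
    have "Suc (Suc k) * ?m \<le> n" by (rule times_div_less_eq_dividend)
    then have "?m * Suc k \<le> n - i" using False by (simp add: mult.commute[of k])
    then have "?m \<le> (n - i) div Suc k" by (simp add: less_eq_div_iff_mult_less_eq)
    then have "b ((n - i) div Suc k) \<le> b ?m" using b(1) by (simp add: decseqD)
    then have "fps_nth P (n - i) \<le> real (Suc k) * \<rho> ^ k * b ?m"
      unfolding P_def by (intro order_trans[OF Suc.IH] mult_left_mono) (use \<rho> in auto)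
    then have "b i * fps_nth P (n - i) \<le> b i * (real (Suc k) * \<rho> ^ k * b ?m)" by (intro mult_left_mono b)
    moreover have "b ?m * fps_nth P (n - i) \<ge> 0" using P0 b(2) by simp
    ultimately show ?thesis by (simp add: mult_ac)
  qed
  have "fps_nth (Abs_fps b ^ Suc (Suc k)) n = (\<Sum>i\<le>n. b i * fps_nth P (n - i))"
    unfolding P_def by (subst power_Suc) (simp add: fps_mult_nth atLeast0AtMost)
  also have "\<dots> \<le> (\<Sum>i\<le>n. b ?m * fps_nth P (n - i) + real (Suc k) * \<rho> ^ k * b ?m * b i)"
    by (rule sum_mono) (use term_le in auto)
  also have "\<dots> = b ?m * (\<Sum>i\<le>n. fps_nth P (n - i)) + real (Suc k) * \<rho> ^ k * b ?m * (\<Sum>i\<le>n. b i)"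
    by (simp add: sum.distrib sum_distrib_left)
  also have "(\<Sum>i\<le>n. fps_nth P (n - i)) = (\<Sum>i\<le>n. fps_nth P i)"
    by (rule sum.reindex_bij_witness[of _ "\<lambda>i. n - i" "\<lambda>i. n - i"]) auto
  also have "\<dots> \<le> \<rho> ^ Suc k"
    using sum_le_suminf[of "\<lambda>i. fps_nth P i" "{..n}"] Psum P0 by (simp add: sums_iff)
  also have "(\<Sum>i\<le>n. b i) \<le> \<rho>"
    using sum_le_suminf[of b "{..n}"] b by (simp add: sums_iff)
  finally have "fps_nth (Abs_fps b ^ Suc (Suc k)) n \<le> b ?m * \<rho> ^ Suc k + real (Suc k) * \<rho> ^ k * b ?m * \<rho>"
    using b(2) \<rho> by (simp add: mult_left_mono)
  then show ?case by (simp add: algebra_simps)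
qed

lemma summable_powr_mult_power:
  fixes s \<rho> :: real
  assumes "0 \<le> \<rho>" "\<rho> < 1"
  shows "summable (\<lambda>k. real (Suc k) powr s * \<rho> ^ k)"
proof -
  define c where "c = (1 + \<rho>) / 2"
  have c: "\<rho> < c" "c < 1" using assms by (auto simp: c_def)
  have "(\<lambda>k. 1 + 1 / real (Suc k)) \<longlonglongrightarrow> 1 + 0" by (intro tendsto_intros LIMSEQ_Suc[OF lim_1_over_n])
  from tendsto_mult[OF tendsto_powr[OF this tendsto_const] tendsto_const, of s \<rho>]
  have "(\<lambda>k. (1 + 1 / real (Suc k)) powr s * \<rho>) \<longlonglongrightarrow> (1 + 0) powr s * \<rho>" by simp
  then have "\<forall>\<^sub>F k in sequentially. (1 + 1 / real (Suc k)) powr s * \<rho> < c" by (rule order_tendstoD) (use c in simp)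
  then obtain N where N: "\<And>k. k \<ge> N \<Longrightarrow> (1 + 1 / real (Suc k)) powr s * \<rho> < c" by (auto simp: eventually_sequentially)
  show ?thesis
  proof (rule summable_ratio_test[OF c(2), of N])
    fix k assume k: "k \<ge> N"
    have "real (Suc (Suc k)) = real (Suc k) * (1 + 1 / real (Suc k))" by (simp add: distrib_left)
    then have "real (Suc (Suc k)) powr s = real (Suc k) powr s * (1 + 1 / real (Suc k)) powr s"
      by (simp only: powr_mult)
    then have "real (Suc (Suc k)) powr s * \<rho> ^ Suc k = ((1 + 1 / real (Suc k)) powr s * \<rho>) * (real (Suc k) powr s * \<rho> ^ k)"
      by simp
    also have "\<dots> \<le> c * (real (Suc k) powr s * \<rho> ^ k)"
      by (rule mult_right_mono) (use N[OF k] assms in auto)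
    finally show "norm (real (Suc (Suc k)) powr s * \<rho> ^ Suc k) \<le> c * norm (real (Suc k) powr s * \<rho> ^ k)"
      using assms by simp
  qed
qed

text \<open>The coefficients of \<open>B / (1 - B)\<close>, where \<open>B\<close> is the generating function of \<open>b\<close>.\<close>

definition renewal :: "(nat \<Rightarrow> real) \<Rightarrow> nat \<Rightarrow> real" where
  "renewal b n = (\<Sum>k. fps_nth (Abs_fps b ^ Suc k) n)"

text \<open>The termwise limits \<open>Suc k * \<rho> ^ k\<close> add up to
  \<open>1 / (1 - \<rho>)^2\<close>. The domination combines \<open>conv_power_bound\<close> with
  Potter's bound: passing from \<open>b (n div Suc k)\<close> to \<open>b n\<close> costs only a
  power of \<open>Suc k\<close>, which the geometric factor absorbs.\<close>

lemma renewal_limit: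
  fixes b :: "nat \<Rightarrow> real"
  assumes b: "reg_var \<alpha> b" "b sums \<rho>" and \<alpha>: "\<alpha> \<ge> 0" and \<rho>: "\<rho> < 1"
  shows "(\<lambda>n. renewal b n / b n) \<longlonglongrightarrow> 1 / (1 - \<rho>)\<^sup>2"
proof -
  have pos: "b n > 0" for n using b by (simp add: reg_var_pos)
  have nonneg: "b n \<ge> 0" for n using pos[of n] by simp
  have \<rho>0: "\<rho> \<ge> 0" using b(2) nonneg by (auto simp: sums_iff intro: suminf_nonneg)
  define s where "s = \<alpha> + 1"
  have s: "\<alpha> < s" "0 \<le> s" using \<alpha> by (auto simp: s_def)
  obtain C where C: "C > 0" "\<And>j n. 1 \<le> j \<Longrightarrow> j \<le> n \<Longrightarrow> b j \<le> C * (real n / real j) powr s * b n"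
    using reg_var_potter_lower[OF b(1) s] by blast
  \<comment> \<open>The factor \<open>2 powr s\<close> accounts for the rounding in
    \<open>n div Suc k\<close>. The factor \<open>b 0 / b 1\<close> covers \<open>n < Suc k\<close>,
    where the quotient is 0 and Potter's bound can only be started at index 1.\<close>
  define C' where "C' = C * 2 powr s * (b 0 / b 1)"
  have b01: "b 0 / b 1 \<ge> 1" using reg_var_mono[OF b(1), of 0 1] pos[of 1] by simp
  have two: "(2::real) powr s \<ge> 1" using s by (simp add: ge_one_powr_ge_zero)
  have div_bound: "b (n div Suc k) \<le> C' * real (Suc k) powr s * b n" for n k
  proof (cases "Suc k \<le> n")
    case True
    let ?j = "n div Suc k"
    have j: "1 \<le> ?j" "?j \<le> n" using True by (auto simp: less_eq_div_iff_mult_less_eq intro: div_le_dividend)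
    have "n < Suc ?j * Suc k" using dividend_less_div_times[of "Suc k" n] by simp
    also have "\<dots> \<le> (2 * ?j) * Suc k" using j by (intro mult_right_mono) auto
    finally have "real n \<le> real ((2 * ?j) * Suc k)" by (simp only: of_nat_le_iff less_imp_le_nat)
    then have "real n / real ?j \<le> 2 * real (Suc k)" using j by (simp add: pos_divide_le_eq algebra_simps)
    then have "(real n / real ?j) powr s \<le> (2 * real (Suc k)) powr s" using s by (intro powr_mono2) auto
    also have "\<dots> = 2 powr s * real (Suc k) powr s" by (rule powr_mult)
    finally have "b ?j \<le> C * (2 powr s * real (Suc k) powr s) * b n"
      using C(1) nonneg by (intro order_trans[OF C(2)[OF j]] mult_right_mono mult_left_mono) auto
    also have "\<dots> = 1 * (C * 2 powr s * real (Suc k) powr s * b n)" by simp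
    also have "\<dots> \<le> (b 0 / b 1) * (C * 2 powr s * real (Suc k) powr s * b n)"
      by (rule mult_right_mono[OF b01]) (use C(1) nonneg in auto)
    finally show ?thesis by (simp add: C'_def mult_ac)
  next
    case False
    have "b 1 \<le> C * (real (Suc k) / real 1) powr s * b (Suc k)" by (rule C(2)) auto
    also have "real (Suc k) / real 1 = real (Suc k)" by simp
    also have "C * real (Suc k) powr s * b (Suc k) \<le> C * real (Suc k) powr s * b n"
      using False C(1) by (intro mult_left_mono reg_var_mono[OF b(1)]) auto
    finally have "(b 0 / b 1) * b 1 \<le> (b 0 / b 1) * (C * real (Suc k) powr s * b n)"
      using b01 by (intro mult_left_mono) auto
    then have "b 0 \<le> 1 * ((b 0 / b 1) * (C * real (Suc k) powr s * b n))" using pos[of 1] by simp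
    also have "\<dots> \<le> 2 powr s * ((b 0 / b 1) * (C * real (Suc k) powr s * b n))"
      by (rule mult_right_mono[OF two]) (use C(1) nonneg b01 in auto)
    finally show ?thesis using False by (simp add: C'_def mult_ac)
  qed
  have C'0: "C' \<ge> 0" using C(1) pos[of 0] pos[of 1] by (simp add: C'_def)
  define M where "M k = C' * (real (Suc k) powr (s + 1) * \<rho> ^ k)" for k
  have bound: "\<bar>fps_nth (Abs_fps b ^ Suc k) n / b n\<bar> \<le> M k" for k n
  proof -
    have "fps_nth (Abs_fps b ^ Suc k) n \<le> real (Suc k) * \<rho> ^ k * b (n div Suc k)"
      by (rule conv_power_bound) (use b nonneg in \<open>auto simp: reg_var_def\<close>)
    also have "\<dots> \<le> real (Suc k) * \<rho> ^ k * (C' * real (Suc k) powr s * b n)"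
      by (intro mult_left_mono div_bound) (use \<rho>0 in auto)
    also have "\<dots> = M k * b n" by (simp add: M_def powr_add)
    finally show ?thesis using pos[of n] fps_power_nonneg[of b "Suc k" n, OF nonneg] by (simp add: pos_divide_le_eq)
  qed
  have "(\<lambda>n. \<Sum>k. fps_nth (Abs_fps b ^ Suc k) n / b n) \<longlonglongrightarrow> (\<Sum>k. real (Suc k) * \<rho> ^ k)"
  proof (rule tannery_seq(1)[OF _ bound])
    show "(\<lambda>n. fps_nth (Abs_fps b ^ Suc k) n / b n) \<longlonglongrightarrow> real (Suc k) * \<rho> ^ k" for k
      using conv_power_limit[OF b, of "Suc k"] by (simp only: diff_Suc_1)
    show "summable M" unfolding M_def by (intro summable_mult summable_powr_mult_power \<rho>0 \<rho>)
  qed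
  moreover have "(\<Sum>k. real (Suc k) * \<rho> ^ k) = 1 / (1 - \<rho>)\<^sup>2"
    using geometric_deriv_sums[of \<rho>] \<rho>0 \<rho> by (simp add: sums_iff)
  moreover have "(\<Sum>k. fps_nth (Abs_fps b ^ Suc k) n / b n) = renewal b n / b n" for n
  proof -
    have "summable (\<lambda>k. fps_nth (Abs_fps b ^ Suc k) n / b n)"
      by (rule summable_comparison_test'[where g = M and N = 0])
         (use bound summable_mult[OF summable_powr_mult_power[OF \<rho>0 \<rho>]] in \<open>auto simp: M_def[abs_def]\<close>)
    from summable_mult2[OF this, of "b n"] have "summable (\<lambda>k. fps_nth (Abs_fps b ^ Suc k) n)" using pos[of n] by simp
    then show ?thesis unfolding renewal_def by (rule suminf_divide)
  qed
  ultimately show ?thesis by simp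
qed

section \<open>Sums of independent copies of an integer random variable\<close>

primrec iid_sum :: "nat pmf \<Rightarrow> nat \<Rightarrow> nat pmf" where
  "iid_sum \<xi> 0 = return_pmf 0"
| "iid_sum \<xi> (Suc j) = bind_pmf \<xi> (\<lambda>k. map_pmf ((+) k) (iid_sum \<xi> j))"

lemma prob_bind_pmf:
  "measure_pmf.prob (bind_pmf M f) A = (\<integral>x. measure_pmf.prob (f x) A \<partial>measure_pmf M)"
proof -
  have "ennreal (measure_pmf.prob (bind_pmf M f) A) = (\<integral>\<^sup>+x. ennreal (measure_pmf.prob (f x) A) \<partial>measure_pmf M)"
    by (simp add: measure_pmf.emeasure_eq_measure[symmetric])
  also have "\<dots> = ennreal (\<integral>x. measure_pmf.prob (f x) A \<partial>measure_pmf M)"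
    by (rule nn_integral_eq_integral) (auto intro!: measure_pmf.integrable_const_bound[where B = 1])
  finally show ?thesis by (simp add: integral_nonneg_AE)
qed

lemma prob_iid_sum_Suc:
  "measure_pmf.prob (iid_sum \<xi> (Suc j)) A = (\<integral>k. measure_pmf.prob (iid_sum \<xi> j) {i. k + i \<in> A} \<partial>measure_pmf \<xi>)"
  by (simp add: prob_bind_pmf vimage_def)

lemma pmf_iid_sum: "pmf (iid_sum \<xi> j) n = fps_nth (Abs_fps (pmf \<xi>) ^ j) n"
proof (induction j arbitrary: n)
  case 0
  then show ?case by (simp add: fps_one_nth pmf_return)
next
  case (Suc j)
  have "pmf (iid_sum \<xi> (Suc j)) n = (\<integral>k. pmf (map_pmf ((+) k) (iid_sum \<xi> j)) n \<partial>measure_pmf \<xi>)"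
    by (simp add: pmf_bind)
  also have "\<dots> = (\<Sum>k\<le>n. pmf \<xi> k *\<^sub>R pmf (map_pmf ((+) k) (iid_sum \<xi> j)) n)"
  proof (rule integral_measure_pmf)
    fix k assume "pmf (map_pmf ((+) k) (iid_sum \<xi> j)) n \<noteq> 0"
    then have "n \<in> (+) k ` set_pmf (iid_sum \<xi> j)" by (metis pmf_map_outside)
    then show "k \<in> {..n}" by auto
  qed simp
  also have "\<dots> = (\<Sum>k\<le>n. pmf \<xi> k * pmf (iid_sum \<xi> j) (n - k))"
  proof (rule sum.cong)
    fix k assume "k \<in> {..n}"
    then have "n = k + (n - k)" by simp
    then have "pmf (map_pmf ((+) k) (iid_sum \<xi> j)) n = pmf (iid_sum \<xi> j) (n - k)"
      by (metis pmf_map_inj' inj_on_add)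
    then show "pmf \<xi> k *\<^sub>R pmf (map_pmf ((+) k) (iid_sum \<xi> j)) n = pmf \<xi> k * pmf (iid_sum \<xi> j) (n - k)" by simp
  qed simp
  finally show ?case by (simp add: Suc fps_mult_nth atLeast0AtMost)
qed

text \<open>The summands are natural numbers, so one more of them cannot decrease the sum.\<close>

lemma prob_iid_sum_mono:
  assumes "i \<le> j"
  shows "measure_pmf.prob (iid_sum \<xi> i) {n..} \<le> measure_pmf.prob (iid_sum \<xi> j) {n..}"
proof (rule lift_Suc_mono_le[OF _ assms])
  fix j
  have "measure_pmf.prob (iid_sum \<xi> j) {n..} = (\<integral>k. measure_pmf.prob (iid_sum \<xi> j) {n..} \<partial>measure_pmf \<xi>)" by simp
  also have "\<dots> \<le> (\<integral>k. measure_pmf.prob (iid_sum \<xi> j) {i. k + i \<in> {n..}} \<partial>measure_pmf \<xi>)"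
    by (intro integral_mono measure_pmf.finite_measure_mono)
       (auto intro!: measure_pmf.integrable_const_bound[where B = 1])
  finally show "measure_pmf.prob (iid_sum \<xi> j) {n..} \<le> measure_pmf.prob (iid_sum \<xi> (Suc j)) {n..}"
    by (simp only: prob_iid_sum_Suc)
qed

text \<open>Either one summand exceeds \<open>x\<close>, or Chernoff's bound applies to the summands truncated at \<open>x\<close>.\<close>

lemma iid_sum_truncated_chernoff:
  fixes \<xi> :: "nat pmf" and s x y :: real
  assumes s: "s \<ge> 0"
  defines "M \<equiv> (\<integral>k. exp (s * real k) * indicator {k. real k \<le> x} k \<partial>measure_pmf \<xi>)"
  shows "measure_pmf.prob (iid_sum \<xi> j) {i. y \<le> real i} \<le>
    real j * measure_pmf.prob \<xi> {k. x < real k} + exp (- s * y) * M ^ j"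
proof (induction j arbitrary: y)
  case 0
  show ?case
  proof (cases "y \<le> 0")
    case True
    then have "exp (- s * y) \<ge> 1" using s by (simp add: mult_nonneg_nonpos)
    then have "measure_pmf.prob (iid_sum \<xi> 0) {i. y \<le> real i} \<le> exp (- s * y)"
      by (rule order_trans[OF measure_pmf.prob_le_1])
    then show ?thesis by (simp only: of_nat_0 mult_zero_left add_0_left power_0 mult_1_right)
  next
    case False
    then have "measure_pmf.prob (iid_sum \<xi> 0) {i. y \<le> real i} = 0" by (simp add: measure_return indicator_def)
    then show ?thesis by simp
  qed
next
  case (Suc j)
  let ?P = "measure_pmf.prob \<xi> {k. x < real k}"
  let ?f = "\<lambda>k. exp (s * real k) * indicator {k. real k \<le> x} k"
  have intf: "integrable (measure_pmf \<xi>) ?f"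
    by (rule measure_pmf.integrable_const_bound[where B = "exp (s * x)"])
       (use s in \<open>auto simp: indicator_def intro!: AE_I2 mult_left_mono\<close>)
  have M0: "M \<ge> 0" unfolding M_def by (rule integral_nonneg_AE) auto
  have "measure_pmf.prob (iid_sum \<xi> (Suc j)) {i. y \<le> real i}
      = (\<integral>k. measure_pmf.prob (iid_sum \<xi> j) {i. y \<le> real (k + i)} \<partial>measure_pmf \<xi>)"
    by (subst prob_iid_sum_Suc) simp
  also have "\<dots> \<le> (\<integral>k. indicator {k. x < real k} k + (real j * ?P + exp (- s * y) * M ^ j * ?f k) \<partial>measure_pmf \<xi>)"
  proof (rule integral_mono)
    show "integrable (measure_pmf \<xi>) (\<lambda>k. indicator {k. x < real k} k + (real j * ?P + exp (- s * y) * M ^ j * ?f k))"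
      by (intro Bochner_Integration.integrable_add integrable_mult_right intf)
         (auto intro!: measure_pmf.integrable_const_bound[where B = 1] simp: indicator_def)
    fix k
    show "measure_pmf.prob (iid_sum \<xi> j) {i. y \<le> real (k + i)} \<le> indicator {k. x < real k} k + (real j * ?P + exp (- s * y) * M ^ j * ?f k)"
    proof (cases "x < real k")
      case True
      have "measure_pmf.prob (iid_sum \<xi> j) {i. y \<le> real (k + i)} \<le> 1" by (rule measure_pmf.prob_le_1)
      moreover have "real j * ?P + exp (- s * y) * M ^ j * ?f k \<ge> 0" using M0 by (intro add_nonneg_nonneg mult_nonneg_nonneg) auto
      moreover have "indicator {k. x < real k} k = (1::real)" using True by simp
      ultimately show ?thesis by linarith
    next
      case False
      have "{i. y \<le> real (k + i)} = {i. y - real k \<le> real i}" by auto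
      then have "measure_pmf.prob (iid_sum \<xi> j) {i. y \<le> real (k + i)} \<le> real j * ?P + exp (- s * (y - real k)) * M ^ j"
        using Suc[of "y - real k"] by simp
      also have "exp (- s * (y - real k)) = exp (- s * y) * exp (s * real k)"
        by (simp add: exp_add[symmetric] algebra_simps)
      finally show ?thesis using False by (simp add: mult_ac)
    qed
  qed (auto intro!: measure_pmf.integrable_const_bound[where B = 1])
  also have "\<dots> = ?P + (real j * ?P + exp (- s * y) * M ^ j * M)"
    unfolding M_def using intf
    by (subst Bochner_Integration.integral_add)
       (auto intro!: measure_pmf.integrable_const_bound[where B = 1] simp: indicator_def)
  finally show ?case by (simp add: algebra_simps)
qed

text \<open>On the lower side no truncation enters, since \<open>exp (- s * k)\<close> is bounded by
  1 whatever the tail of \<xi>.\<close>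

lemma iid_sum_lower_chernoff:
  fixes \<xi> :: "nat pmf" and s y :: real
  assumes s: "s \<ge> 0"
  defines "M \<equiv> (\<integral>k. exp (- s * real k) \<partial>measure_pmf \<xi>)"
  shows "measure_pmf.prob (iid_sum \<xi> j) {i. real i \<le> y} \<le> exp (s * y) * M ^ j"
proof (induction j arbitrary: y)
  case 0
  show ?case
  proof (cases "y \<ge> 0")
    case True
    then have "exp (s * y) \<ge> 1" using s by simp
    then have "measure_pmf.prob (iid_sum \<xi> 0) {i. real i \<le> y} \<le> exp (s * y)"
      by (rule order_trans[OF measure_pmf.prob_le_1])
    then show ?thesis by (simp only: power_0 mult_1_right)
  next
    case False
    then have "measure_pmf.prob (iid_sum \<xi> 0) {i. real i \<le> y} = 0" by (simp add: measure_return indicator_def)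
    then show ?thesis by simp
  qed
next
  case (Suc j)
  have intf: "integrable (measure_pmf \<xi>) (\<lambda>k. exp (- s * real k))"
    by (rule measure_pmf.integrable_const_bound[where B = 1]) (use s in auto)
  have "measure_pmf.prob (iid_sum \<xi> (Suc j)) {i. real i \<le> y}
      = (\<integral>k. measure_pmf.prob (iid_sum \<xi> j) {i. real (k + i) \<le> y} \<partial>measure_pmf \<xi>)"
    by (subst prob_iid_sum_Suc) simp
  also have "\<dots> \<le> (\<integral>k. exp (s * y) * M ^ j * exp (- s * real k) \<partial>measure_pmf \<xi>)"
  proof (rule integral_mono)
    fix k
    have "{i. real (k + i) \<le> y} = {i. real i \<le> y - real k}" by auto
    then have "measure_pmf.prob (iid_sum \<xi> j) {i. real (k + i) \<le> y} \<le> exp (s * (y - real k)) * M ^ j"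
      using Suc[of "y - real k"] by simp
    also have "exp (s * (y - real k)) = exp (s * y) * exp (- s * real k)"
      by (simp add: exp_add[symmetric] algebra_simps)
    finally show "measure_pmf.prob (iid_sum \<xi> j) {i. real (k + i) \<le> y} \<le> exp (s * y) * M ^ j * exp (- s * real k)"
      by (simp add: mult_ac)
  next
    show "integrable (measure_pmf \<xi>) (\<lambda>k. exp (s * y) * M ^ j * exp (- s * real k))"
      by (intro integrable_mult_right intf)
  qed (auto intro!: measure_pmf.integrable_const_bound[where B = 1])
  also have "\<dots> = exp (s * y) * M ^ j * M" unfolding M_def using intf by simp
  finally show ?case by (simp add: algebra_simps)
qed

section \<open>Deviation bounds and laws of large numbers for summands with finite mean\<close>

context
  fixes \<xi> :: "nat pmf" and m :: real
  assumes mean: "integrable (measure_pmf \<xi>) real" "m = (\<integral>k. real k \<partial>measure_pmf \<xi>)" and m: "m > 0"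
begin

text \<open>A Fuk-Nagaev type inequality that uses only the first moment. Truncating at
  \<open>n / r\<close> makes the Chernoff term a power \<open>r\<close> of \<open>j / n\<close>, and
  \<open>r\<close> is free; a large \<open>r\<close> later beats the growth of the weights
  \<open>e j\<close> towards small \<open>j\<close>.\<close>

lemma iid_sum_big_jump_bound:
  fixes r :: real
  assumes r: "r > 0" and n: "n > 0" and jn: "real j * m \<le> real n"
  shows "measure_pmf.prob (iid_sum \<xi> j) {n..} \<le>
    real j * measure_pmf.prob \<xi> {k. real n / r < real k} + (exp 1 * m * real j / real n) powr r"
proof (cases "j = 0")
  case True
  then show ?thesis using n by (simp add: measure_return indicator_def)
next
  case False
  then have j: "j > 0" by simp
  define x where "x = real n / r"
  have x: "x > 0" using n r by (simp add: x_def)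
  \<comment> \<open>The parameter is tuned by \<open>exp (s * x) = u\<close>. Convexity of
    \<open>exp\<close> on \<open>[0, s * x]\<close> then bounds the truncated transform by
    \<open>exp (u / x * m)\<close>, whose power \<open>j\<close> is exactly \<open>exp r\<close>,
    while \<open>exp (- s * n)\<close> is \<open>u powr -r\<close>. The hypothesis
    \<open>j * m \<le> n\<close> means \<open>u \<ge> 1\<close>, hence
    \<open>s \<ge> 0\<close>.\<close>
  define u where "u = real n / (real j * m)"
  have u: "u \<ge> 1" using jn j m by (simp add: u_def)
  define s where "s = ln u / x"
  have s: "s \<ge> 0" using u x by (simp add: s_def)
  have sx: "exp (s * x) = u" using u x by (simp add: s_def)
  define M where "M = (\<integral>k. exp (s * real k) * indicator {k. real k \<le> x} k \<partial>measure_pmf \<xi>)"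
  have "M \<le> (\<integral>k. 1 + (u / x) * real k \<partial>measure_pmf \<xi>)"
    unfolding M_def
  proof (rule integral_mono)
    fix k
    show "exp (s * real k) * indicator {k. real k \<le> x} k \<le> 1 + (u / x) * real k"
    proof (cases "real k \<le> x")
      case True
      let ?t = "real k / x"
      have t: "0 \<le> ?t" "?t \<le> 1" using True x by auto
      have "exp ((1 - ?t) *\<^sub>R 0 + ?t *\<^sub>R (s * x)) \<le> (1 - ?t) * exp 0 + ?t * exp (s * x)"
        by (rule convex_onD[OF exp_convex t]) auto
      moreover have "(1 - ?t) *\<^sub>R 0 + ?t *\<^sub>R (s * x) = s * real k" using x by simp
      ultimately have "exp (s * real k) \<le> (1 - ?t) + ?t * u" by (simp add: sx)
      also have "\<dots> \<le> 1 + (u / x) * real k" using t by (simp add: mult.commute)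
      finally show ?thesis using True by simp
    qed (use u x in simp)
  next
    show "integrable (measure_pmf \<xi>) (\<lambda>k. exp (s * real k) * indicator {k. real k \<le> x} k)"
      by (rule measure_pmf.integrable_const_bound[where B = "exp (s * x)"])
         (use s in \<open>auto simp: indicator_def intro!: AE_I2 mult_left_mono\<close>)
  qed (use mean in auto)
  also have "\<dots> = 1 + (u / x) * m" using mean by simp
  also have "\<dots> \<le> exp (u / x * m)" by (rule exp_ge_add_one_self)
  finally have "M \<le> exp (u / x * m)" .
  moreover have "M \<ge> 0" unfolding M_def by (rule integral_nonneg_AE) auto
  ultimately have "M ^ j \<le> exp (u / x * m) ^ j" by (rule power_mono)
  also have "\<dots> = exp (real j * (u / x * m))" by (rule exp_of_nat_mult[symmetric])
  also have "real j * (u / x * m) = r" unfolding u_def x_def using j m n r by simp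
  finally have Mj: "M ^ j \<le> exp r" .
  have "exp (- s * real n) = u powr (-r)"
    using u n r by (simp add: s_def x_def powr_def)
  then have "exp (- s * real n) * M ^ j \<le> u powr (-r) * exp r" using Mj by (simp add: mult_left_mono)
  also have "\<dots> = (exp 1 * m * real j / real n) powr r"
  proof -
    have "exp 1 * m * real j / real n = exp 1 * inverse u" using j m n by (simp add: u_def field_simps)
    also have "\<dots> powr r = exp 1 powr r * inverse u powr r" by (rule powr_mult)
    also have "\<dots> = u powr (-r) * exp r" using u by (simp add: powr_def ln_inverse)
    finally show ?thesis by simp
  qed
  finally have "exp (- s * real n) * M ^ j \<le> (exp 1 * m * real j / real n) powr r" .
  moreover have "measure_pmf.prob (iid_sum \<xi> j) {i. real n \<le> real i} \<le>
      real j * measure_pmf.prob \<xi> {k. x < real k} + exp (- s * real n) * M ^ j"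
    unfolding M_def by (rule iid_sum_truncated_chernoff[OF s])
  moreover have "{i. real n \<le> real i} = {n..}" by auto
  ultimately show ?thesis by (simp add: x_def)
qed

text \<open>Jumps above \<gamma> n are excluded by the tail hypothesis \<open>t0\<close>, as there
  are only O(n) summands. For the truncated ones a Chernoff parameter of order 1/n suffices: the
  transform is then \<open>1 + s m\<close> up to a factor close to 1, so the exponent stays strictly
  negative.\<close>

lemma iid_sum_LLN_upper:
  assumes k: "\<And>n. real (k n) * m \<le> (1 - \<epsilon>) * real n" and \<epsilon>: "0 < \<epsilon>" "\<epsilon> < 1"
    and t0: "\<And>\<gamma>. \<gamma> > 0 \<Longrightarrow> (\<lambda>n. real n * measure_pmf.prob \<xi> {i. \<gamma> * real n < real i}) \<longlonglongrightarrow> 0"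
  shows "(\<lambda>n. measure_pmf.prob (iid_sum \<xi> (k n)) {n..}) \<longlonglongrightarrow> 0"
proof (rule LIMSEQ_I)
  fix e :: real assume e: "e > 0"
  \<comment> \<open>\<theta> is large enough to make the final Chernoff factor less than half of the
    prescribed error.\<close>
  define \<theta> where "\<theta> = 2 / \<epsilon> * (\<bar>ln (e / 2)\<bar> + 1)"
  have \<theta>: "\<theta> > 0" using \<epsilon> by (simp add: \<theta>_def)
  have exp_small: "exp (- \<theta> * \<epsilon> / 2) < e / 2"
  proof -
    have "- \<theta> * \<epsilon> / 2 = - (\<bar>ln (e / 2)\<bar> + 1)" using \<epsilon> by (simp add: \<theta>_def)
    also have "\<dots> < ln (e / 2)" by linarith
    finally have "exp (- \<theta> * \<epsilon> / 2) < exp (ln (e / 2))" by (simp only: exp_less_mono)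
    then show ?thesis using e by simp
  qed
  \<comment> \<open>\<open>v > 1\<close> is the admissible loss from truncation: since
    \<open>v * (1 - \<epsilon>) = 1 - \<epsilon> / 2\<close>, half of the margin \<epsilon>
    survives. The truncation level \<gamma> n is the one at which
    \<open>exp (s * x) = v\<close>.\<close>
  define v where "v = (1 - \<epsilon> / 2) / (1 - \<epsilon>)"
  have v: "v > 1" using \<epsilon> by (simp add: v_def)
  define \<gamma> where "\<gamma> = ln v / \<theta>"
  have \<gamma>: "\<gamma> > 0" using v \<theta> by (simp add: \<gamma>_def)
  have bound: "measure_pmf.prob (iid_sum \<xi> (k n)) {n..} \<le>
      (1 / m) * (real n * measure_pmf.prob \<xi> {i. \<gamma> * real n < real i}) + exp (- \<theta> * \<epsilon> / 2)" if n: "n > 0" for n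
  proof -
    define s where "s = \<theta> / real n"
    have s: "s > 0" using \<theta> n by (simp add: s_def)
    define x where "x = \<gamma> * real n"
    have sx: "exp (s * x) = v" using n \<theta> v by (simp add: s_def x_def \<gamma>_def)
    define M where "M = (\<integral>k. exp (s * real k) * indicator {k. real k \<le> x} k \<partial>measure_pmf \<xi>)"
    have "M \<le> (\<integral>k. 1 + (s * v) * real k \<partial>measure_pmf \<xi>)"
      unfolding M_def
    proof (rule integral_mono)
      fix k
      show "exp (s * real k) * indicator {k. real k \<le> x} k \<le> 1 + (s * v) * real k"
      proof (cases "real k \<le> x")
        case True
        have "1 - s * real k \<le> exp (- (s * real k))" using exp_ge_add_one_self[of "- (s * real k)"] by simp
        then have "(1 - s * real k) * exp (s * real k) \<le> exp (- (s * real k)) * exp (s * real k)"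
          by (rule mult_right_mono) simp
        also have "\<dots> = 1" by (simp add: exp_add[symmetric])
        finally have "exp (s * real k) \<le> 1 + s * real k * exp (s * real k)" by (simp add: algebra_simps)
        also have "s * real k * exp (s * real k) \<le> s * real k * v"
          unfolding sx[symmetric] using True s by (intro mult_left_mono) auto
        finally show ?thesis using True by (simp add: mult_ac)
      qed (use s v in simp)
    next
      show "integrable (measure_pmf \<xi>) (\<lambda>k. exp (s * real k) * indicator {k. real k \<le> x} k)"
        by (rule measure_pmf.integrable_const_bound[where B = "exp (s * x)"])
           (use s in \<open>auto simp: indicator_def intro!: AE_I2 mult_left_mono\<close>)
    qed (use mean in auto)
    also have "\<dots> = 1 + (s * v) * m" using mean by simp
    also have "\<dots> \<le> exp (s * v * m)" by (rule exp_ge_add_one_self)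
    finally have "M \<le> exp (s * v * m)" .
    moreover have "M \<ge> 0" unfolding M_def by (rule integral_nonneg_AE) auto
    ultimately have "M ^ k n \<le> exp (s * v * m) ^ k n" by (rule power_mono)
    also have "\<dots> = exp (real (k n) * (s * v * m))" by (rule exp_of_nat_mult[symmetric])
    also have "\<dots> \<le> exp (\<theta> * (1 - \<epsilon> / 2))"
    proof -
      have "real (k n) * (s * v * m) = (s * v) * (real (k n) * m)" by simp
      also have "\<dots> \<le> (s * v) * ((1 - \<epsilon>) * real n)" using k s v by (intro mult_left_mono) auto
      also have "\<dots> = \<theta> * (v * (1 - \<epsilon>))" using n by (simp add: s_def)
      also have "v * (1 - \<epsilon>) = 1 - \<epsilon> / 2" using \<epsilon> by (simp add: v_def)
      finally show ?thesis by simp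
    qed
    finally have "exp (- s * real n) * M ^ k n \<le> exp (- s * real n) * exp (\<theta> * (1 - \<epsilon> / 2))" by simp
    also have "\<dots> = exp (- \<theta> * \<epsilon> / 2)" using n by (simp add: exp_add[symmetric] s_def algebra_simps)
    finally have 1: "exp (- s * real n) * M ^ k n \<le> exp (- \<theta> * \<epsilon> / 2)" .
    have "measure_pmf.prob (iid_sum \<xi> (k n)) {i. real n \<le> real i} \<le>
        real (k n) * measure_pmf.prob \<xi> {k. x < real k} + exp (- s * real n) * M ^ k n"
      unfolding M_def by (rule iid_sum_truncated_chernoff) (use s in simp)
    moreover have "{i. real n \<le> real i} = {n..}" by auto
    moreover have "real (k n) * measure_pmf.prob \<xi> {k. x < real k} \<le> (real n / m) * measure_pmf.prob \<xi> {k. x < real k}"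
    proof (rule mult_right_mono)
      have "(1 - \<epsilon>) * real n \<le> real n" using \<epsilon> by (simp add: mult_left_le_one_le)
      then have "real (k n) * m \<le> real n" using k[of n] by linarith
      then show "real (k n) \<le> real n / m" using m by (simp add: pos_le_divide_eq)
    qed simp
    ultimately show ?thesis using 1 by (simp add: x_def)
  qed
  have "(\<lambda>n. (1 / m) * (real n * measure_pmf.prob \<xi> {i. \<gamma> * real n < real i}) + exp (- \<theta> * \<epsilon> / 2)) \<longlonglongrightarrow> (1 / m) * 0 + exp (- \<theta> * \<epsilon> / 2)"
    by (intro tendsto_intros t0 \<gamma>)
  then have "\<forall>\<^sub>F n in sequentially. (1 / m) * (real n * measure_pmf.prob \<xi> {i. \<gamma> * real n < real i}) + exp (- \<theta> * \<epsilon> / 2) < e"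
    by (rule order_tendstoD) (use exp_small e in simp)
  then have "\<forall>\<^sub>F n in sequentially. norm (measure_pmf.prob (iid_sum \<xi> (k n)) {n..} - 0) < e"
    using eventually_gt_at_top[of 0]
  proof eventually_elim
    case (elim n)
    then show ?case using bound[of n] by simp
  qed
  then show "\<exists>no. \<forall>n\<ge>no. norm (measure_pmf.prob (iid_sum \<xi> (k n)) {n..} - 0) < e" by (simp add: eventually_sequentially)
qed

text \<open>Chernoff's lower bound with \<open>s = \<theta> / n\<close>. A finite mean is enough:
  \<open>n * (1 - E exp (- s \<xi>))\<close> converges to \<open>\<theta> * m\<close> by dominated
  convergence, and the margin \<epsilon> leaves the exponent
  \<open>- \<theta> * \<epsilon>\<close>.\<close>

lemma iid_sum_LLN_lower:
  assumes k: "\<And>n. real (k n) * m \<ge> (1 + \<epsilon>) * real n" and \<epsilon>: "0 < \<epsilon>"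
  shows "(\<lambda>n. measure_pmf.prob (iid_sum \<xi> (k n)) {n..}) \<longlonglongrightarrow> 1"
proof (rule LIMSEQ_I)
  fix e :: real assume e: "e > 0"
  define \<theta> where "\<theta> = (\<bar>ln e\<bar> + 1) / \<epsilon>"
  have \<theta>: "\<theta> > 0" using \<epsilon> by (simp add: \<theta>_def)
  have exp_small: "exp (- \<theta> * \<epsilon>) < e"
  proof -
    have "- \<theta> * \<epsilon> = - (\<bar>ln e\<bar> + 1)" using \<epsilon> by (simp add: \<theta>_def)
    also have "\<dots> < ln e" by linarith
    finally have "exp (- \<theta> * \<epsilon>) < exp (ln e)" by (simp only: exp_less_mono)
    then show ?thesis using e by simp
  qed
  \<comment> \<open>The rescaled exponent of the Laplace transform, so that the transform at
    \<open>\<theta> / n\<close> equals \<open>1 - \<mu> n / n\<close>; the integrand is dominated by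
    \<open>\<theta> * i\<close>.\<close>
  define \<mu> where "\<mu> n = (\<integral>i. real n * (1 - exp (- (\<theta> / real n) * real i)) \<partial>measure_pmf \<xi>)" for n
  have "\<mu> \<longlonglongrightarrow> (\<integral>i. \<theta> * real i \<partial>measure_pmf \<xi>)"
    unfolding \<mu>_def[abs_def]
  proof (rule integral_dominated_convergence[where w = "\<lambda>i. \<theta> * real i"])
    show "AE i in measure_pmf \<xi>. (\<lambda>n. real n * (1 - exp (- (\<theta> / real n) * real i))) \<longlonglongrightarrow> \<theta> * real i"
    proof (rule AE_I2)
      fix i :: nat
      show "(\<lambda>n. real n * (1 - exp (- (\<theta> / real n) * real i))) \<longlonglongrightarrow> \<theta> * real i"
      proof -
        let ?c = "\<theta> * real i"
        have "((\<lambda>x. exp (- ?c * x)) has_real_derivative (- ?c)) (at 0)"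
          by (auto intro!: derivative_eq_intros)
        then have "((\<lambda>x. (exp (- ?c * x) - 1) / x) \<longlongrightarrow> - ?c) (at 0)"
          by (simp add: has_field_derivative_iff)
        moreover have "filterlim (\<lambda>n. 1 / real n) (at 0) sequentially"
          using lim_1_over_n eventually_gt_at_top[of 0]
          by (auto simp: filterlim_at elim!: eventually_mono)
        ultimately have "(\<lambda>n. (exp (- ?c * (1 / real n)) - 1) / (1 / real n)) \<longlonglongrightarrow> - ?c"
          by (rule filterlim_compose)
        from tendsto_minus[OF this] show ?thesis by (simp add: algebra_simps)
      qed
    qed
    show "AE i in measure_pmf \<xi>. norm (real n * (1 - exp (- (\<theta> / real n) * real i))) \<le> \<theta> * real i" for n
    proof (rule AE_I2)
      fix i
      let ?u = "\<theta> / real n * real i"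
      have u: "?u \<ge> 0" using \<theta> by simp
      have "1 - exp (- ?u) \<le> ?u" using exp_ge_add_one_self[of "- ?u"] by linarith
      then have "real n * (1 - exp (- ?u)) \<le> real n * ?u" by (rule mult_left_mono) simp
      also have "\<dots> \<le> \<theta> * real i" using \<theta> by simp
      finally show "norm (real n * (1 - exp (- (\<theta> / real n) * real i))) \<le> \<theta> * real i" using u by simp
    qed
  qed (use mean in auto)
  then have \<mu>: "\<mu> \<longlonglongrightarrow> \<theta> * m" using mean by simp
  have bound: "measure_pmf.prob (iid_sum \<xi> (k n)) {n..} \<ge> 1 - exp (\<theta> - (1 + \<epsilon>) / m * \<mu> n)" if n: "n > 0" for n
  proof -
    define s where "s = \<theta> / real n"
    have s: "s > 0" using \<theta> n by (simp add: s_def)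
    define M where "M = (\<integral>i. exp (- s * real i) \<partial>measure_pmf \<xi>)"
    have intf: "integrable (measure_pmf \<xi>) (\<lambda>k. exp (- s * real k))"
      by (rule measure_pmf.integrable_const_bound[where B = 1]) (use s in auto)
    have M\<mu>: "M = 1 - \<mu> n / real n" using intf n unfolding \<mu>_def M_def s_def by simp
    have \<mu>0: "\<mu> n \<ge> 0" unfolding \<mu>_def using \<theta> by (intro integral_nonneg_AE) auto
    have M0: "M \<ge> 0" unfolding M_def by (rule integral_nonneg_AE) auto
    have "M \<le> exp (- (\<mu> n / real n))" unfolding M\<mu> using exp_ge_add_one_self[of "- (\<mu> n / real n)"] by linarith
    then have "M ^ k n \<le> exp (- (\<mu> n / real n)) ^ k n" using M0 by (rule power_mono)
    also have "\<dots> = exp (- (real (k n) * (\<mu> n / real n)))"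
      using exp_of_nat_mult[of "k n" "- (\<mu> n / real n)"] by simp
    also have "\<dots> \<le> exp (- ((1 + \<epsilon>) / m * \<mu> n))"
    proof -
      have "(1 + \<epsilon>) * real n / m \<le> real (k n)" using k[of n] m by (simp add: pos_divide_le_eq)
      then have "(1 + \<epsilon>) * real n / m * (\<mu> n / real n) \<le> real (k n) * (\<mu> n / real n)"
        by (rule mult_right_mono) (use \<mu>0 in simp)
      then show ?thesis using n by simp
    qed
    finally have "exp (s * real n) * M ^ k n \<le> exp (s * real n) * exp (- ((1 + \<epsilon>) / m * \<mu> n))" by simp
    also have "\<dots> = exp (\<theta> - (1 + \<epsilon>) / m * \<mu> n)" using n by (simp add: exp_add[symmetric] s_def)
    finally have "exp (s * real n) * M ^ k n \<le> exp (\<theta> - (1 + \<epsilon>) / m * \<mu> n)" .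
    moreover have "measure_pmf.prob (iid_sum \<xi> (k n)) {i. real i \<le> real n} \<le> exp (s * real n) * M ^ k n"
      unfolding M_def by (rule iid_sum_lower_chernoff) (use s in simp)
    moreover have "measure_pmf.prob (iid_sum \<xi> (k n)) {i. i < n} \<le> measure_pmf.prob (iid_sum \<xi> (k n)) {i. real i \<le> real n}"
      by (rule measure_pmf.finite_measure_mono) auto
    moreover have "measure_pmf.prob (iid_sum \<xi> (k n)) {n..} = 1 - measure_pmf.prob (iid_sum \<xi> (k n)) {i. i < n}"
      using measure_pmf.prob_compl[of "{i. i < n}" "iid_sum \<xi> (k n)"] by (simp add: Compl_eq_Diff_UNIV[symmetric] Collect_neg_eq[symmetric] not_less atLeast_def)
    ultimately show ?thesis by linarith
  qed
  have "(\<lambda>n. exp (\<theta> - (1 + \<epsilon>) / m * \<mu> n)) \<longlonglongrightarrow> exp (\<theta> - (1 + \<epsilon>) / m * (\<theta> * m))"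
    by (intro tendsto_intros \<mu>)
  moreover have "\<theta> - (1 + \<epsilon>) / m * (\<theta> * m) = - \<theta> * \<epsilon>"
  proof -
    have "(1 + \<epsilon>) / m * (\<theta> * m) = (1 + \<epsilon>) * \<theta>" using m by simp
    then show ?thesis by (simp add: algebra_simps)
  qed
  ultimately have "(\<lambda>n. exp (\<theta> - (1 + \<epsilon>) / m * \<mu> n)) \<longlonglongrightarrow> exp (- \<theta> * \<epsilon>)" by (simp only:)
  then have "\<forall>\<^sub>F n in sequentially. exp (\<theta> - (1 + \<epsilon>) / m * \<mu> n) < e"
    by (rule order_tendstoD(2)[OF _ exp_small])
  then have "\<forall>\<^sub>F n in sequentially. norm (measure_pmf.prob (iid_sum \<xi> (k n)) {n..} - 1) < e"
    using eventually_gt_at_top[of 0]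
  proof eventually_elim
    case (elim n)
    have "measure_pmf.prob (iid_sum \<xi> (k n)) {n..} \<le> 1" by simp
    then show ?case using bound[OF elim(2)] elim(1) by (simp only: real_norm_def abs_less_iff) linarith
  qed
  then show "\<exists>no. \<forall>n\<ge>no. norm (measure_pmf.prob (iid_sum \<xi> (k n)) {n..} - 1) < e" by (simp add: eventually_sequentially)
qed

end

section \<open>The law of the orbit progeny\<close>

lemma fps_power_mono:
  fixes x y :: "nat \<Rightarrow> real"
  assumes "\<And>n. 0 \<le> x n" "\<And>n. x n \<le> y n"
  shows "fps_nth (Abs_fps x ^ k) n \<le> fps_nth (Abs_fps y ^ k) n"
proof (induction k arbitrary: n)
  case (Suc k)
  have y: "0 \<le> y n" for n using assms(1)[of n] assms(2)[of n] by linarith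
  show ?case unfolding power_Suc fps_mult_nth
    by (intro sum_mono mult_mono Suc.IH fps_power_nonneg) (use assms y in auto)
qed auto

lemma fps_power_tendsto:
  fixes x :: "nat \<Rightarrow> nat \<Rightarrow> real"
  assumes "\<And>n. (\<lambda>i. x i n) \<longlonglongrightarrow> y n"
  shows "(\<lambda>i. fps_nth (Abs_fps (x i) ^ k) n) \<longlonglongrightarrow> fps_nth (Abs_fps y ^ k) n"
proof (induction k arbitrary: n)
  case (Suc k)
  show ?case unfolding power_Suc fps_mult_nth
    by (intro tendsto_sum tendsto_mult Suc.IH) (use assms in simp)
qed auto

text \<open>The law \<open>\<omega>\<close> solves \<open>w = q A(w) + p z\<close> for generating functions. It is the limit of the iterates starting
  from \<open>0\<close>; no mass escapes since \<open>q A'(1) < 1\<close>.\<close>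

lemma exists_progeny_law:
  fixes a :: "nat \<Rightarrow> real"
  assumes a: "\<And>n. a n \<ge> 0" "a sums 1" and mean: "(\<lambda>n. real n * a n) sums \<rho>"
    and pq: "p > 0" "q > 0" "p + q = 1" and sub: "q * \<rho> < 1"
  obtains \<omega> where "\<And>n. \<omega> n \<ge> 0" "\<omega> sums 1"
    "\<And>z w. 0 \<le> z \<Longrightarrow> z \<le> 1 \<Longrightarrow> (\<lambda>n. \<omega> n * z ^ n) sums w \<Longrightarrow> w = q * (\<Sum>j. a j * w ^ j) + p * z"
proof -
  \<comment> \<open>Coefficient form of the map \<open>w\<close> to \<open>q A(w) + p z\<close>; the
    iterates from 0 increase coefficientwise and have total mass at most 1.\<close>
  define \<Phi> where "\<Phi> x n = q * (\<Sum>j. a j * fps_nth (Abs_fps x ^ j) n) + (if n = 1 then p else 0)" for x :: "nat \<Rightarrow> real" and n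
  define W where "W k = (\<Phi> ^^ k) (\<lambda>_. 0)" for k
  have WS: "W (Suc k) = \<Phi> (W k)" and W0: "W 0 = (\<lambda>_. 0)" for k by (auto simp: W_def)
  have as: "summable a" "suminf a = 1" using a by (auto simp: sums_iff)
  have delta: "(\<lambda>n. if n = 1 then p else 0) sums p" using sums_single[of 1 "\<lambda>_. p"] by simp
  have A_sums: "(\<lambda>j. a j * s ^ j) sums (\<Sum>j. a j * s ^ j)" "(\<Sum>j. a j * s ^ j) \<le> 1" if "0 \<le> s" "s \<le> 1" for s
  proof -
    have le: "a j * s ^ j \<le> a j" for j using that a(1)[of j] by (simp add: mult_left_le power_le_one)
    have sm: "summable (\<lambda>j. a j * s ^ j)"
      by (rule summable_comparison_test'[where g = a and N = 0]) (use as le a that in auto)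
    then show "(\<lambda>j. a j * s ^ j) sums (\<Sum>j. a j * s ^ j)" by (rule summable_sums)
    show "(\<Sum>j. a j * s ^ j) \<le> 1" unfolding as(2)[symmetric] by (rule suminf_le) (use le sm as in auto)
  qed
  have swap: "(\<lambda>n. (\<Sum>j. a j * fps_nth (Abs_fps x ^ j) n) * z ^ n) sums (\<Sum>j. a j * w ^ j)"
      "summable (\<lambda>j. a j * fps_nth (Abs_fps x ^ j) n)"
    if x: "\<And>n. x n \<ge> 0" and z: "0 \<le> z" and w: "(\<lambda>n. x n * z ^ n) sums w" "w \<le> 1" and x1: "\<exists>s\<le>1. x sums s" for x z w n
  proof -
    have w0: "w \<ge> 0" using w z x by (auto simp: sums_iff intro!: suminf_nonneg)
    have row: "(\<lambda>n. a j * fps_nth (Abs_fps x ^ j) n * z ^ n) sums (a j * w ^ j)" for j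
      using sums_mult[OF fps_power_sums[OF x z w(1)], of "a j" j] by (simp add: mult_ac)
    have s1: "(\<lambda>n. \<Sum>j. a j * fps_nth (Abs_fps x ^ j) n * z ^ n) sums (\<Sum>j. a j * w ^ j)"
      by (rule sums_swap_nonneg(1)[OF _ row A_sums(1)[OF w0 w(2)]]) (use a z fps_power_nonneg[OF x] in auto)
    obtain s where s: "s \<le> 1" "(\<lambda>n. x n * 1 ^ n) sums s" using x1 by auto
    have s0: "s \<ge> 0" using s x by (auto simp: sums_iff intro!: suminf_nonneg)
    have row1: "(\<lambda>n. a j * fps_nth (Abs_fps x ^ j) n) sums (a j * s ^ j)" for j
      using sums_mult[OF fps_power_sums[OF x _ s(2)], of "a j" j] by simp
    have sm: "summable (\<lambda>j. a j * fps_nth (Abs_fps x ^ j) n)" for n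
      by (rule sums_swap_nonneg(2)[OF _ row1 A_sums(1)[OF s0 s(1)]]) (use a fps_power_nonneg[OF x] in auto)
    then show "summable (\<lambda>j. a j * fps_nth (Abs_fps x ^ j) n)" .
    show "(\<lambda>n. (\<Sum>j. a j * fps_nth (Abs_fps x ^ j) n) * z ^ n) sums (\<Sum>j. a j * w ^ j)"
      using s1 by (simp add: suminf_mult2[OF sm])
  qed
  have inv: "(\<forall>n. W k n \<ge> 0) \<and> (\<exists>s\<le>1. W k sums s)" for k
  proof (induction k)
    case 0
    then show ?case by (auto simp: W0 intro!: exI[of _ 0])
  next
    case (Suc k)
    then obtain s where s: "s \<le> 1" "(\<lambda>n. W k n * 1 ^ n) sums s" "\<And>n. W k n \<ge> 0" by auto
    have s0: "s \<ge> 0" using s by (auto simp: sums_iff intro!: suminf_nonneg)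
    note sw = swap[OF s(3) _ s(2,1)]
    have "(\<lambda>n. \<Sum>j. a j * fps_nth (Abs_fps (W k) ^ j) n) sums (\<Sum>j. a j * s ^ j)"
      using sw(1) Suc by simp
    from sums_add[OF sums_mult[OF this, of q] delta]
    have "W (Suc k) sums (q * (\<Sum>j. a j * s ^ j) + p)" by (simp add: WS \<Phi>_def[abs_def])
    moreover have "q * (\<Sum>j. a j * s ^ j) + p \<le> 1"
      using mult_left_mono[OF A_sums(2)[OF s0 s(1)], of q] pq by linarith
    moreover have "W (Suc k) n \<ge> 0" for n
      unfolding WS \<Phi>_def using pq a sw(2) Suc fps_power_nonneg[OF s(3)]
      by (intro add_nonneg_nonneg mult_nonneg_nonneg suminf_nonneg) auto
    ultimately show ?case by blast
  qed
  then have Wnn: "W k n \<ge> 0" for k n by blast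
  have Wsm: "summable (\<lambda>j. a j * fps_nth (Abs_fps (W k) ^ j) n)" for k n
  proof -
    obtain s where s: "s \<le> 1" "(\<lambda>n. W k n * 1 ^ n) sums s" using inv[of k] by auto
    show ?thesis using swap(2)[OF Wnn _ s(2,1)] inv[of k] by simp
  qed
  have Wmono: "W k n \<le> W (Suc k) n" for k n
  proof (induction k arbitrary: n)
    case 0
    then show ?case using Wnn[of 1 n] by (simp add: W0)
  next
    case (Suc k)
    have "(\<Sum>j. a j * fps_nth (Abs_fps (W k) ^ j) n) \<le> (\<Sum>j. a j * fps_nth (Abs_fps (W (Suc k)) ^ j) n)"
      using Wsm[of k n] Wsm[of "Suc k" n]
      by (rule suminf_le[rotated]) (rule mult_left_mono[OF fps_power_mono[OF Wnn Suc.IH] a(1)])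
    then have "\<Phi> (W k) n \<le> \<Phi> (W (Suc k)) n" unfolding \<Phi>_def using pq by simp
    then show ?case unfolding WS[symmetric] .
  qed
  have part: "sum (W k) {..<n} \<le> 1" for k n
  proof -
    obtain s where s: "s \<le> 1" "W k sums s" using inv[of k] by auto
    have "sum (W k) {..<n} \<le> suminf (W k)" by (rule sum_le_suminf) (use s Wnn in \<open>auto simp: sums_iff\<close>)
    then show ?thesis using s by (simp add: sums_iff)
  qed
  have W1: "W k n \<le> 1" for k n
  proof -
    have "W k n \<le> sum (W k) {..<Suc n}" by (rule member_le_sum) (use Wnn in auto)
    then show ?thesis using part[of k "Suc n"] by linarith
  qed
  define \<omega> where "\<omega> n = lim (\<lambda>k. W k n)" for n
  have \<omega>: "(\<lambda>k. W k n) \<longlonglongrightarrow> \<omega> n" for n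
  proof -
    have "incseq (\<lambda>k. W k n)" by (rule incseq_SucI) (rule Wmono)
    moreover have "\<forall>k. W k n \<le> 1" using W1 by simp
    ultimately obtain L where "(\<lambda>k. W k n) \<longlonglongrightarrow> L" by (rule incseq_convergent)
    then show ?thesis unfolding \<omega>_def by (simp add: limI)
  qed
  have \<omega>0: "\<omega> n \<ge> 0" for n by (rule LIMSEQ_le_const[OF \<omega>]) (use Wnn in auto)
  have \<omega>part: "sum \<omega> {..<n} \<le> 1" for n
    by (rule LIMSEQ_le_const2[OF tendsto_sum[OF \<omega>]]) (use part in auto)
  have \<omega>sm: "summable \<omega>" by (rule summableI_nonneg_bounded[OF \<omega>0 \<omega>part])
  have \<omega>le1: "suminf \<omega> \<le> 1" by (rule suminf_le_const[OF \<omega>sm \<omega>part])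
  have eq: "\<omega> n = \<Phi> \<omega> n" for n
  proof -
    \<comment> \<open>Each coefficient of a convolution power of a defective law is at most 1, so
      \<open>a j\<close> dominates and the limit may be taken inside the sum over
      \<open>j\<close>.\<close>
    have bd: "\<bar>a j * fps_nth (Abs_fps (W k) ^ j) n\<bar> \<le> a j" for j k
    proof -
      obtain s where s: "s \<le> 1" "(\<lambda>n. W k n * 1 ^ n) sums s" using inv[of k] by auto
      have s0: "s \<ge> 0" using s Wnn by (auto simp: sums_iff intro!: suminf_nonneg)
      have ps: "(\<lambda>n. fps_nth (Abs_fps (W k) ^ j) n) sums s ^ j"
        using fps_power_sums[OF Wnn _ s(2)] by simp
      have "fps_nth (Abs_fps (W k) ^ j) n = sum (\<lambda>n. fps_nth (Abs_fps (W k) ^ j) n) {n}" by simp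
      also have "\<dots> \<le> suminf (\<lambda>n. fps_nth (Abs_fps (W k) ^ j) n)"
        by (rule sum_le_suminf) (use ps fps_power_nonneg[OF Wnn] in \<open>auto simp: sums_iff\<close>)
      also have "\<dots> = s ^ j" using ps by (simp add: sums_iff)
      also have "\<dots> \<le> 1" using s s0 by (simp add: power_le_one)
      finally show ?thesis using a(1)[of j] fps_power_nonneg[OF Wnn] by (simp add: abs_mult mult_left_le)
    qed
    have "(\<lambda>k. \<Sum>j. a j * fps_nth (Abs_fps (W k) ^ j) n) \<longlonglongrightarrow> (\<Sum>j. a j * fps_nth (Abs_fps \<omega> ^ j) n)"
      by (rule tannery_seq(1)[where M = a and ?n0.0 = 0]) (use bd as \<omega> in \<open>auto intro!: tendsto_intros fps_power_tendsto\<close>)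
    then have "(\<lambda>k. W (Suc k) n) \<longlonglongrightarrow> \<Phi> \<omega> n" unfolding WS \<Phi>_def by (intro tendsto_intros)
    moreover have "(\<lambda>k. W (Suc k) n) \<longlonglongrightarrow> \<omega> n" by (rule LIMSEQ_Suc[OF \<omega>])
    ultimately show ?thesis by (rule LIMSEQ_unique[rotated])
  qed
  have fixpt: "w = q * (\<Sum>j. a j * w ^ j) + p * z" if z: "0 \<le> z" "z \<le> 1" and w: "(\<lambda>n. \<omega> n * z ^ n) sums w" for z w
  proof -
    have "w \<le> 1"
    proof -
      have "(\<Sum>n. \<omega> n * z ^ n) \<le> suminf \<omega>"
        by (rule suminf_le) (use w \<omega>sm \<omega>0 z in \<open>auto simp: sums_iff mult_left_le power_le_one\<close>)
      then show ?thesis using \<omega>le1 w by (simp add: sums_iff)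
    qed
    from swap(1)[OF \<omega>0 z(1) w this] \<omega>sm \<omega>le1
    have s: "(\<lambda>n. (\<Sum>j. a j * fps_nth (Abs_fps \<omega> ^ j) n) * z ^ n) sums (\<Sum>j. a j * w ^ j)"
      by (auto intro: summable_sums)
    have d: "(\<lambda>n. (if n = 1 then p else 0) * z ^ n) sums (p * z)"
      using sums_single[of 1 "\<lambda>n. p * z ^ n"] by (simp add: if_distrib[where f="\<lambda>x. x * _"] cong: if_cong)
    have "(\<lambda>n. \<Phi> \<omega> n * z ^ n) sums (q * (\<Sum>j. a j * w ^ j) + p * z)"
      using sums_add[OF sums_mult[OF s, of q] d] by (simp add: \<Phi>_def algebra_simps)
    moreover have "(\<lambda>n. \<Phi> \<omega> n * z ^ n) sums w" using w eq by simp
    ultimately show ?thesis using sums_unique2 by blast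
  qed
  \<comment> \<open>At \<open>z = 1\<close> the mass \<open>s\<close> solves
    \<open>1 - s = q (1 - A(s))\<close>. Bernoulli's inequality gives
    \<open>1 - s ^ j \<le> j (1 - s)\<close>, hence \<open>1 - s \<le> q \<rho> (1 - s)\<close>,
    which excludes \<open>s < 1\<close> in the subcritical case.\<close>
  have "suminf \<omega> = 1"
  proof (rule ccontr)
    assume ne: "suminf \<omega> \<noteq> 1"
    define s where "s = suminf \<omega>"
    have s: "0 \<le> s" "s < 1" using ne \<omega>le1 \<omega>0 \<omega>sm by (auto simp: s_def intro!: suminf_nonneg)
    have "s = q * (\<Sum>j. a j * s ^ j) + p * 1" by (rule fixpt) (use \<omega>sm in \<open>auto simp: s_def intro: summable_sums\<close>)
    then have "1 - s = q * (1 - (\<Sum>j. a j * s ^ j))" using pq by (simp add: algebra_simps)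
    also have "1 - (\<Sum>j. a j * s ^ j) = (\<Sum>j. a j - a j * s ^ j)"
      using suminf_diff[OF as(1), of "\<lambda>j. a j * s ^ j"] A_sums(1)[of s] s as by (simp add: sums_iff)
    also have "\<dots> \<le> (\<Sum>j. (1 - s) * (real j * a j))"
    proof (rule suminf_le)
      fix j
      have "1 + real j * (s - 1) \<le> (1 + (s - 1)) ^ j" by (rule Bernoulli_inequality) (use s in simp)
      then have "1 - s ^ j \<le> (1 - s) * real j" by (simp add: algebra_simps)
      then have "a j * (1 - s ^ j) \<le> a j * ((1 - s) * real j)" using a(1) by (rule mult_left_mono)
      then show "a j - a j * s ^ j \<le> (1 - s) * (real j * a j)" by (simp add: algebra_simps)
    qed (use A_sums(1)[of s] s as mean in \<open>auto simp: sums_iff intro!: summable_diff summable_mult\<close>)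
    also have "\<dots> = (1 - s) * \<rho>" using sums_mult[OF mean, of "1 - s"] by (simp add: sums_iff)
    finally have "1 - s \<le> q * ((1 - s) * \<rho>)" using pq by simp
    also have "\<dots> = (1 - s) * (q * \<rho>)" by simp
    also have "\<dots> < (1 - s) * 1" using s sub by (intro mult_strict_left_mono) auto
    finally show False by simp
  qed
  then have "\<omega> sums 1" using \<omega>sm by (simp add: sums_iff)
  from that[OF \<omega>0 this fixpt] show thesis .
qed

text \<open>The generating functions are compared only on \<open>0 < z < 1\<close>, so the constant
  coefficient is recovered as the limit from the right at 0.\<close>

lemma powser_zero_imp_head_zero:
  fixes d :: "nat \<Rightarrow> real"
  assumes zero: "\<And>z. 0 < z \<Longrightarrow> z < 1 \<Longrightarrow> (\<lambda>n. d n * z ^ n) sums 0"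
  shows "d 0 = 0"
proof -
  have "summable (\<lambda>n. d n * (1/2) ^ n)" using zero[of "1/2"] by (simp add: sums_iff)
  then have "isCont (\<lambda>x. \<Sum>n. d n * x ^ n) 0" by (rule isCont_powser) simp
  then have "((\<lambda>x. \<Sum>n. d n * x ^ n) \<longlongrightarrow> (\<Sum>n. d n * 0 ^ n)) (at_right 0)"
    unfolding isCont_def by (rule tendsto_mono[rotated]) (simp add: at_le)
  then have "((\<lambda>x. \<Sum>n. d n * x ^ n) \<longlongrightarrow> d 0) (at_right 0)" by simp
  moreover have "((\<lambda>x. \<Sum>n. d n * x ^ n) \<longlongrightarrow> 0) (at_right 0)"
  proof (rule Lim_transform_eventually[OF tendsto_const])
    have "\<forall>\<^sub>F x in at_right 0. x \<in> {0<..<1::real}" by (rule eventually_at_right_real) simp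
    then show "\<forall>\<^sub>F x in at_right 0. 0 = (\<Sum>n. d n * x ^ n)"
      by eventually_elim (use zero in \<open>auto simp: sums_iff\<close>)
  qed
  ultimately show ?thesis using tendsto_unique trivial_limit_at_right_real by blast
qed

text \<open>Once the constant coefficient vanishes, the series is divided by \<open>z\<close>, and
  the induction continues with the shifted sequence.\<close>

lemma powser_zero_imp_coeff_zero:
  fixes d :: "nat \<Rightarrow> real"
  assumes zero: "\<And>z. 0 < z \<Longrightarrow> z < 1 \<Longrightarrow> (\<lambda>n. d n * z ^ n) sums 0"
  shows "d n = 0"
  using assms
proof (induction n arbitrary: d)
  case (0 d)
  then show ?case by (rule powser_zero_imp_head_zero)
next
  case (Suc n d)
  have d0: "d 0 = 0" by (rule powser_zero_imp_head_zero[OF Suc.prems])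
  show ?case
  proof (rule Suc.IH)
    fix z :: real assume z: "0 < z" "z < 1"
    have "(\<lambda>n. d (Suc n) * z ^ Suc n) sums 0"
      using Suc.prems[OF z] d0 by (subst sums_Suc_iff) simp
    from sums_divide[OF this, of z] show "(\<lambda>n. d (Suc n) * z ^ n) sums 0" using z by simp
  qed
qed

section \<open>The tail of \<open>\<kappa>\<close>\<close>

lemma prob_nat_sums: "(\<lambda>i. pmf (P :: nat pmf) (i + n)) sums measure_pmf.prob P {n..}"
proof -
  have "(\<lambda>i. measure_pmf.prob P {i + n}) sums measure_pmf.prob P (\<Union>i. {i + n})"
    by (rule measure_pmf.finite_measure_UNION) (auto simp: disjoint_family_on_def)
  moreover have "(\<Union>i. {i + n}) = {n..}" by (auto intro: le_add_diff_inverse2[symmetric])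
  ultimately show ?thesis by (simp add: measure_pmf_single)
qed

lemma pmf_nat_sums: "pmf (P :: nat pmf) sums 1"
  using prob_nat_sums[of P 0] by (simp add: atLeast_0)

text \<open>The one-step recursion of the tails, \<open>t (Suc n) = t n - \<omega> (Suc n)\<close>,
  gives \<open>T * (1 - z) = 1 - w\<close>.\<close>

lemma tail_generating_function:
  fixes \<omega> :: "nat \<Rightarrow> real"
  assumes \<omega>: "\<And>n. \<omega> n \<ge> 0" "\<omega> sums 1" and z: "0 \<le> z" "z < 1" and w: "(\<lambda>n. \<omega> n * z ^ n) sums w"
  shows "(\<lambda>n. tail_sum \<omega> (Suc n) * z ^ n) sums ((1 - w) / (1 - z))"
proof -
  define t where "t n = tail_sum \<omega> (Suc n)" for n
  have sm: "summable \<omega>" "suminf \<omega> = 1" using \<omega> by (auto simp: sums_iff)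
  have t0: "t 0 = 1 - \<omega> 0" unfolding t_def using tail_sum_eq[OF sm(1), of 1] sm(2) by simp
  have tS: "t (Suc n) = t n - \<omega> (Suc n)" for n unfolding t_def using tail_sum_Suc[OF sm(1), of "Suc n"] by simp
  have t_nn: "t n \<ge> 0" for n unfolding t_def by (rule tail_sum_nonneg[OF sm(1) \<omega>(1)])
  have t_le: "t n \<le> 1" for n
    unfolding t_def tail_sum_eq[OF sm(1)] sm(2) using sum_nonneg[of "{..<Suc n}" \<omega>] \<omega>(1) by simp
  have smt: "summable (\<lambda>n. t n * z ^ n)"
    by (rule summable_comparison_test'[where g = "\<lambda>n. z ^ n" and N = 0])
       (use z t_nn t_le in \<open>auto simp: summable_geometric abs_mult mult_right_le_one_le mult_left_le_one_le\<close>)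
  define T where "T = (\<Sum>n. t n * z ^ n)"
  have smw: "summable (\<lambda>n. \<omega> n * z ^ n)" "suminf (\<lambda>n. \<omega> n * z ^ n) = w" using w by (auto simp: sums_iff)
  have "T = t 0 + (\<Sum>n. t (Suc n) * z ^ n) * z" unfolding T_def by (rule powser_split_head(1)[OF smt])
  also have "(\<Sum>n. t (Suc n) * z ^ n) = (\<Sum>n. t n * z ^ n - \<omega> (Suc n) * z ^ n)"
    unfolding tS by (simp add: algebra_simps)
  also have "\<dots> = T - (\<Sum>n. \<omega> (Suc n) * z ^ n)" unfolding T_def
    by (rule suminf_diff[symmetric]) (use smt powser_split_head(3)[OF smw(1)] in auto)
  finally have "T = t 0 + (T * z - (\<Sum>n. \<omega> (Suc n) * z ^ n) * z)" by (simp add: algebra_simps)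
  also have "(\<Sum>n. \<omega> (Suc n) * z ^ n) * z = w - \<omega> 0" using powser_split_head(2)[OF smw(1)] smw(2) by simp
  finally have "T * (1 - z) = 1 - w" unfolding t0 by (simp add: algebra_simps)
  then have "T = (1 - w) / (1 - z)" using z by (simp add: eq_divide_eq)
  moreover have "(\<lambda>n. t n * z ^ n) sums T" unfolding T_def by (rule summable_sums[OF smt])
  ultimately show ?thesis by (simp add: t_def)
qed

lemma tail_sums_mean:
  fixes \<omega> :: "nat \<Rightarrow> real"
  assumes \<omega>: "\<And>n. \<omega> n \<ge> 0" "summable \<omega>" and t: "(\<lambda>n. tail_sum \<omega> (Suc n)) sums m"
  shows "(\<lambda>n. real n * \<omega> n) sums m"
proof -
  define f where "f n i = (if n < i then \<omega> i else 0)" for n i :: nat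
  have row: "f n sums tail_sum \<omega> (Suc n)" for n
  proof -
    have "(\<lambda>i. f n (i + Suc n)) sums tail_sum \<omega> (Suc n)"
      unfolding tail_sum_def f_def using summable_sums[OF summable_ignore_initial_segment[OF \<omega>(2), of "Suc n"]] by simp
    then show ?thesis by (subst (asm) sums_zero_iff_shift) (auto simp: f_def)
  qed
  have "(\<lambda>i. \<Sum>n. f n i) sums m"
    by (rule sums_swap_nonneg(1)[OF _ row t]) (use \<omega> in \<open>auto simp: f_def\<close>)
  moreover have "(\<Sum>n. f n i) = real i * \<omega> i" for i
    unfolding f_def by (subst suminf_If_lessThan) simp
  ultimately show ?thesis by simp
qed

lemma pmf_nat_mean:
  assumes "(\<lambda>n. real n * pmf P n) sums m"
  shows "integrable (measure_pmf P) real" "m = (\<integral>k. real k \<partial>measure_pmf P)"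
proof -
  have m0: "m \<ge> 0" using assms by (auto simp: sums_iff intro!: suminf_nonneg)
  have "(\<integral>\<^sup>+k. ennreal (real k) \<partial>measure_pmf P) = (\<integral>\<^sup>+k. ennreal (pmf P k) * ennreal (real k) \<partial>count_space UNIV)"
    by (rule nn_integral_measure_pmf)
  also have "\<dots> = (\<Sum>k. ennreal (real k * pmf P k))"
    by (subst nn_integral_count_space_nat) (simp add: ennreal_mult'[symmetric] mult.commute)
  also have "\<dots> = ennreal m" using assms by (intro suminf_ennreal_eq) auto
  finally have nn: "(\<integral>\<^sup>+k. ennreal (real k) \<partial>measure_pmf P) = ennreal m" .
  then show int: "integrable (measure_pmf P) real"
    by (intro integrableI_nn_integral_finite[of _ _ m]) (use m0 in auto)
  show "m = (\<integral>k. real k \<partial>measure_pmf P)"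
    using nn m0 by (subst integral_eq_nn_integral) auto
qed

lemma suminf_If_greater:
  fixes e :: "nat \<Rightarrow> real"
  assumes "summable e"
  shows "(\<lambda>j. if D < j then e j else 0) sums tail_sum e (Suc D)"
proof -
  have "(\<lambda>j. if D < j + Suc D then e (j + Suc D) else 0) sums tail_sum e (Suc D)"
    unfolding tail_sum_def using summable_sums[OF summable_ignore_initial_segment[OF assms, of "Suc D"]] by simp
  then show ?thesis by (subst (asm) sums_zero_iff_shift[where f = "\<lambda>j. if D < j then e j else 0"]) auto
qed

text \<open>\<open>fixpt\<close> is the equation \<open>w = q A(w) + p z\<close> after
  \<open>1 - A(w) = (1 - w) B(w)\<close> has been inserted: the factor \<open>1 - w\<close> can be
  split off and only \<open>b\<close> remains. Differentiation at \<open>z = 1\<close> suggests that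
  \<open>m\<close> is the mean of \<xi>; this is proved below from the tail sums.\<close>

locale progeny =
  fixes b :: "nat \<Rightarrow> real" and \<alpha> \<rho> p q m :: real and \<xi> :: "nat pmf"
  assumes b: "reg_var \<alpha> b" "b sums \<rho>" and \<alpha>: "\<alpha> > 1" and \<rho>: "\<rho> < 1"
    and pq: "0 < p" "0 < q" "p + q = 1"
    and fixpt: "\<And>z w. 0 \<le> z \<Longrightarrow> z < 1 \<Longrightarrow> (\<lambda>n. pmf \<xi> n * z ^ n) sums w \<Longrightarrow> (1 - w) * (1 - q * (\<Sum>n. b n * w ^ n)) = p * (1 - z)"
    and m_def: "m = p / (1 - q * \<rho>)"
begin

lemma b_pos: "b n > 0" using b by (simp add: reg_var_pos)
lemma b_nonneg: "b n \<ge> 0" using b_pos[of n] by simp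

lemma \<rho>_pos: "\<rho> > 0"
  using b(2) b_pos by (auto simp: sums_iff intro!: suminf_pos)

lemma q\<rho>: "q * \<rho> < \<rho>" "q * \<rho> < 1"
proof -
  show "q * \<rho> < \<rho>" using pq \<rho>_pos by simp
  then show "q * \<rho> < 1" using \<rho> by linarith
qed

lemma m_pos: "m > 0" using pq q\<rho> by (simp add: m_def)

text \<open>Ensures \<open>j * m \<le> n\<close> for every \<open>j \<le> n\<close>, as the big jump
  bound demands.\<close>

lemma m_le_1: "m \<le> 1"
proof -
  have "q * \<rho> \<le> q" using pq \<rho> by simp
  then have "p \<le> 1 - q * \<rho>" using pq by linarith
  then show ?thesis using q\<rho> by (simp add: m_def)
qed

lemma w_exists:
  assumes "0 \<le> z" "z \<le> 1"
  obtains w where "(\<lambda>n. pmf \<xi> n * z ^ n) sums w" "0 \<le> w" "w \<le> 1"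
proof -
  have sp: "summable (pmf \<xi>)" "suminf (pmf \<xi>) = 1" using pmf_nat_sums[of \<xi>] by (auto simp: sums_iff)
  have le: "pmf \<xi> n * z ^ n \<le> pmf \<xi> n" for n using assms by (simp add: mult_left_le power_le_one)
  have sm: "summable (\<lambda>n. pmf \<xi> n * z ^ n)"
    by (rule summable_comparison_test'[OF sp(1), where N = 0]) (use le assms in auto)
  show thesis
  proof
    show "(\<lambda>n. pmf \<xi> n * z ^ n) sums (\<Sum>n. pmf \<xi> n * z ^ n)" by (rule summable_sums[OF sm])
    show "(\<Sum>n. pmf \<xi> n * z ^ n) \<ge> 0" using sm assms by (intro suminf_nonneg) auto
    show "(\<Sum>n. pmf \<xi> n * z ^ n) \<le> 1" unfolding sp(2)[symmetric] by (rule suminf_le[OF le sm sp(1)])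
  qed
qed

lemma B_sums:
  assumes "0 \<le> w" "w \<le> 1"
  shows "(\<lambda>n. b n * w ^ n) sums (\<Sum>n. b n * w ^ n)" "0 \<le> (\<Sum>n. b n * w ^ n)" "(\<Sum>n. b n * w ^ n) \<le> \<rho>"
proof -
  have sp: "summable b" "suminf b = \<rho>" using b by (auto simp: sums_iff)
  have le: "b n * w ^ n \<le> b n" for n using assms b_nonneg by (simp add: mult_left_le power_le_one)
  have sm: "summable (\<lambda>n. b n * w ^ n)"
    by (rule summable_comparison_test'[OF sp(1), where N = 0]) (use le assms b_nonneg in auto)
  show "(\<lambda>n. b n * w ^ n) sums (\<Sum>n. b n * w ^ n)" by (rule summable_sums[OF sm])
  show "(\<Sum>n. b n * w ^ n) \<ge> 0" using sm assms b_nonneg by (intro suminf_nonneg) auto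
  show "(\<Sum>n. b n * w ^ n) \<le> \<rho>" unfolding sp(2)[symmetric] by (rule suminf_le[OF le sm sp(1)])
qed

text \<open>Weights of a random sum of copies of \<xi> whose number of terms has weights
  \<open>u\<close>; on generating functions this is the composition \<open>U(w(z))\<close>.\<close>

definition compound :: "(nat \<Rightarrow> real) \<Rightarrow> nat \<Rightarrow> real" where
  "compound u n = (\<Sum>j. u j * pmf (iid_sum \<xi> j) n)"

lemma iid_sum_generating_function:
  assumes "0 \<le> z" "(\<lambda>n. pmf \<xi> n * z ^ n) sums w"
  shows "(\<lambda>n. pmf (iid_sum \<xi> j) n * z ^ n) sums w ^ j"
  unfolding pmf_iid_sum by (rule fps_power_sums) (use assms in auto)

lemma compound_sums:
  assumes u: "\<And>j. u j \<ge> 0" and z: "0 \<le> z" "z \<le> 1" and w: "(\<lambda>n. pmf \<xi> n * z ^ n) sums w"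
    and U: "(\<lambda>j. u j * w ^ j) sums U" and su: "summable u"
  shows "(\<lambda>n. compound u n * z ^ n) sums U" "summable (\<lambda>j. u j * pmf (iid_sum \<xi> j) n)"
proof -
  have row: "(\<lambda>n. u j * (pmf (iid_sum \<xi> j) n * z ^ n)) sums (u j * w ^ j)" for j
    by (rule sums_mult[OF iid_sum_generating_function[OF z(1) w]])
  have "(\<lambda>n. \<Sum>j. u j * (pmf (iid_sum \<xi> j) n * z ^ n)) sums U"
    by (rule sums_swap_nonneg(1)[OF _ row U]) (use u z in auto)
  moreover have sm: "summable (\<lambda>j. u j * pmf (iid_sum \<xi> j) n)" for n
    by (rule summable_comparison_test'[OF su, where N = 0]) (use u in \<open>auto simp: mult_left_le pmf_le_1\<close>)
  moreover have "(\<Sum>j. u j * (pmf (iid_sum \<xi> j) n * z ^ n)) = compound u n * z ^ n" for n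
    unfolding compound_def suminf_mult2[OF sm] by (simp add: mult.assoc)
  ultimately show "(\<lambda>n. compound u n * z ^ n) sums U" by simp
  show "summable (\<lambda>j. u j * pmf (iid_sum \<xi> j) n)" by (rule sm)
qed

lemma compound_nonneg: "(\<And>j. u j \<ge> 0) \<Longrightarrow> summable u \<Longrightarrow> compound u n \<ge> 0"
  unfolding compound_def
  by (rule suminf_nonneg, rule summable_comparison_test'[where g = u and N = 0]) (auto simp: mult_left_le pmf_le_1)

text \<open>The coefficients of \<open>1 / (1 - q B)\<close>.\<close>

definition g :: "nat \<Rightarrow> real" where "g j = (\<Sum>k. q ^ k * fps_nth (Abs_fps b ^ k) j)"

definition e :: "nat \<Rightarrow> real" where "e = renewal b"

lemma bpow_nonneg: "fps_nth (Abs_fps b ^ k) j \<ge> 0" by (rule fps_power_nonneg[OF b_nonneg])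

text \<open>Used with \<open>c = q\<close> for \<open>g\<close> and with \<open>c = 1\<close> for
  \<open>e\<close>. The geometric series converge because \<open>B(w) \<le> \<rho> < 1\<close>, and
  nonnegativity allows the double series to be rearranged.\<close>

lemma geometric_compound:
  assumes c: "0 \<le> c" "c \<le> 1" and w: "0 \<le> w" "w \<le> 1"
  defines "B \<equiv> \<Sum>n. b n * w ^ n"
  shows "(\<lambda>j. (\<Sum>k. c ^ k * fps_nth (Abs_fps b ^ k) j) * w ^ j) sums (1 / (1 - c * B))"
    "(\<lambda>j. (\<Sum>k. c ^ k * fps_nth (Abs_fps b ^ Suc k) j) * w ^ j) sums (B / (1 - c * B))"
    "summable (\<lambda>k. c ^ k * fps_nth (Abs_fps b ^ k) j)"
    "summable (\<lambda>k. c ^ k * fps_nth (Abs_fps b ^ Suc k) j)"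
proof -
  have geo: "(\<lambda>k. c ^ k * B' ^ k) sums (1 / (1 - c * B'))" if "0 \<le> B'" "B' \<le> \<rho>" for B'
  proof -
    have "c * B' \<le> 1 * \<rho>" using c that by (intro mult_mono) auto
    then have "\<bar>c * B'\<bar> < 1" using \<rho> c that by simp
    from geometric_sums[of "c * B'"] this show ?thesis by (simp add: power_mult_distrib)
  qed
  have row: "(\<lambda>j. c ^ k * (fps_nth (Abs_fps b ^ i) j * w ^ j)) sums (c ^ k * B ^ i)" for k i
    unfolding B_def by (intro sums_mult fps_power_sums b_nonneg w B_sums)
  have row1: "(\<lambda>j. c ^ k * fps_nth (Abs_fps b ^ i) j) sums (c ^ k * \<rho> ^ i)" for k i
    using fps_power_sums[of b 1 \<rho> i] b b_nonneg by (intro sums_mult) auto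
  have B: "0 \<le> B" "B \<le> \<rho>" unfolding B_def by (rule B_sums[OF w])+
  have g1: "(\<lambda>k. c ^ k * B' ^ Suc k) sums (B' / (1 - c * B'))" if "0 \<le> B'" "B' \<le> \<rho>" for B'
    using sums_mult[OF geo[OF that], of B'] by (simp add: mult_ac)
  show sm: "summable (\<lambda>k. c ^ k * fps_nth (Abs_fps b ^ k) j)" for j
    by (rule sums_swap_nonneg(2)[OF _ row1 geo[of \<rho>]]) (use c bpow_nonneg \<rho>_pos in auto)
  show sm1: "summable (\<lambda>k. c ^ k * fps_nth (Abs_fps b ^ Suc k) j)" for j
    by (rule sums_swap_nonneg(2)[OF _ row1 g1[of \<rho>]]) (use c bpow_nonneg \<rho>_pos in \<open>auto simp del: power_Suc\<close>)
  have "(\<lambda>j. \<Sum>k. c ^ k * (fps_nth (Abs_fps b ^ k) j * w ^ j)) sums (1 / (1 - c * B))"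
    by (rule sums_swap_nonneg(1)[OF _ row geo[OF B]]) (use c bpow_nonneg w in auto)
  then show "(\<lambda>j. (\<Sum>k. c ^ k * fps_nth (Abs_fps b ^ k) j) * w ^ j) sums (1 / (1 - c * B))"
    by (simp add: suminf_mult2[OF sm] mult.assoc)
  have "(\<lambda>j. \<Sum>k. c ^ k * (fps_nth (Abs_fps b ^ Suc k) j * w ^ j)) sums (B / (1 - c * B))"
    by (rule sums_swap_nonneg(1)[OF _ row g1[OF B]]) (use c bpow_nonneg w in \<open>auto simp del: power_Suc\<close>)
  then show "(\<lambda>j. (\<Sum>k. c ^ k * fps_nth (Abs_fps b ^ Suc k) j) * w ^ j) sums (B / (1 - c * B))"
    by (simp add: suminf_mult2[OF sm1] mult.assoc del: power_Suc)
qed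

lemma g_nonneg: "g j \<ge> 0" unfolding g_def
  by (intro suminf_nonneg geometric_compound(3)[of q 1]) (use pq bpow_nonneg in auto)

lemma e_nonneg: "e j \<ge> 0" unfolding e_def renewal_def
  using geometric_compound(4)[of 1 1 j] bpow_nonneg by (intro suminf_nonneg) (auto simp del: power_Suc)

lemma g_sums: "0 \<le> w \<Longrightarrow> w \<le> 1 \<Longrightarrow> (\<lambda>j. g j * w ^ j) sums (1 / (1 - q * (\<Sum>n. b n * w ^ n)))"
  unfolding g_def using geometric_compound(1)[of q w] pq by simp

lemma e_sums: "0 \<le> w \<Longrightarrow> w \<le> 1 \<Longrightarrow> (\<lambda>j. e j * w ^ j) sums ((\<Sum>n. b n * w ^ n) / (1 - (\<Sum>n. b n * w ^ n)))"
  unfolding e_def renewal_def using geometric_compound(2)[of 1 w] by (simp del: power_Suc)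

lemma summable_g: "summable g" using g_sums[of 1] by (simp add: sums_iff)
lemma summable_e: "summable e" using e_sums[of 1] by (simp add: sums_iff)

text \<open>In \<open>1 / (1 - q B)\<close> the power 0 contributes to the coefficient of index 0
  only; every other power of \<open>B\<close> has coefficient at most 1, which is its coefficient in
  \<open>B / (1 - B)\<close>.\<close>

lemma g_le_e: "j \<ge> 1 \<Longrightarrow> g j \<le> e j"
proof -
  assume j: "j \<ge> 1"
  have sm: "summable (\<lambda>k. q ^ k * fps_nth (Abs_fps b ^ k) j)" using geometric_compound(3)[of q 1] pq by simp
  have "g j = fps_nth (Abs_fps b ^ 0) j + (\<Sum>k. q ^ Suc k * fps_nth (Abs_fps b ^ Suc k) j)"
    unfolding g_def using suminf_split_head[OF sm] by simp
  also have "fps_nth (Abs_fps b ^ 0) j = 0" using j by (simp add: fps_one_nth)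
  also have "(\<Sum>k. q ^ Suc k * fps_nth (Abs_fps b ^ Suc k) j) \<le> (\<Sum>k. 1 ^ k * fps_nth (Abs_fps b ^ Suc k) j)"
  proof (rule suminf_le)
    show "q ^ Suc k * fps_nth (Abs_fps b ^ Suc k) j \<le> 1 ^ k * fps_nth (Abs_fps b ^ Suc k) j" for k
      using pq by (intro mult_right_mono bpow_nonneg) (simp add: power_le_one del: power_Suc)
    show "summable (\<lambda>k. q ^ Suc k * fps_nth (Abs_fps b ^ Suc k) j)" using sm by (subst summable_Suc_iff)
    show "summable (\<lambda>k. 1 ^ k * fps_nth (Abs_fps b ^ Suc k) j)" by (rule geometric_compound(4)[of 1 1]) auto
  qed
  finally show ?thesis by (simp add: e_def renewal_def del: power_Suc)
qed

definition \<kappa> :: "nat \<Rightarrow> real" where "\<kappa> n = p * compound e n"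

lemma \<kappa>_nonneg: "\<kappa> n \<ge> 0" unfolding \<kappa>_def using pq compound_nonneg[of e n, OF e_nonneg summable_e] by simp

lemma \<kappa>_sums:
  assumes z: "0 \<le> z" "z \<le> 1" and w: "(\<lambda>n. pmf \<xi> n * z ^ n) sums w"
  shows "(\<lambda>n. \<kappa> n * z ^ n) sums (p * (\<Sum>n. b n * w ^ n) / (1 - (\<Sum>n. b n * w ^ n)))"
proof -
  obtain w' where w': "(\<lambda>n. pmf \<xi> n * z ^ n) sums w'" "0 \<le> w'" "w' \<le> 1" using w_exists[OF z] .
  then have [simp]: "w' = w" using w sums_unique2 by blast
  show ?thesis unfolding \<kappa>_def
    using sums_mult[OF compound_sums(1)[OF e_nonneg z w e_sums summable_e], of p] w' by (simp add: mult.assoc)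
qed

lemma summable_\<kappa>: "summable \<kappa>" using \<kappa>_sums[of 1 1] pmf_nat_sums[of \<xi>] by (simp add: sums_iff)

definition t :: "nat \<Rightarrow> real" where "t n = tail_sum (pmf \<xi>) (Suc n)"

lemma t_eq_prob: "t n = measure_pmf.prob \<xi> {n<..}"
proof -
  have "{n<..} = {Suc n..}" by auto
  then show ?thesis using prob_nat_sums[of \<xi> "Suc n"] by (simp add: t_def tail_sum_def sums_iff)
qed

text \<open>The tails of \<xi> have generating function \<open>(1 - w) / (1 - z)\<close>, which
  \<open>fixpt\<close> turns into \<open>p / (1 - q B(w))\<close>, a composition of the same type as
  \<kappa>.\<close>

lemma t_eq: "t n = p * compound g n"
proof -
  have "t n - p * compound g n = 0"
  proof (rule powser_zero_imp_coeff_zero[of "\<lambda>n. t n - p * compound g n"])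
    fix z :: real assume z: "0 < z" "z < 1"
    obtain w where w: "(\<lambda>n. pmf \<xi> n * z ^ n) sums w" "0 \<le> w" "w \<le> 1"
      using w_exists[OF less_imp_le[OF z(1)] less_imp_le[OF z(2)]] .
    define B where "B = (\<Sum>n. b n * w ^ n)"
    have "q * B \<le> q * \<rho>" unfolding B_def by (rule mult_left_mono[OF B_sums(3)[OF w(2,3)] less_imp_le[OF pq(2)]])
    then have qB: "1 - q * B > 0" using q\<rho>(2) by linarith
    have "(\<lambda>n. t n * z ^ n) sums ((1 - w) / (1 - z))" unfolding t_def
      by (rule tail_generating_function) (use z w pmf_nat_sums in auto)
    moreover have "(1 - w) / (1 - z) = p * (1 / (1 - q * B))"
    proof -
      have "(1 - w) * (1 - q * B) = p * (1 - z)" unfolding B_def by (rule fixpt) (use z w in auto)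
      then have "1 - w = p * (1 - z) / (1 - q * B)" using qB by (simp add: eq_divide_eq)
      then show ?thesis using z by simp
    qed
    moreover have "(\<lambda>n. p * (compound g n * z ^ n)) sums (p * (1 / (1 - q * B)))"
      unfolding B_def by (rule sums_mult, rule compound_sums(1)[OF g_nonneg _ _ w(1) g_sums summable_g]) (use z w in auto)
    ultimately have "(\<lambda>n. t n * z ^ n - p * (compound g n * z ^ n)) sums (p * (1 / (1 - q * B)) - p * (1 / (1 - q * B)))"
      by (intro sums_diff) (simp_all only:)
    moreover have "t n * z ^ n - p * (compound g n * z ^ n) = (t n - p * compound g n) * z ^ n" for n
      by (simp only: left_diff_distrib mult.assoc)
    ultimately show "(\<lambda>n. (t n - p * compound g n) * z ^ n) sums 0" by (simp only: diff_self)
  qed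
  then show ?thesis by simp
qed

lemma t_sums: "t sums m"
proof -
  have "(\<lambda>n. compound g n * 1 ^ n) sums (1 / (1 - q * \<rho>))"
  proof (rule compound_sums(1)[OF g_nonneg _ _ _ _ summable_g])
    show "(\<lambda>n. pmf \<xi> n * 1 ^ n) sums 1" using pmf_nat_sums by simp
    show "(\<lambda>j. g j * 1 ^ j) sums (1 / (1 - q * \<rho>))" using g_sums[of 1] b by (simp add: sums_iff)
  qed auto
  from sums_mult[OF this, of p] have "(\<lambda>n. p * compound g n) sums m" by (simp add: m_def)
  then show ?thesis by (simp only: t_eq[symmetric])
qed

lemma mean: "integrable (measure_pmf \<xi>) real" "m = (\<integral>k. real k \<partial>measure_pmf \<xi>)"
proof -
  have "(\<lambda>n. real n * pmf \<xi> n) sums m"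
  proof (rule tail_sums_mean)
    show "(\<lambda>n. tail_sum (pmf \<xi>) (Suc n)) sums m" using t_sums unfolding t_def[abs_def] .
    show "summable (pmf \<xi>)" using pmf_nat_sums[of \<xi>] by (simp add: sums_iff)
  qed simp
  from pmf_nat_mean[OF this] show "integrable (measure_pmf \<xi>) real" "m = (\<integral>k. real k \<partial>measure_pmf \<xi>)" by auto
qed

text \<open>The comparison that breaks the circle. The index \<open>j = 0\<close>, where the weights
  \<open>g\<close> and \<open>e\<close> are not compared, drops out because the empty sum is 0 and
  \<open>n \<ge> 1\<close>.\<close>

lemma t_le_\<kappa>: "n \<ge> 1 \<Longrightarrow> t n \<le> \<kappa> n"
proof -
  assume n: "n \<ge> 1"
  have sm: "summable (\<lambda>j. u j * pmf (iid_sum \<xi> j) n)" if "\<And>j. u j \<ge> 0" "summable u" for u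
    by (rule summable_comparison_test'[OF that(2), where N = 0]) (use that in \<open>auto simp: mult_left_le pmf_le_1\<close>)
  have "compound g n \<le> compound e n"
    unfolding compound_def
  proof (rule suminf_le)
    fix j
    show "g j * pmf (iid_sum \<xi> j) n \<le> e j * pmf (iid_sum \<xi> j) n"
    proof (cases j)
      case 0
      then show ?thesis using n by (simp add: pmf_return)
    next
      case (Suc i)
      then show ?thesis using g_le_e[of j] by (intro mult_right_mono) auto
    qed
  qed (use sm g_nonneg e_nonneg summable_g summable_e in auto)
  then show ?thesis unfolding t_eq \<kappa>_def using pq by simp
qed

lemma t_decseq: "decseq t"
  unfolding t_eq_prob by (rule decseq_SucI) (auto intro!: measure_pmf.finite_measure_mono)

definition K :: "nat \<Rightarrow> real" where "K = tail_sum \<kappa>"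

definition Q :: "nat \<Rightarrow> nat \<Rightarrow> real" where "Q j n = measure_pmf.prob (iid_sum \<xi> j) {n..}"

lemma Q_bounds: "0 \<le> Q j n" "Q j n \<le> 1" by (auto simp: Q_def)

lemma Q_mono: "i \<le> j \<Longrightarrow> Q i n \<le> Q j n" unfolding Q_def by (rule prob_iid_sum_mono)

lemma summable_eQ: "summable (\<lambda>j. e j * Q j n)"
  by (rule summable_comparison_test'[OF summable_e, where N = 0]) (use e_nonneg Q_bounds in \<open>auto simp: mult_left_le\<close>)

lemma K_eq: "K n = p * (\<Sum>j. e j * Q j n)"
proof -
  have row: "(\<lambda>i. e j * pmf (iid_sum \<xi> j) (i + n)) sums (e j * Q j n)" for j
    unfolding Q_def by (rule sums_mult[OF prob_nat_sums])
  have "(\<lambda>i. \<Sum>j. e j * pmf (iid_sum \<xi> j) (i + n)) sums (\<Sum>j. e j * Q j n)"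
    by (rule sums_swap_nonneg(1)[OF _ row summable_sums[OF summable_eQ]]) (use e_nonneg in auto)
  from sums_mult[OF this, of p] show ?thesis
    unfolding K_def tail_sum_def \<kappa>_def compound_def by (simp add: sums_iff)
qed

lemma K_nonneg: "K n \<ge> 0" unfolding K_def by (rule tail_sum_nonneg[OF summable_\<kappa> \<kappa>_nonneg])

text \<open>\<open>t k\<close> is at most the average of \<open>t\<close> over
  \<open>{k div 2..k}\<close>, and there \<open>t \<le> \<kappa>\<close>; this gains a factor of
  order \<open>1 / k\<close>. For \<open>k \<ge> 2\<close> the range avoids index 0.\<close>

lemma t_le_K:
  assumes k: "k \<ge> 2"
  shows "t k \<le> 2 / real k * K (k div 2)"
proof -
  have "real k / 2 * t k \<le> real (card {k div 2..k}) * t k"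
    by (intro mult_right_mono) (auto simp: t_eq_prob)
  also have "\<dots> \<le> (\<Sum>i\<in>{k div 2..k}. t i)"
    using sum_bounded_below[of "{k div 2..k}" "t k" t] t_decseq by (simp add: decseqD)
  also have "\<dots> \<le> (\<Sum>i\<in>{k div 2..k}. \<kappa> i)" by (rule sum_mono) (use t_le_\<kappa> k in auto)
  also have "\<dots> = (\<Sum>i\<in>{..k - k div 2}. \<kappa> (i + k div 2))"
    by (rule sum.reindex_bij_witness[of _ "\<lambda>i. i + k div 2" "\<lambda>i. i - k div 2"]) auto
  also have "\<dots> \<le> K (k div 2)" unfolding K_def tail_sum_def
    by (rule sum_le_suminf) (use \<kappa>_nonneg summable_\<kappa> in \<open>auto intro: summable_ignore_initial_segment\<close>)
  finally show ?thesis using k by (simp add: field_simps)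
qed

end

lemma powr_one_over:
  fixes x s :: real
  assumes "x > 0"
  shows "(1 / x) powr s = x powr -s"
proof -
  have "1 / x = x powr -1" using assms by (simp add: powr_minus_divide)
  then have "(1 / x) powr s = x powr (-1 * s)" by (simp only: powr_powr)
  then show ?thesis by simp
qed

section \<open>Asymptotics of the tail sum of \<kappa>\<close>

context progeny
begin

definition X :: "nat \<Rightarrow> real" where "X = tail_sum b"

lemma X: "reg_var (\<alpha> - 1) X" unfolding X_def by (rule reg_var_tail_sum[OF b(1) \<alpha>])

lemma X_pos: "X n > 0" using X by (rule reg_var_pos)

lemma summable_b: "summable b" using b(2) by (simp add: sums_iff)

lemma e_limit: "(\<lambda>n. e n / b n) \<longlonglongrightarrow> 1 / (1 - \<rho>)\<^sup>2"
  unfolding e_def by (rule renewal_limit[OF b]) (use \<alpha> \<rho> in auto)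

lemma E_limit: "(\<lambda>n. tail_sum e n / X n) \<longlonglongrightarrow> 1 / (1 - \<rho>)\<^sup>2"
  unfolding X_def by (rule tail_sum_equiv(2)[OF summable_b b_pos e_limit])

lemma E_antimono: "i \<le> j \<Longrightarrow> tail_sum e j \<le> tail_sum e i"
  using tail_sum_antimono[OF summable_e e_nonneg] by (simp add: decseqD)

lemma E_nonneg: "tail_sum e n \<ge> 0" by (rule tail_sum_nonneg[OF summable_e e_nonneg])

text \<open>The exponent in the big jump bound. It exceeds the Potter exponent
  \<open>\<alpha> + 1\<close> by 2, so the products in \<open>small_jumps_bound\<close> are at most
  \<open>(j / n)^2\<close> up to constants.\<close>

definition r :: real where "r = \<alpha> + 3"

lemma r_pos: "r > 0" using \<alpha> by (simp add: r_def)

definition small_jumps :: "nat \<Rightarrow> nat \<Rightarrow> real" where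
  "small_jumps D n = (\<Sum>j\<le>D. e j * (exp 1 * m * real j / real n) powr r)"

definition first_moment :: "nat \<Rightarrow> real" where
  "first_moment n = (\<Sum>j\<le>n. real j * e j)"

text \<open>Up to \<open>D\<close> use the big jump bound, from \<open>D\<close> to \<open>H\<close> monotonicity of \<open>Q\<close>, beyond \<open>H\<close> only \<open>Q \<le> 1\<close>.\<close>

lemma K_split:
  assumes n: "n > 0" and D: "D \<le> n"
  shows "K n \<le> p * (t (nat \<lfloor>real n / r\<rfloor>) * first_moment n + small_jumps D n + Q H n * tail_sum e D + tail_sum e H)"
proof -
  define \<tau> where "\<tau> = t (nat \<lfloor>real n / r\<rfloor>)"
  have \<tau>: "\<tau> = measure_pmf.prob \<xi> {k. real n / r < real k}"
  proof -
    have "real n / r \<ge> 0" using r_pos by simp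
    then have "{nat \<lfloor>real n / r\<rfloor><..} = {k. real n / r < real k}" by (auto simp: nat_less_iff floor_less_iff)
    then show ?thesis by (simp add: \<tau>_def t_eq_prob)
  qed
  have \<tau>0: "\<tau> \<ge> 0" by (simp add: \<tau>)
  define f1 where "f1 j = (if j \<le> D then e j * (real j * \<tau> + (exp 1 * m * real j / real n) powr r) else 0)" for j
  define f2 where "f2 j = Q H n * (if D < j then e j else 0)" for j
  define f3 where "f3 j = (if H < j then e j else 0)" for j
  have s1: "f1 sums (\<Sum>j\<le>D. e j * (real j * \<tau> + (exp 1 * m * real j / real n) powr r))"
    using sums_If_finite_set[of "{..D}" "\<lambda>j. e j * (real j * \<tau> + (exp 1 * m * real j / real n) powr r)"]
    by (simp add: f1_def[abs_def])
  have s2: "f2 sums (Q H n * tail_sum e (Suc D))" unfolding f2_def by (intro sums_mult suminf_If_greater summable_e)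
  have s3: "f3 sums tail_sum e (Suc H)" unfolding f3_def by (intro suminf_If_greater summable_e)
  have "(\<Sum>j. e j * Q j n) \<le> (\<Sum>j\<le>D. e j * (real j * \<tau> + (exp 1 * m * real j / real n) powr r)) +
      Q H n * tail_sum e (Suc D) + tail_sum e (Suc H)"
  proof (rule sums_le[OF _ summable_sums[OF summable_eQ] sums_add[OF sums_add[OF s1 s2] s3]])
    fix j
    have pos: "f1 j \<ge> 0" "f2 j \<ge> 0" "f3 j \<ge> 0" using e_nonneg \<tau>0 Q_bounds by (auto simp: f1_def f2_def f3_def)
    consider "j \<le> D" | "D < j" "j \<le> H" | "H < j" by linarith
    then show "e j * Q j n \<le> f1 j + f2 j + f3 j"
    proof cases
      case 1
      have "real j * m \<le> real j * 1" using m_le_1 by (intro mult_left_mono) auto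
      then have "real j * m \<le> real n" using 1 D by linarith
      from iid_sum_big_jump_bound[OF mean m_pos r_pos n this]
      have "Q j n \<le> real j * \<tau> + (exp 1 * m * real j / real n) powr r" by (simp add: Q_def \<tau>)
      then have "e j * Q j n \<le> f1 j" using 1 e_nonneg by (simp add: f1_def mult_left_mono)
      then show ?thesis using pos by linarith
    next
      case 2
      have "e j * Q j n \<le> f2 j" using 2 mult_left_mono[OF Q_mono[OF 2(2)] e_nonneg] by (simp add: f2_def mult.commute)
      then show ?thesis using pos by linarith
    next
      case 3
      have "e j * Q j n \<le> f3 j" using 3 e_nonneg Q_bounds by (simp add: f3_def mult_left_le)
      then show ?thesis using pos by linarith
    qed
  qed
  also have "(\<Sum>j\<le>D. e j * (real j * \<tau> + (exp 1 * m * real j / real n) powr r)) = \<tau> * (\<Sum>j\<le>D. real j * e j) + small_jumps D n"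
    by (simp add: small_jumps_def sum.distrib sum_distrib_left algebra_simps)
  also have "(\<Sum>j\<le>D. real j * e j) \<le> first_moment n" unfolding first_moment_def
    by (rule sum_mono2) (use D e_nonneg in auto)
  also have "tail_sum e (Suc D) \<le> tail_sum e D" by (rule E_antimono) simp
  also have "tail_sum e (Suc H) \<le> tail_sum e H" by (rule E_antimono) simp
  finally have "(\<Sum>j. e j * Q j n) \<le> \<tau> * first_moment n + small_jumps D n + Q H n * tail_sum e D + tail_sum e H"
    using \<tau>0 Q_bounds by (simp add: mult_left_mono)
  then show ?thesis unfolding K_eq \<tau>_def[symmetric] using pq by simp
qed

text \<open>Summability of \<open>e\<close> is enough, by Tannery with the bound
  \<open>j * e j / n \<le> e j\<close> for \<open>j \<le> n\<close>; for small \<alpha> the full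
  first moment of \<open>e\<close> can be infinite.\<close>

lemma first_moment_limit: "(\<lambda>n. first_moment n / real n) \<longlonglongrightarrow> 0"
proof -
  define f where "f j n = (if j \<le> n then real j * e j / real n else 0)" for j n
  have "(\<lambda>n. \<Sum>j. f j n) \<longlonglongrightarrow> (\<Sum>j::nat. 0)"
  proof (rule tannery_seq(1)[OF _ _ summable_e, where ?n0.0 = 1])
    fix j
    have "(\<lambda>n. real j * e j * (1 / real n)) \<longlonglongrightarrow> real j * e j * 0" by (intro tendsto_intros lim_1_over_n)
    then have "(\<lambda>n. real j * e j * (1 / real n)) \<longlonglongrightarrow> 0" by simp
    moreover have "\<forall>\<^sub>F n in sequentially. real j * e j * (1 / real n) = f j n"
      using eventually_ge_at_top[of j] by eventually_elim (simp add: f_def)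
    ultimately show "(\<lambda>n. f j n) \<longlonglongrightarrow> 0" by (rule Lim_transform_eventually)
    fix n :: nat assume n: "n \<ge> 1"
    show "\<bar>f j n\<bar> \<le> e j"
    proof (cases "j \<le> n")
      case True
      have "real j * e j \<le> real n * e j" using True e_nonneg by (intro mult_right_mono) auto
      then show ?thesis using True n e_nonneg[of j] by (simp add: f_def pos_divide_le_eq mult.commute)
    qed (use e_nonneg in \<open>simp add: f_def\<close>)
  qed
  moreover have "(\<Sum>j. f j n) = first_moment n / real n" for n
    unfolding f_def suminf_If_atMost first_moment_def by (simp add: sum_divide_distrib)
  ultimately show ?thesis by simp
qed

text \<open>Potter's bound gives \<open>e j = O((n / j) powr (\<alpha> + 1) * b n)\<close>, and the
  factor \<open>(j / n) powr r\<close> more than compensates, so every term is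
  \<open>O(b n)\<close>. There are at most \<delta> n terms with \<open>j \<ge> 1\<close>, and
  \<open>n * b n = O(X n)\<close> by Karamata.\<close>

lemma small_jumps_bound:
  obtains C where "C \<ge> 0" "\<And>D n \<delta>. n > 0 \<Longrightarrow> real D \<le> \<delta> * real n \<Longrightarrow> \<delta> \<le> 1 \<Longrightarrow> small_jumps D n \<le> C * \<delta> * X n"
proof -
  obtain C1 where C1: "C1 > 0" "\<And>n. \<bar>e n\<bar> \<le> C1 * b n" using bounded_ratio[OF e_limit b_pos] by blast
  obtain C2 where C2: "C2 > 0" "\<And>j n. 1 \<le> j \<Longrightarrow> j \<le> n \<Longrightarrow> b j \<le> C2 * (real n / real j) powr (\<alpha> + 1) * b n"
    by (rule reg_var_potter_lower[OF b(1), of "\<alpha> + 1"]) (use \<alpha> in auto)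
  have "(\<lambda>n. inverse (X n / (real n * b n))) \<longlonglongrightarrow> inverse (1 / (\<alpha> - 1))"
    unfolding X_def by (intro tendsto_inverse reg_var_karamata b \<alpha>) (use \<alpha> in auto)
  then have "(\<lambda>n. (real n * b n) / X n) \<longlonglongrightarrow> \<alpha> - 1" by (simp add: inverse_eq_divide)
  from bounded_ratio[OF this X_pos] obtain C3 where C3: "C3 > 0" "\<And>n. \<bar>real n * b n\<bar> \<le> C3 * X n" by blast
  define c where "c = (exp 1 * m) powr r"
  have c: "c \<ge> 0" by (simp add: c_def)
  show thesis
  proof
    show "C1 * C2 * c * C3 \<ge> 0" using C1(1) C2(1) C3(1) c by simp
    fix D n :: nat and \<delta> :: real
    assume n: "n > 0" and D: "real D \<le> \<delta> * real n" and \<delta>: "\<delta> \<le> 1"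
    have \<delta>0: "\<delta> \<ge> 0" using D n by (metis of_nat_0_le_iff order_trans zero_le_mult_iff of_nat_0_less_iff not_less)
    have "\<delta> * real n \<le> 1 * real n" using \<delta> by (intro mult_right_mono) auto
    then have Dn: "D \<le> n" using D by linarith
    have term_le: "e j * (exp 1 * m * real j / real n) powr r \<le> C1 * C2 * c * b n" if j: "j \<in> {..D} - {0}" for j
    proof -
      have j1: "1 \<le> j" "j \<le> n" using j Dn by auto
      have "e j \<le> C1 * b j" using C1(2)[of j] by simp
      also have "\<dots> \<le> C1 * (C2 * (real n / real j) powr (\<alpha> + 1) * b n)" using C1(1) C2(2)[OF j1] by simp
      finally have ej: "e j \<le> C1 * (C2 * (real n / real j) powr (\<alpha> + 1) * b n)" .
      have pw: "(exp 1 * m * real j / real n) powr r = c * (real j / real n) powr r"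
        using powr_mult[of "exp 1 * m" "real j / real n" r] by (simp add: c_def)
      have "e j * (exp 1 * m * real j / real n) powr r \<le>
          C1 * (C2 * (real n / real j) powr (\<alpha> + 1) * b n) * (c * (real j / real n) powr r)"
        unfolding pw by (rule mult_right_mono[OF ej]) (use c in simp)
      also have "C1 * (C2 * (real n / real j) powr (\<alpha> + 1) * b n) * (c * (real j / real n) powr r)
          = C1 * C2 * c * b n * ((real n / real j) powr (\<alpha> + 1) * (real j / real n) powr r)" by (simp add: mult_ac)
      also have "\<dots> \<le> C1 * C2 * c * b n * 1"
      proof (intro mult_left_mono)
        have "(real n / real j) powr (\<alpha> + 1) = (real j / real n) powr -(\<alpha> + 1)"
          using powr_one_over[of "real j / real n" "\<alpha> + 1"] j1 by simp
        then have "(real n / real j) powr (\<alpha> + 1) * (real j / real n) powr r = (real j / real n) powr 2"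
          by (simp add: powr_add[symmetric] r_def)
        also have "\<dots> \<le> 1 powr 2" by (rule powr_mono2) (use j1 in auto)
        finally show "(real n / real j) powr (\<alpha> + 1) * (real j / real n) powr r \<le> 1" by simp
      qed (use C1(1) C2(1) c b_nonneg in auto)
      finally show ?thesis by simp
    qed
    \<comment> \<open>The term \<open>j = 0\<close> is removed because Potter's bound starts at 1;
      it vanishes since \<open>0 powr r\<close> is 0.\<close>
    have "small_jumps D n = (\<Sum>j\<in>{..D} - {0}. e j * (exp 1 * m * real j / real n) powr r)"
      unfolding small_jumps_def by (rule sum.mono_neutral_right) auto
    also have "\<dots> \<le> (\<Sum>j\<in>{..D} - {0}. C1 * C2 * c * b n)" by (rule sum_mono) (rule term_le)
    also have "\<dots> = real D * (C1 * C2 * c * b n)" by (simp add: card_Diff_singleton)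
    also have "\<dots> \<le> (\<delta> * real n) * (C1 * C2 * c * b n)"
      using D C1(1) C2(1) c b_nonneg by (intro mult_right_mono) auto
    also have "\<dots> = C1 * C2 * c * \<delta> * (real n * b n)" by simp
    also have "\<dots> \<le> C1 * C2 * c * \<delta> * (C3 * X n)"
      using C3(2)[of n] C1(1) C2(1) c \<delta>0 by (intro mult_left_mono) auto
    finally show "small_jumps D n \<le> C1 * C2 * c * C3 * \<delta> * X n" by (simp add: mult_ac)
  qed
qed

text \<open>The index reached when \<open>t_le_K\<close> is applied at the truncation level
  \<open>n / r\<close>; the recursion for \<open>K\<close> jumps from \<open>n\<close> to
  it.\<close>

definition half :: "nat \<Rightarrow> nat" where "half n = nat \<lfloor>real n / r\<rfloor> div 2"

lemma half_ratio: "(\<lambda>n. real (half n) / real n) \<longlonglongrightarrow> 1 / (2 * r)"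
proof -
  have e: "half n = nat \<lfloor>1 / (2 * r) * real n\<rfloor>" for n
  proof -
    have "real n / r \<ge> 0" using r_pos by simp
    have "\<lfloor>real n / r / real 2\<rfloor> = \<lfloor>real n / r\<rfloor> div 2"
      using floor_divide_real_eq_div[of 2 "real n / r"] by simp
    then have "\<lfloor>1 / (2 * r) * real n\<rfloor> = \<lfloor>real n / r\<rfloor> div 2" by (simp add: mult.commute)
    then show ?thesis unfolding half_def by (simp add: nat_div_distrib)
  qed
  show ?thesis unfolding e by (rule tendsto_floor_ratio) (use r_pos in simp)
qed

lemma t_bound:
  assumes n: "real n \<ge> 4 * r"
  shows "t (nat \<lfloor>real n / r\<rfloor>) \<le> 4 * r / real n * K (half n)"
proof -
  define k where "k = nat \<lfloor>real n / r\<rfloor>"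
  have q: "real n / r \<ge> 4" using n r_pos by (simp add: pos_le_divide_eq)
  then have k2: "k \<ge> 2" unfolding k_def by linarith
  have "real k \<ge> real n / r - 1" unfolding k_def by linarith
  then have kr: "real k \<ge> real n / (2 * r)" using q by simp
  have n0: "real n > 0" using n r_pos by linarith
  have "2 / real k \<le> 2 / (real n / (2 * r))" using kr n0 r_pos k2 by (intro divide_left_mono mult_pos_pos) auto
  also have "\<dots> = 4 * r / real n" by simp
  finally have "2 / real k * K (k div 2) \<le> 4 * r / real n * K (k div 2)" by (rule mult_right_mono) (rule K_nonneg)
  then show ?thesis using t_le_K[OF k2] unfolding half_def k_def by linarith
qed

text \<open>The crude bound on \<xi> enters here: \<open>t\<close> at level \<open>n / r\<close> is
  at most a constant times \<open>K (half n) / n\<close>, and multiplied by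
  \<open>first_moment n = o(n)\<close> it has a vanishing coefficient, so
  \<open>reg_var_recursion\<close> applies.\<close>

lemma K_bounded:
  obtains Y where "Y \<ge> 0" "\<And>n. K n \<le> Y * X n"
proof -
  obtain C where C: "C \<ge> 0" "\<And>D n \<delta>. n > 0 \<Longrightarrow> real D \<le> \<delta> * real n \<Longrightarrow> \<delta> \<le> 1 \<Longrightarrow> small_jumps D n \<le> C * \<delta> * X n"
    using small_jumps_bound by blast
  obtain C' where C': "C' > 0" "\<And>n. \<bar>tail_sum e n\<bar> \<le> C' * X n" using bounded_ratio[OF E_limit X_pos] by blast
  define \<eta> where "\<eta> n = p * (4 * r) * (first_moment n / real n)" for n
  define n0 where "n0 = nat \<lceil>4 * r\<rceil>"
  have \<eta>: "\<eta> \<longlonglongrightarrow> 0" unfolding \<eta>_def[abs_def] using tendsto_mult[OF tendsto_const first_moment_limit] by simp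
  have fm: "first_moment n \<ge> 0" for n unfolding first_moment_def by (intro sum_nonneg mult_nonneg_nonneg e_nonneg) auto
  have n0: "real n \<ge> 4 * r \<and> n > 0" if "n \<ge> n0" for n
  proof -
    have "4 * r \<le> real n0" unfolding n0_def by linarith
    then show ?thesis using that r_pos by (auto intro: gr0I)
  qed
  show thesis
  proof (rule reg_var_recursion[OF X K_nonneg \<eta> _ half_ratio _ _ _ that, where ?n0.0 = n0 and C = "p * (C + 2 * C')"])
    fix n assume n: "n \<ge> n0"
    have "r \<ge> 1" using \<alpha> by (simp add: r_def)
    then have "real n / r \<le> real n" using n0[OF n] by (simp add: divide_le_eq mult_le_cancel_left1)
    then have "nat \<lfloor>real n / r\<rfloor> \<le> n" by linarith
    then show "half n < n" unfolding half_def using n0[OF n] by (metis div_le_mono div_less_dividend le_less_trans one_less_numeral_iff semiring_norm(76))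
    \<comment> \<open>With \<open>D = H = n\<close> the middle range is empty and the factor
      \<open>Q n n\<close> is simply bounded by 1; constants do not matter at this stage.\<close>
    have "K n \<le> p * (t (nat \<lfloor>real n / r\<rfloor>) * first_moment n + small_jumps n n + Q n n * tail_sum e n + tail_sum e n)"
      by (rule K_split) (use n0[OF n] in auto)
    also have "\<dots> \<le> p * ((4 * r / real n * K (half n)) * first_moment n + C * 1 * X n + 1 * (C' * X n) + C' * X n)"
    proof (intro mult_left_mono add_mono mult_mono mult_right_mono)
      show "t (nat \<lfloor>real n / r\<rfloor>) \<le> 4 * r / real n * K (half n)" by (rule t_bound) (use n0[OF n] in simp)
      show "small_jumps n n \<le> C * 1 * X n" by (rule C) (use n0[OF n] in auto)
    qed (use C'(2)[of n] Q_bounds fm pq E_nonneg K_nonneg r_pos in auto)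
    also have "\<dots> = \<eta> n * K (half n) + p * (C + 2 * C') * X n" by (simp add: \<eta>_def algebra_simps)
    finally show "K n \<le> \<eta> n * K (half n) + p * (C + 2 * C') * X n" .
  qed (use C C' pq r_pos in auto)
qed

lemma K_tendsto_0: "K \<longlonglongrightarrow> 0"
proof -
  have "K \<longlonglongrightarrow> suminf \<kappa> - suminf \<kappa>"
    unfolding K_def tail_sum_eq[OF summable_\<kappa>] by (intro tendsto_intros summable_LIMSEQ[OF summable_\<kappa>])
  then show ?thesis by simp
qed

text \<open>The tail hypothesis of \<open>iid_sum_LLN_upper\<close>: by \<open>t_le_K\<close>,
  \<open>k * t k\<close> is at most \<open>2 * K (k div 2)\<close>, which tends to 0.\<close>

lemma prob_xi_tail_limit:
  assumes \<gamma>: "\<gamma> > 0"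
  shows "(\<lambda>n. real n * measure_pmf.prob \<xi> {i. \<gamma> * real n < real i}) \<longlonglongrightarrow> 0"
proof -
  define k where "k n = nat \<lfloor>\<gamma> * real n\<rfloor>" for n
  have k_top: "filterlim k at_top sequentially" unfolding k_def by (rule filterlim_nat_floor[OF \<gamma>])
  have eq: "measure_pmf.prob \<xi> {i. \<gamma> * real n < real i} = t (k n)" for n
  proof -
    have "\<gamma> * real n \<ge> 0" using \<gamma> by simp
    then have "{k n<..} = {i. \<gamma> * real n < real i}" by (auto simp: k_def nat_less_iff floor_less_iff)
    then show ?thesis by (simp add: t_eq_prob)
  qed
  have "(\<lambda>n. 2 * inverse (real (k n) / real n) * K (k n div 2)) \<longlonglongrightarrow> 2 * inverse \<gamma> * 0"
  proof (intro tendsto_intros)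
    show "(\<lambda>n. real (k n) / real n) \<longlonglongrightarrow> \<gamma>" unfolding k_def by (rule tendsto_floor_ratio[OF \<gamma>])
    show "(\<lambda>n. K (k n div 2)) \<longlonglongrightarrow> 0"
      by (rule filterlim_compose[OF K_tendsto_0], rule filterlim_compose[OF filterlim_at_top_div_const_nat k_top]) simp
  qed (use \<gamma> in simp)
  then have lim: "(\<lambda>n. 2 * inverse (real (k n) / real n) * K (k n div 2)) \<longlonglongrightarrow> 0" by simp
  show ?thesis
  proof (rule tendsto_sandwich[OF _ _ tendsto_const lim])
    show "\<forall>\<^sub>F n in sequentially. 0 \<le> real n * measure_pmf.prob \<xi> {i. \<gamma> * real n < real i}" by simp
    show "\<forall>\<^sub>F n in sequentially. real n * measure_pmf.prob \<xi> {i. \<gamma> * real n < real i} \<le> 2 * inverse (real (k n) / real n) * K (k n div 2)"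
      using eventually_compose_filterlim[OF eventually_ge_at_top[of 2] k_top]
    proof eventually_elim
      case (elim n)
      have "real n * t (k n) \<le> real n * (2 / real (k n) * K (k n div 2))" by (intro mult_left_mono t_le_K elim) simp
      also have "\<dots> = 2 * inverse (real (k n) / real n) * K (k n div 2)" by (simp add: divide_inverse mult_ac)
      finally show ?case by (simp only: eq)
    qed
  qed
qed

text \<open>\<open>Q j n\<close> switches from nearly 0 to nearly 1 at \<open>j\<close> about
  \<open>n / m\<close>, so \<open>K n\<close> is close to \<open>p\<close> times the tail of
  \<open>e\<close> at \<open>n / m\<close>. For the upper bound the big jump part vanishes by
  \<open>K_bounded\<close>, the small terms cost at most a multiple of \<epsilon>, and the middle
  range has weight O(X) but \<open>Q\<close> tending to 0. For the lower bound only indices beyond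
  the switch are kept.\<close>

lemma K_limit: "(\<lambda>n. K n / X n) \<longlonglongrightarrow> p * m powr (\<alpha> - 1) / (1 - \<rho>)\<^sup>2"
proof (rule LIMSEQ_I)
  fix \<epsilon>' :: real assume \<epsilon>': "\<epsilon>' > 0"
  define ce where "ce = 1 / (1 - \<rho>)\<^sup>2"
  define L where "L = p * m powr (\<alpha> - 1) / (1 - \<rho>)\<^sup>2"
  have Lce: "L = p * (ce * (1 / m) powr -(\<alpha> - 1))"
    using powr_one_over[OF m_pos, of "-(\<alpha> - 1)"] by (simp add: L_def ce_def)
  obtain Y where Y: "Y \<ge> 0" "\<And>n. K n \<le> Y * X n" using K_bounded by blast
  obtain C where C: "C \<ge> 0" "\<And>D n \<delta>. n > 0 \<Longrightarrow> real D \<le> \<delta> * real n \<Longrightarrow> \<delta> \<le> 1 \<Longrightarrow> small_jumps D n \<le> C * \<delta> * X n"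
    using small_jumps_bound by blast
  have "((\<lambda>\<epsilon>. p * (C * \<epsilon> + ce * ((1 - \<epsilon>) / m) powr -(\<alpha> - 1))) \<longlongrightarrow> p * (C * 0 + ce * ((1 - 0) / m) powr -(\<alpha> - 1))) (at_right 0)"
    using m_pos by (intro tendsto_intros) auto
  then have up: "\<forall>\<^sub>F \<epsilon> in at_right 0. p * (C * \<epsilon> + ce * ((1 - \<epsilon>) / m) powr -(\<alpha> - 1)) < L + \<epsilon>'"
    by (rule order_tendstoD) (use \<epsilon>' in \<open>simp add: Lce\<close>)
  have "((\<lambda>\<epsilon>. p * (ce * ((1 + \<epsilon>) / m) powr -(\<alpha> - 1))) \<longlongrightarrow> p * (ce * ((1 + 0) / m) powr -(\<alpha> - 1))) (at_right 0)"
    using m_pos by (intro tendsto_intros) auto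
  then have lo: "\<forall>\<^sub>F \<epsilon> in at_right 0. p * (ce * ((1 + \<epsilon>) / m) powr -(\<alpha> - 1)) > L - \<epsilon>'"
    by (rule order_tendstoD) (use \<epsilon>' in \<open>simp add: Lce\<close>)
  have "\<forall>\<^sub>F \<epsilon> in at_right 0. \<epsilon> \<in> {0<..<1::real}" by (rule eventually_at_right_real) simp
  from eventually_happens'[OF trivial_limit_at_right_real eventually_conj[OF this eventually_conj[OF up lo]]]
  obtain \<epsilon> where \<epsilon>: "0 < \<epsilon>" "\<epsilon> < 1" and \<epsilon>up: "p * (C * \<epsilon> + ce * ((1 - \<epsilon>) / m) powr -(\<alpha> - 1)) < L + \<epsilon>'"
    and \<epsilon>lo: "p * (ce * ((1 + \<epsilon>) / m) powr -(\<alpha> - 1)) > L - \<epsilon>'"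
    unfolding greaterThanLessThan_iff by blast
  have E_ratio: "(\<lambda>n. tail_sum e (k n) / X n) \<longlonglongrightarrow> ce * u powr -(\<alpha> - 1)"
    if k: "(\<lambda>n. real (k n) / real n) \<longlonglongrightarrow> u" "u > 0" "filterlim k at_top sequentially" for k u
  proof -
    have "(\<lambda>n. tail_sum e (k n) / X (k n) * (X (k n) / X n)) \<longlonglongrightarrow> ce * u powr -(\<alpha> - 1)"
      unfolding ce_def by (intro tendsto_mult filterlim_compose[OF E_limit k(3)] reg_var_ratio[OF X k(1,2)])
    moreover have "(\<lambda>n. tail_sum e (k n) / X (k n) * (X (k n) / X n)) = (\<lambda>n. tail_sum e (k n) / X n)"
    proof
      fix n
      have "X (k n) \<noteq> 0" using X_pos[of "k n"] by simp
      then show "tail_sum e (k n) / X (k n) * (X (k n) / X n) = tail_sum e (k n) / X n" by simp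
    qed
    ultimately show ?thesis by (simp only:)
  qed
  \<comment> \<open>\<open>H\<close> and \<open>H'\<close> bracket the switching point
    \<open>n / m\<close> by a relative margin \<epsilon>. The successor in \<open>H'\<close> rounds
    up, so that \<open>H' n * m \<ge> (1 + \<epsilon>) * n\<close>.\<close>
  define D where "D n = nat \<lfloor>\<epsilon> * real n\<rfloor>" for n
  define H where "H n = nat \<lfloor>(1 - \<epsilon>) / m * real n\<rfloor>" for n
  define H' where "H' n = Suc (nat \<lfloor>(1 + \<epsilon>) / m * real n\<rfloor>)" for n
  have um: "(1 - \<epsilon>) / m > 0" "(1 + \<epsilon>) / m > 0" using \<epsilon> m_pos by auto
  have ED: "(\<lambda>n. tail_sum e (D n) / X n) \<longlonglongrightarrow> ce * \<epsilon> powr -(\<alpha> - 1)"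
    unfolding D_def by (intro E_ratio tendsto_floor_ratio filterlim_nat_floor \<epsilon>)
  have EH: "(\<lambda>n. tail_sum e (H n) / X n) \<longlonglongrightarrow> ce * ((1 - \<epsilon>) / m) powr -(\<alpha> - 1)"
    unfolding H_def by (intro E_ratio tendsto_floor_ratio filterlim_nat_floor um)
  have EH': "(\<lambda>n. tail_sum e (H' n) / X n) \<longlonglongrightarrow> ce * ((1 + \<epsilon>) / m) powr -(\<alpha> - 1)"
  proof (rule E_ratio[OF _ um(2)])
    have "(\<lambda>n. real (nat \<lfloor>(1 + \<epsilon>) / m * real n\<rfloor>) / real n + 1 / real n) \<longlonglongrightarrow> (1 + \<epsilon>) / m + 0"
      by (intro tendsto_add tendsto_floor_ratio um lim_1_over_n)
    moreover have "real (nat \<lfloor>(1 + \<epsilon>) / m * real n\<rfloor>) / real n + 1 / real n = real (H' n) / real n" for n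
      unfolding H'_def by (simp add: add_divide_distrib del: of_nat_nat)
    ultimately show "(\<lambda>n. real (H' n) / real n) \<longlonglongrightarrow> (1 + \<epsilon>) / m" by simp
    show "filterlim H' at_top sequentially" unfolding H'_def
      by (rule filterlim_compose[OF filterlim_Suc filterlim_nat_floor[OF um(2)]])
  qed
  have QH: "(\<lambda>n. Q (H n) n) \<longlonglongrightarrow> 0" unfolding Q_def
  proof (rule iid_sum_LLN_upper[OF mean m_pos _ \<epsilon> prob_xi_tail_limit])
    fix n
    have "0 \<le> (1 - \<epsilon>) / m * real n" by (rule mult_nonneg_nonneg) (use um in auto)
    then have "real (H n) \<le> (1 - \<epsilon>) / m * real n" unfolding H_def by linarith
    then have "real (H n) * m \<le> (1 - \<epsilon>) / m * real n * m" using m_pos by (intro mult_right_mono) auto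
    then show "real (H n) * m \<le> (1 - \<epsilon>) * real n" using m_pos by simp
  qed
  have QH': "(\<lambda>n. Q (H' n) n) \<longlonglongrightarrow> 1" unfolding Q_def
  proof (rule iid_sum_LLN_lower[OF mean m_pos _ \<epsilon>(1)])
    fix n
    have "(1 + \<epsilon>) / m * real n \<le> real (H' n)" unfolding H'_def by linarith
    then have "(1 + \<epsilon>) / m * real n * m \<le> real (H' n) * m" using m_pos by (intro mult_right_mono) auto
    then show "(1 + \<epsilon>) * real n \<le> real (H' n) * m" using m_pos by simp
  qed
  have fm: "first_moment n \<ge> 0" for n unfolding first_moment_def by (intro sum_nonneg mult_nonneg_nonneg e_nonneg) auto
  let ?U = "\<lambda>n. p * (4 * r * (first_moment n / real n) * Y * (X (half n) / X n) + C * \<epsilon> + Q (H n) n * (tail_sum e (D n) / X n) + tail_sum e (H n) / X n)"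
  have "?U \<longlonglongrightarrow> p * (4 * r * 0 * Y * (1 / (2 * r)) powr -(\<alpha> - 1) + C * \<epsilon> + 0 * (ce * \<epsilon> powr -(\<alpha> - 1)) + ce * ((1 - \<epsilon>) / m) powr -(\<alpha> - 1))"
    by (intro tendsto_intros first_moment_limit reg_var_ratio[OF X half_ratio] QH ED EH) (use r_pos in simp)
  then have evU: "\<forall>\<^sub>F n in sequentially. ?U n < L + \<epsilon>'" by (rule order_tendstoD) (use \<epsilon>up in simp)
  have "(\<lambda>n. p * (Q (H' n) n * (tail_sum e (H' n) / X n))) \<longlonglongrightarrow> p * (1 * (ce * ((1 + \<epsilon>) / m) powr -(\<alpha> - 1)))"
    by (intro tendsto_intros QH' EH')
  then have evL: "\<forall>\<^sub>F n in sequentially. p * (Q (H' n) n * (tail_sum e (H' n) / X n)) > L - \<epsilon>'"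
    by (rule order_tendstoD) (use \<epsilon>lo in simp)
  have evn: "\<forall>\<^sub>F n in sequentially. real n \<ge> 4 * r"
    using filterlim_at_top[THEN iffD1, OF filterlim_real_sequentially] by blast
  have "\<forall>\<^sub>F n in sequentially. norm (K n / X n - L) < \<epsilon>'"
    using evU evL evn eventually_gt_at_top[of 0]
  proof eventually_elim
    case (elim n)
    have \<epsilon>n: "\<epsilon> * real n \<le> 1 * real n" "0 \<le> \<epsilon> * real n" using \<epsilon> mult_right_mono[of \<epsilon> 1 "real n"] by auto
    have Dn: "real (D n) \<le> \<epsilon> * real n" unfolding D_def using \<epsilon>n by linarith
    have "K n \<le> p * (t (nat \<lfloor>real n / r\<rfloor>) * first_moment n + small_jumps (D n) n + Q (H n) n * tail_sum e (D n) + tail_sum e (H n))"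
      by (rule K_split) (use elim(4) Dn \<epsilon>n in linarith)+
    also have "\<dots> \<le> p * ((4 * r / real n * (Y * X (half n))) * first_moment n + C * \<epsilon> * X n + Q (H n) n * tail_sum e (D n) + tail_sum e (H n))"
    proof (intro mult_left_mono add_right_mono add_mono mult_right_mono fm)
      have "t (nat \<lfloor>real n / r\<rfloor>) \<le> 4 * r / real n * K (half n)" by (rule t_bound[OF elim(3)])
      also have "\<dots> \<le> 4 * r / real n * (Y * X (half n))" by (intro mult_left_mono Y) (use r_pos in simp)
      finally show "t (nat \<lfloor>real n / r\<rfloor>) \<le> 4 * r / real n * (Y * X (half n))" .
      show "small_jumps (D n) n \<le> C * \<epsilon> * X n" by (rule C(2)) (use elim(4) Dn \<epsilon> in auto)
    qed (use pq in auto)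
    finally have "K n / X n \<le> p * ((4 * r / real n * (Y * X (half n))) * first_moment n + C * \<epsilon> * X n + Q (H n) n * tail_sum e (D n) + tail_sum e (H n)) / X n"
      by (rule divide_right_mono) (use X_pos[of n] in simp)
    also have "\<dots> = ?U n"
    proof -
      have "((4 * r / real n * (Y * X (half n))) * first_moment n + C * \<epsilon> * X n + Q (H n) n * tail_sum e (D n) + tail_sum e (H n)) / X n
          = 4 * r * (first_moment n / real n) * Y * (X (half n) / X n) + C * \<epsilon> + Q (H n) n * (tail_sum e (D n) / X n) + tail_sum e (H n) / X n"
        using X_pos[of n] by (simp add: add_divide_distrib)
      then show ?thesis by (metis times_divide_eq_right)
    qed
    finally have 1: "K n / X n < L + \<epsilon>'" using elim(1) by linarith
    have "Q (H' n) n * tail_sum e (H' n) \<le> (\<Sum>j. e j * Q j n)"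
    proof -
      have sm: "summable (\<lambda>j. e (j + H' n))" "summable (\<lambda>j. e (j + H' n) * Q (j + H' n) n)"
        using summable_e summable_eQ[of n] by (auto intro: summable_ignore_initial_segment)
      have "Q (H' n) n * tail_sum e (H' n) = (\<Sum>j. Q (H' n) n * e (j + H' n))" unfolding tail_sum_def by (rule suminf_mult[OF sm(1), symmetric])
      also have "\<dots> \<le> (\<Sum>j. e (j + H' n) * Q (j + H' n) n)"
      proof (rule suminf_le)
        show "Q (H' n) n * e (j + H' n) \<le> e (j + H' n) * Q (j + H' n) n" for j
          using mult_left_mono[OF Q_mono[of "H' n" "j + H' n" n] e_nonneg[of "j + H' n"]] by (simp add: mult.commute)
      qed (use sm in \<open>auto intro: summable_mult\<close>)
      also have "\<dots> \<le> (\<Sum>j. e (j + H' n) * Q (j + H' n) n) + (\<Sum>j<H' n. e j * Q j n)"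
        using sum_nonneg[of "{..<H' n}" "\<lambda>j. e j * Q j n"] e_nonneg Q_bounds by simp
      also have "\<dots> = (\<Sum>j. e j * Q j n)" by (rule suminf_split_initial_segment[OF summable_eQ, symmetric])
      finally show ?thesis .
    qed
    then have "p * (Q (H' n) n * tail_sum e (H' n)) \<le> K n" unfolding K_eq using pq by simp
    then have "p * (Q (H' n) n * tail_sum e (H' n)) / X n \<le> K n / X n" by (rule divide_right_mono) (use X_pos[of n] in simp)
    then have 2: "L - \<epsilon>' < K n / X n" using elim(2) by simp
    show ?case using 1 2 by (simp only: real_norm_def abs_less_iff) linarith
  qed
  then show "\<exists>no. \<forall>n\<ge>no. norm (K n / X n - p * m powr (\<alpha> - 1) / (1 - \<rho>)\<^sup>2) < \<epsilon>'"
    by (simp add: eventually_sequentially L_def)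
qed

end

section \<open>Arrivals during a service\<close>

lemma poisson_sums: "(\<lambda>k. exp (- x) * x ^ k / fact k * w ^ k) sums exp (- x * (1 - w))" for x w :: real
proof -
  have "(\<lambda>k. exp (- x) * ((x * w) ^ k /\<^sub>R fact k)) sums (exp (- x) * exp (x * w))"
    by (intro sums_mult exp_converges)
  moreover have "exp (- x) * ((x * w) ^ k /\<^sub>R fact k) = exp (- x) * x ^ k / fact k * w ^ k" for k
    by (simp add: power_mult_distrib divide_inverse)
  moreover have "exp (- x) * exp (x * w) = exp (- x * (1 - w))"
    by (simp add: exp_add[symmetric] algebra_simps)
  ultimately show ?thesis by simp
qed

definition poisson_upto :: "nat \<Rightarrow> real \<Rightarrow> real" where
  "poisson_upto n x = (\<Sum>k\<le>n. exp (- x) * x ^ k / fact k)"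

lemma poisson_upto_bounds: "x \<ge> 0 \<Longrightarrow> 0 \<le> poisson_upto n x" "x \<ge> 0 \<Longrightarrow> poisson_upto n x \<le> 1"
proof -
  assume x: "x \<ge> 0"
  show "0 \<le> poisson_upto n x" unfolding poisson_upto_def using x by (intro sum_nonneg) auto
  have "poisson_upto n x \<le> (\<Sum>k. exp (- x) * x ^ k / fact k)" unfolding poisson_upto_def
    by (rule sum_le_suminf) (use x poisson_sums[of x 1] in \<open>auto simp: sums_iff\<close>)
  also have "\<dots> = 1" using poisson_sums[of x 1] by (simp add: sums_iff)
  finally show "poisson_upto n x \<le> 1" .
qed

text \<open>Exponential Markov inequality with parameter \<open>-s\<close>: each weight with
  \<open>k \<le> n\<close> may be multiplied by
  \<open>exp (s * n) * exp (- s) ^ k \<ge> 1\<close>.\<close>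

lemma poisson_upto_chernoff:
  assumes x: "x \<ge> 0" and s: "s \<ge> 0"
  shows "poisson_upto n x \<le> exp (s * real n - x * (1 - exp (- s)))"
proof -
  have "poisson_upto n x \<le> (\<Sum>k\<le>n. exp (s * real n) * (exp (- x) * x ^ k / fact k * exp (- s) ^ k))"
    unfolding poisson_upto_def
  proof (rule sum_mono)
    fix k assume "k \<in> {..n}"
    then have "s * real k \<le> s * real n" using s by (intro mult_left_mono) auto
    then have "1 \<le> exp (s * real n + real k * (- s))" by (simp add: mult.commute)
    also have "\<dots> = exp (s * real n) * exp (- s) ^ k" by (simp only: exp_add exp_of_nat_mult)
    finally have "exp (- x) * x ^ k / fact k * 1 \<le> exp (- x) * x ^ k / fact k * (exp (s * real n) * exp (- s) ^ k)"
      using x by (intro mult_left_mono) auto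
    then show "exp (- x) * x ^ k / fact k \<le> exp (s * real n) * (exp (- x) * x ^ k / fact k * exp (- s) ^ k)"
      by (simp add: mult_ac)
  qed
  also have "\<dots> = exp (s * real n) * (\<Sum>k\<le>n. exp (- x) * x ^ k / fact k * exp (- s) ^ k)"
    by (rule sum_distrib_left[symmetric])
  also have "(\<Sum>k\<le>n. exp (- x) * x ^ k / fact k * exp (- s) ^ k) \<le> (\<Sum>k. exp (- x) * x ^ k / fact k * exp (- s) ^ k)"
    by (rule sum_le_suminf) (use x poisson_sums[of x "exp (-s)"] in \<open>auto simp: sums_iff\<close>)
  also have "\<dots> = exp (- x * (1 - exp (- s)))" using poisson_sums[of x "exp (-s)"] by (simp add: sums_iff)
  finally show ?thesis by (simp add: exp_add[symmetric] exp_diff exp_minus field_simps)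
qed

lemma poisson_above_chernoff:
  assumes x: "x \<ge> 0" and s: "s \<ge> 0"
  shows "1 - poisson_upto n x \<le> exp (- s * real n + x * (exp s - 1))"
proof -
  define f where "f k = exp (- x) * x ^ k / fact k" for k
  have f0: "f k \<ge> 0" for k using x by (simp add: f_def)
  have f1: "summable f" "suminf f = 1" using poisson_sums[of x 1] by (auto simp: f_def[abs_def] sums_iff)
  have fs: "(\<lambda>k. f k * exp s ^ k) sums exp (- x * (1 - exp s))" unfolding f_def by (rule poisson_sums)
  have "1 - poisson_upto n x = tail_sum f (Suc n)"
    unfolding tail_sum_eq[OF f1(1)] f1(2) by (simp add: poisson_upto_def f_def lessThan_Suc_atMost)
  also have "\<dots> \<le> (\<Sum>k. exp (- s * real n) * (f (k + Suc n) * exp s ^ (k + Suc n)))"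
    unfolding tail_sum_def
  proof (rule suminf_le)
    fix k
    have "s * real n \<le> s * real (k + Suc n)" using s by (intro mult_left_mono) auto
    then have "1 \<le> exp (- s * real n + real (k + Suc n) * s)" by (simp add: mult.commute)
    also have "\<dots> = exp (- s * real n) * exp s ^ (k + Suc n)" by (simp only: exp_add exp_of_nat_mult)
    finally have "f (k + Suc n) * 1 \<le> f (k + Suc n) * (exp (- s * real n) * exp s ^ (k + Suc n))"
      by (intro mult_left_mono f0)
    then show "f (k + Suc n) \<le> exp (- s * real n) * (f (k + Suc n) * exp s ^ (k + Suc n))" by (simp add: mult_ac)
  next
    show "summable (\<lambda>k. f (k + Suc n))" by (rule summable_ignore_initial_segment[OF f1(1)])
    show "summable (\<lambda>k. exp (- s * real n) * (f (k + Suc n) * exp s ^ (k + Suc n)))"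
      using fs by (intro summable_mult summable_ignore_initial_segment[of "\<lambda>k. f k * exp s ^ k" "Suc n"]) (simp add: sums_iff)
  qed
  also have "\<dots> = exp (- s * real n) * tail_sum (\<lambda>k. f k * exp s ^ k) (Suc n)"
    unfolding tail_sum_def
    using fs by (intro suminf_mult summable_ignore_initial_segment[of "\<lambda>k. f k * exp s ^ k" "Suc n"]) (simp add: sums_iff)
  also have "\<dots> \<le> exp (- s * real n) * exp (- x * (1 - exp s))"
  proof (intro mult_left_mono)
    show "tail_sum (\<lambda>k. f k * exp s ^ k) (Suc n) \<le> exp (- x * (1 - exp s))"
    proof -
      have "(\<Sum>k<Suc n. f k * exp s ^ k) \<ge> 0" by (intro sum_nonneg mult_nonneg_nonneg f0) auto
      moreover have "tail_sum (\<lambda>k. f k * exp s ^ k) (Suc n) = exp (- x * (1 - exp s)) - (\<Sum>k<Suc n. f k * exp s ^ k)"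
        using fs by (subst tail_sum_eq) (simp_all add: sums_iff)
      ultimately show ?thesis by linarith
    qed
  qed simp
  also have "\<dots> = exp (- s * real n + x * (exp s - 1))" by (simp add: exp_add[symmetric] algebra_simps)
  finally show ?thesis .
qed

locale service_time = prob_space N for N :: "'b measure" +
  fixes T :: "'b \<Rightarrow> real" and lam :: real
  assumes T[measurable]: "T \<in> borel_measurable N" and T_pos: "AE x in N. T x > 0" and T_int: "integrable N T" and lam: "lam > 0"
begin

text \<open>The law of the number of arrivals during a service.\<close>

definition a :: "nat \<Rightarrow> real" where "a k = (\<integral>x. exp (- (lam * T x)) * (lam * T x) ^ k / fact k \<partial>N)"

definition b :: "nat \<Rightarrow> real" where "b n = tail_sum a (Suc n)"

lemma poisson_term_bounds: "x \<ge> 0 \<Longrightarrow> 0 \<le> exp (- x) * x ^ k / fact k \<and> exp (- x) * x ^ k / fact k \<le> 1" for x :: real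
proof -
  assume x: "x \<ge> 0"
  have "exp (- x) * x ^ k / fact k \<le> poisson_upto k x" unfolding poisson_upto_def
    by (rule member_le_sum) (use x in auto)
  then have "exp (- x) * x ^ k / fact k \<le> 1" using poisson_upto_bounds(2)[OF x, of k] by (rule order_trans)
  moreover have "0 \<le> exp (- x) * x ^ k / fact k" using x by simp
  ultimately show ?thesis by blast
qed

lemma integrable_poisson: "integrable N (\<lambda>x. exp (- (lam * T x)) * (lam * T x) ^ k / fact k)"
proof (rule integrable_const_bound[where B = 1])
  show "AE x in N. norm (exp (- (lam * T x)) * (lam * T x) ^ k / fact k) \<le> 1"
    using T_pos
  proof eventually_elim
    case (elim x)
    then show ?case using poisson_term_bounds[of "lam * T x" k] lam by simp
  qed
qed measurable

lemma a_nonneg: "a k \<ge> 0" unfolding a_def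
proof (rule integral_nonneg_AE)
  show "AE x in N. 0 \<le> exp (- (lam * T x)) * (lam * T x) ^ k / fact k"
    using T_pos by eventually_elim (use lam in auto)
qed

text \<open>Given \<open>T\<close>, the number of arrivals is Poisson with mean
  \<open>lam * T\<close>, so its conditional generating function is an exponential; partial sums are
  dominated by 1.\<close>

lemma a_generating_function:
  assumes w: "0 \<le> w" "w \<le> 1"
  shows "(\<lambda>k. a k * w ^ k) sums (\<integral>x. exp (- (lam * (1 - w)) * T x) \<partial>N)"
proof -
  have "(\<lambda>n. \<integral>x. (\<Sum>k<n. exp (- (lam * T x)) * (lam * T x) ^ k / fact k * w ^ k) \<partial>N) \<longlonglongrightarrow> (\<integral>x. exp (- (lam * T x) * (1 - w)) \<partial>N)"
  proof (rule integral_dominated_convergence[where w = "\<lambda>_. 1"])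
    show "AE x in N. (\<lambda>n. \<Sum>k<n. exp (- (lam * T x)) * (lam * T x) ^ k / fact k * w ^ k) \<longlonglongrightarrow> exp (- (lam * T x) * (1 - w))"
      using poisson_sums by (auto simp: sums_def)
    fix n
    show "AE x in N. norm (\<Sum>k<n. exp (- (lam * T x)) * (lam * T x) ^ k / fact k * w ^ k) \<le> 1"
      using T_pos
    proof eventually_elim
      case (elim x)
      let ?y = "lam * T x"
      have y: "?y \<ge> 0" using elim lam by simp
      have "(\<Sum>k<n. exp (- ?y) * ?y ^ k / fact k * w ^ k) \<le> (\<Sum>k<n. exp (- ?y) * ?y ^ k / fact k)"
        by (rule sum_mono, rule mult_left_le) (use y w in \<open>auto simp: power_le_one\<close>)
      also have "\<dots> \<le> poisson_upto n ?y" unfolding poisson_upto_def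
        by (rule sum_mono2) (use y in auto)
      also have "\<dots> \<le> 1" by (rule poisson_upto_bounds[OF y])
      finally have "(\<Sum>k<n. exp (- ?y) * ?y ^ k / fact k * w ^ k) \<le> 1" .
      moreover have "(\<Sum>k<n. exp (- ?y) * ?y ^ k / fact k * w ^ k) \<ge> 0" using y w by (intro sum_nonneg) auto
      ultimately show ?case by simp
    qed
  qed auto
  moreover have "(\<integral>x. (\<Sum>k<n. exp (- (lam * T x)) * (lam * T x) ^ k / fact k * w ^ k) \<partial>N) = (\<Sum>k<n. a k * w ^ k)" for n
  proof -
    have "(\<integral>x. (\<Sum>k<n. exp (- (lam * T x)) * (lam * T x) ^ k / fact k * w ^ k) \<partial>N)
        = (\<Sum>k<n. \<integral>x. exp (- (lam * T x)) * (lam * T x) ^ k / fact k * w ^ k \<partial>N)"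
      by (rule Bochner_Integration.integral_sum, rule integrable_mult_left, rule integrable_poisson)
    then show ?thesis unfolding a_def by (simp only: integral_mult_left_zero)
  qed
  moreover have "- (lam * T x) * (1 - w) = - (lam * (1 - w)) * T x" for x by simp
  ultimately show ?thesis by (simp only: sums_def)
qed

lemma a_sums: "a sums 1" using a_generating_function[of 1] by (simp add: prob_space)

lemma summable_a: "summable a" using a_sums by (simp add: sums_iff)

lemma b_eq: "b n = (\<integral>x. 1 - poisson_upto n (lam * T x) \<partial>N)"
proof -
  have "b n = 1 - (\<Sum>k<Suc n. a k)" unfolding b_def tail_sum_eq[OF summable_a] using a_sums by (simp add: sums_iff)
  also have "(\<Sum>k<Suc n. a k) = (\<integral>x. poisson_upto n (lam * T x) \<partial>N)"
    unfolding a_def poisson_upto_def lessThan_Suc_atMost using integrable_poisson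
    by (subst Bochner_Integration.integral_sum) auto
  also have "1 - \<dots> = (\<integral>x. 1 - poisson_upto n (lam * T x) \<partial>N)"
    unfolding poisson_upto_def
    by (subst Bochner_Integration.integral_diff) (use integrable_poisson prob_space in auto)
  finally show ?thesis .
qed

text \<open>Instead of differentiating the generating function, the Poisson weights are shifted:
  \<open>y\<close> times the weight at \<open>k\<close> is \<open>Suc k\<close> times the weight at
  \<open>Suc k\<close>. The partial sums are dominated by \<open>lam * T\<close>.\<close>

lemma a_mean: "(\<lambda>k. real k * a k) sums (lam * (\<integral>x. T x \<partial>N))"
proof -
  have "(\<lambda>n. \<integral>x. (\<Sum>k<n. exp (- (lam * T x)) * (lam * T x) ^ k / fact k * (lam * T x)) \<partial>N) \<longlonglongrightarrow> (\<integral>x. lam * T x \<partial>N)"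
  proof (rule integral_dominated_convergence[where w = "\<lambda>x. lam * T x"])
    show "AE x in N. (\<lambda>n. \<Sum>k<n. exp (- (lam * T x)) * (lam * T x) ^ k / fact k * (lam * T x)) \<longlonglongrightarrow> lam * T x"
    proof (rule AE_I2)
      fix x
      have "(\<lambda>k. exp (- (lam * T x)) * (lam * T x) ^ k / fact k * (lam * T x)) sums (1 * (lam * T x))"
        by (rule sums_mult2) (use poisson_sums[of "lam * T x" 1] in simp)
      then show "(\<lambda>n. \<Sum>k<n. exp (- (lam * T x)) * (lam * T x) ^ k / fact k * (lam * T x)) \<longlonglongrightarrow> lam * T x"
        by (simp add: sums_def)
    qed
    fix n
    show "AE x in N. norm (\<Sum>k<n. exp (- (lam * T x)) * (lam * T x) ^ k / fact k * (lam * T x)) \<le> lam * T x"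
      using T_pos
    proof eventually_elim
      case (elim x)
      let ?y = "lam * T x"
      have y: "?y \<ge> 0" using elim lam by simp
      have "(\<Sum>k<n. exp (- ?y) * ?y ^ k / fact k) \<le> poisson_upto n ?y" unfolding poisson_upto_def
        by (rule sum_mono2) (use y in auto)
      also have "\<dots> \<le> 1" by (rule poisson_upto_bounds[OF y])
      finally have "(\<Sum>k<n. exp (- ?y) * ?y ^ k / fact k) * ?y \<le> 1 * ?y" using y by (rule mult_right_mono)
      moreover have "(\<Sum>k<n. exp (- ?y) * ?y ^ k / fact k) * ?y \<ge> 0" by (rule mult_nonneg_nonneg[OF sum_nonneg y]) (use y in simp)
      ultimately show ?case by (simp add: sum_distrib_right)
    qed
  qed (use T_int in auto)
  moreover have "(\<integral>x. (\<Sum>k<n. exp (- (lam * T x)) * (lam * T x) ^ k / fact k * (lam * T x)) \<partial>N) = (\<Sum>k<n. real (Suc k) * a (Suc k))" for n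
  proof -
    have e: "exp (- (lam * T x)) * (lam * T x) ^ k / fact k * (lam * T x)
        = real (Suc k) * (exp (- (lam * T x)) * (lam * T x) ^ Suc k / fact (Suc k))" for k x
    proof -
      have "A / f * y = S * (A * y / (S * f))" if "S > 0" for A f y S :: real using that by simp
      from this[of "real (Suc k)" "exp (- (lam * T x)) * (lam * T x) ^ k" "fact k" "lam * T x"]
      show ?thesis unfolding fact_Suc power_Suc2 by (simp add: mult.assoc del: of_nat_Suc)
    qed
    have "(\<integral>x. (\<Sum>k<n. real (Suc k) * (exp (- (lam * T x)) * (lam * T x) ^ Suc k / fact (Suc k))) \<partial>N)
        = (\<Sum>k<n. \<integral>x. real (Suc k) * (exp (- (lam * T x)) * (lam * T x) ^ Suc k / fact (Suc k)) \<partial>N)"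
      by (rule Bochner_Integration.integral_sum, rule integrable_mult_right, rule integrable_poisson)
    then show ?thesis unfolding e a_def by (simp only: integral_mult_right_zero)
  qed
  ultimately have "(\<lambda>k. real (Suc k) * a (Suc k)) sums (lam * (\<integral>x. T x \<partial>N))" by (simp add: sums_def del: of_nat_Suc)
  then show ?thesis by (subst (asm) sums_Suc_iff) simp
qed

lemma b_sums: "b sums (lam * (\<integral>x. T x \<partial>N))"
proof -
  define f where "f i n = (if n < i then a i else 0)" for n i :: nat
  have row: "f i sums (real i * a i)" for i
    using sums_If_finite_set[of "{..<i}" "\<lambda>_. a i"] by (simp add: f_def[abs_def])
  have "(\<lambda>n. \<Sum>i. f i n) sums (lam * (\<integral>x. T x \<partial>N))"
    by (rule sums_swap_nonneg(1)[OF _ row a_mean]) (use a_nonneg in \<open>auto simp: f_def\<close>)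
  moreover have "(\<Sum>i. f i n) = b n" for n
    using suminf_If_greater[OF summable_a, of n] by (simp add: f_def b_def sums_iff)
  ultimately show ?thesis by simp
qed

lemma b_antimono: "decseq b"
  unfolding b_def using tail_sum_antimono[OF summable_a a_nonneg] by (auto simp: decseq_def)

lemma b_generating_function:
  assumes w: "0 \<le> w" "w < 1"
  shows "(\<lambda>n. b n * w ^ n) sums ((1 - (\<integral>x. exp (- (lam * (1 - w)) * T x) \<partial>N)) / (1 - w))"
  unfolding b_def by (rule tail_generating_function[OF a_nonneg a_sums w a_generating_function]) (use w in auto)

definition Fbar :: "real \<Rightarrow> real" where "Fbar t = prob {x \<in> space N. T x > t}"

text \<open>If \<open>lam * T \<le> (1 - \<epsilon>) * n\<close>, more than \<open>n\<close>
  arrivals are a large deviation. With \<open>s = \<epsilon> / 2\<close> and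
  \<open>exp s - 1 \<le> s + s^2\<close> the Chernoff exponent is at most
  \<open>- \<epsilon>^2 / 4\<close> per unit of \<open>n\<close>.\<close>

lemma b_upper:
  assumes \<epsilon>: "0 < \<epsilon>" "\<epsilon> < 1"
  shows "b n \<le> Fbar ((1 - \<epsilon>) / lam * real n) + exp (- (\<epsilon>\<^sup>2 / 4) * real n)"
proof -
  define t where "t = (1 - \<epsilon>) / lam * real n"
  define s where "s = \<epsilon> / 2"
  have s: "0 \<le> s" "s \<le> 1" using \<epsilon> by (auto simp: s_def)
  have "b n \<le> (\<integral>x. indicator {x \<in> space N. T x > t} x + exp (- (\<epsilon>\<^sup>2 / 4) * real n) \<partial>N)"
    unfolding b_eq
  proof (rule integral_mono_AE)
    show "integrable N (\<lambda>x. 1 - poisson_upto n (lam * T x))"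
      unfolding poisson_upto_def by (intro Bochner_Integration.integrable_diff Bochner_Integration.integrable_sum integrable_poisson) simp
    show "integrable N (\<lambda>x. indicator {x \<in> space N. T x > t} x + exp (- (\<epsilon>\<^sup>2 / 4) * real n))"
      by (intro Bochner_Integration.integrable_add) (auto simp: emeasure_eq_measure)
    show "AE x in N. 1 - poisson_upto n (lam * T x) \<le> indicator {x \<in> space N. T x > t} x + exp (- (\<epsilon>\<^sup>2 / 4) * real n)"
      using T_pos AE_space
    proof eventually_elim
      case (elim x)
      have y: "lam * T x \<ge> 0" using elim lam by simp
      show ?case
      proof (cases "T x > t")
        case True
        have "exp (- (\<epsilon>\<^sup>2 / 4) * real n) > 0" by (rule exp_gt_zero)
        moreover have "indicator {x \<in> space N. T x > t} x = (1::real)" using True elim(2) by simp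
        ultimately show ?thesis using poisson_upto_bounds(1)[OF y, of n] by linarith
      next
        case False
        have "1 - poisson_upto n (lam * T x) \<le> exp (- s * real n + lam * T x * (exp s - 1))"
          by (rule poisson_above_chernoff[OF y s(1)])
        also have "\<dots> \<le> exp (- (\<epsilon>\<^sup>2 / 4) * real n)"
        proof -
          have "lam * T x \<le> lam * t" using False lam by simp
          also have "\<dots> = (1 - \<epsilon>) * real n" using lam by (simp add: t_def)
          finally have "lam * T x * (exp s - 1) \<le> ((1 - \<epsilon>) * real n) * (s + s\<^sup>2)"
            by (rule mult_mono) (use exp_bound[OF s] s \<epsilon> in auto)
          then have "- s * real n + lam * T x * (exp s - 1) \<le> (- s + (1 - \<epsilon>) * (s + s\<^sup>2)) * real n"
            by (simp add: algebra_simps)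
          also have "\<dots> \<le> (- (\<epsilon>\<^sup>2 / 4)) * real n"
          proof (rule mult_right_mono)
            have "- s + (1 - \<epsilon>) * (s + s\<^sup>2) = - (\<epsilon>\<^sup>2 / 4) - \<epsilon> * s\<^sup>2"
              by (simp add: s_def power2_eq_square field_simps)
            moreover have "\<epsilon> * s\<^sup>2 \<ge> 0" using \<epsilon> by simp
            ultimately show "- s + (1 - \<epsilon>) * (s + s\<^sup>2) \<le> - (\<epsilon>\<^sup>2 / 4)" by linarith
          qed simp
          finally show ?thesis by simp
        qed
        finally show ?thesis using False by simp
      qed
    qed
  qed
  also have "\<dots> = Fbar t + exp (- (\<epsilon>\<^sup>2 / 4) * real n)"
    unfolding Fbar_def by (subst Bochner_Integration.integral_add) (auto simp: emeasure_eq_measure prob_space)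
  finally show ?thesis by (simp add: t_def)
qed

text \<open>If \<open>lam * T > (1 + \<epsilon>) * n\<close>, at most \<open>n\<close> arrivals are
  a large deviation. Again \<open>s = \<epsilon> / 2\<close>; now
  \<open>1 - exp (- s) \<ge> s - s^2 / 2\<close> and \<open>\<epsilon> < 1\<close> give the same
  rate.\<close>

lemma b_lower:
  assumes \<epsilon>: "0 < \<epsilon>" "\<epsilon> < 1"
  shows "b n \<ge> Fbar ((1 + \<epsilon>) / lam * real n) * (1 - exp (- (\<epsilon>\<^sup>2 / 4) * real n))"
proof -
  define t where "t = (1 + \<epsilon>) / lam * real n"
  define s where "s = \<epsilon> / 2"
  have s: "0 \<le> s" "s \<le> 1" using \<epsilon> by (auto simp: s_def)
  have "(\<integral>x. indicator {x \<in> space N. T x > t} x * (1 - exp (- (\<epsilon>\<^sup>2 / 4) * real n)) \<partial>N) \<le> b n"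
    unfolding b_eq
  proof (rule integral_mono_AE)
    show "integrable N (\<lambda>x. 1 - poisson_upto n (lam * T x))"
      unfolding poisson_upto_def by (intro Bochner_Integration.integrable_diff Bochner_Integration.integrable_sum integrable_poisson) simp
    show "integrable N (\<lambda>x. indicator {x \<in> space N. T x > t} x * (1 - exp (- (\<epsilon>\<^sup>2 / 4) * real n)))"
      by (auto simp: emeasure_eq_measure)
    show "AE x in N. indicator {x \<in> space N. T x > t} x * (1 - exp (- (\<epsilon>\<^sup>2 / 4) * real n)) \<le> 1 - poisson_upto n (lam * T x)"
      using T_pos AE_space
    proof eventually_elim
      case (elim x)
      have y: "lam * T x \<ge> 0" using elim lam by simp
      show ?case
      proof (cases "T x > t")
        case False
        then show ?thesis using poisson_upto_bounds(2)[OF y, of n] by simp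
      next
        case True
        have es: "1 - exp (- s) \<ge> s - s\<^sup>2 / 2"
        proof -
          have "exp (- s) \<le> 1 - s + s\<^sup>2 / 2"
          proof -
            \<comment> \<open>\<open>?A\<close> is a lower bound for \<open>exp s\<close>, and
              \<open>?A * ?B = 1 + s^4 / 4 \<ge> 1\<close>, so
              \<open>exp (- s) \<le> 1 / ?A \<le> ?B\<close>.\<close>
            let ?A = "1 + s + s\<^sup>2 / 2" and ?B = "1 - s + s\<^sup>2 / 2"
            have A: "?A > 0" using s by (simp add: add_pos_nonneg)
            have "exp (- s) \<le> 1 / ?A"
              using exp_lower_Taylor_quadratic[OF s(1)] A by (simp add: exp_minus inverse_eq_divide frac_le)
            also have "\<dots> \<le> ?B"
            proof -
              have "?B * ?A = 1 + s ^ 4 / 4" by (simp add: algebra_simps power2_eq_square power4_eq_xxxx)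
              also have "\<dots> \<ge> 1" by simp
              finally show ?thesis using A by (simp add: pos_divide_le_eq)
            qed
            finally show ?thesis .
          qed
          then show ?thesis by linarith
        qed
        have "poisson_upto n (lam * T x) \<le> exp (s * real n - lam * T x * (1 - exp (- s)))"
          by (rule poisson_upto_chernoff[OF y s(1)])
        also have "\<dots> \<le> exp (- (\<epsilon>\<^sup>2 / 4) * real n)"
        proof -
          have "(1 + \<epsilon>) * real n = lam * t" using lam by (simp add: t_def)
          also have "\<dots> \<le> lam * T x" using True lam by simp
          finally have "((1 + \<epsilon>) * real n) * (s - s\<^sup>2 / 2) \<le> lam * T x * (1 - exp (- s))"
          proof (rule mult_mono)
            show "s - s\<^sup>2 / 2 \<le> 1 - exp (- s)" by (rule es)
            have "s * s \<le> s * 1" using s by (intro mult_left_mono) auto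
            then show "0 \<le> s - s\<^sup>2 / 2" using s by (simp add: power2_eq_square)
          qed (use y in auto)
          moreover have "s * real n - ((1 + \<epsilon>) * real n) * S = (s - (1 + \<epsilon>) * S) * real n" for S
            by (simp add: algebra_simps)
          ultimately have "s * real n - lam * T x * (1 - exp (- s)) \<le> (s - (1 + \<epsilon>) * (s - s\<^sup>2 / 2)) * real n"
            by (metis diff_left_mono)
          also have "\<dots> \<le> (- (\<epsilon>\<^sup>2 / 4)) * real n"
          proof (rule mult_right_mono)
            have "s - (1 + \<epsilon>) * (s - s\<^sup>2 / 2) = - (\<epsilon>\<^sup>2 / 2) + (1 + \<epsilon>) * (\<epsilon>\<^sup>2 / 8)"
              by (simp add: s_def power2_eq_square field_simps)
            moreover have "(1 + \<epsilon>) * (\<epsilon>\<^sup>2 / 8) \<le> 2 * (\<epsilon>\<^sup>2 / 8)" using \<epsilon> by (intro mult_right_mono) auto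
            ultimately show "s - (1 + \<epsilon>) * (s - s\<^sup>2 / 2) \<le> - (\<epsilon>\<^sup>2 / 4)" by linarith
          qed simp
          finally show ?thesis by simp
        qed
        finally show ?thesis using True elim(2) by simp
      qed
    qed
  qed
  also have "(\<integral>x. indicator {x \<in> space N. T x > t} x * (1 - exp (- (\<epsilon>\<^sup>2 / 4) * real n)) \<partial>N) = Fbar t * (1 - exp (- (\<epsilon>\<^sup>2 / 4) * real n))"
    unfolding Fbar_def by (simp add: emeasure_eq_measure)
  finally show ?thesis by (simp add: t_def)
qed

end

lemma reg_var_of_antimono:
  fixes F :: "real \<Rightarrow> real"
  assumes F: "antimono F" "\<And>t. F t > 0"
    and lim: "\<And>u. u > 0 \<Longrightarrow> ((\<lambda>t. F (u * t) / F t) \<longlongrightarrow> u powr -\<alpha>) at_top"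
  shows "reg_var \<alpha> (\<lambda>n. F (real n))"
  unfolding reg_var_def
proof (intro conjI allI impI)
  show "decseq (\<lambda>n. F (real n))" using F(1) by (auto simp: decseq_def antimono_def)
  fix u :: real assume u: "u > 0"
  show "(\<lambda>n. F (real (nat \<lfloor>u * real n\<rfloor>)) / F (real n)) \<longlonglongrightarrow> u powr -\<alpha>"
    by (rule antimono_ratio_sequence[OF F _ tendsto_floor_ratio[OF u] u])
      (rule filterlim_compose[OF lim filterlim_real_sequentially])
qed (use F in auto)

text \<open>Potter's bound from index 1 shows that \<open>1 / x n\<close> grows at most
  polynomially.\<close>

lemma reg_var_exp_negligible:
  assumes x: "reg_var \<alpha> x" and \<alpha>: "\<alpha> \<ge> 0" and c: "c > 0"
  shows "(\<lambda>n. exp (- c * real n) / x n) \<longlonglongrightarrow> 0"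
proof -
  obtain C where C: "C > 0" "\<And>j n. 1 \<le> j \<Longrightarrow> j \<le> n \<Longrightarrow> x j \<le> C * (real n / real j) powr (\<alpha> + 1) * x n"
    by (rule reg_var_potter_lower[OF x, of "\<alpha> + 1"]) (use \<alpha> in auto)
  have pos: "x n > 0" for n using x by (rule reg_var_pos)
  have "summable (\<lambda>k. real (Suc k) powr (\<alpha> + 1) * exp (- c) ^ k)"
    by (rule summable_powr_mult_power) (use c in auto)
  then have "(\<lambda>k. real (Suc k) powr (\<alpha> + 1) * exp (- c) ^ k) \<longlonglongrightarrow> 0" by (rule summable_LIMSEQ_zero)
  from tendsto_mult[OF tendsto_const this, of "C / x 1"]
  have lim: "(\<lambda>k. C / x 1 * (real (Suc k) powr (\<alpha> + 1) * exp (- c) ^ k)) \<longlonglongrightarrow> 0" by simp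
  show ?thesis
  proof (rule tendsto_sandwich[OF _ _ tendsto_const lim])
    show "\<forall>\<^sub>F n in sequentially. 0 \<le> exp (- c * real n) / x n"
      using pos by (auto intro!: always_eventually divide_nonneg_pos)
    show "\<forall>\<^sub>F n in sequentially. exp (- c * real n) / x n \<le> C / x 1 * (real (Suc n) powr (\<alpha> + 1) * exp (- c) ^ n)"
      using eventually_ge_at_top[of 1]
    proof eventually_elim
      case (elim n)
      have "x 1 \<le> C * (real n / real 1) powr (\<alpha> + 1) * x n" by (rule C(2)) (use elim in auto)
      also have "\<dots> \<le> C * real (Suc n) powr (\<alpha> + 1) * x n"
        using C(1) pos[of n] \<alpha> by (intro mult_right_mono mult_left_mono powr_mono2) auto
      finally have "1 / x n \<le> C / x 1 * real (Suc n) powr (\<alpha> + 1)"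
        using pos[of n] pos[of 1] by (simp add: pos_divide_le_eq pos_le_divide_eq mult_ac del: of_nat_Suc)
      then have "exp (- c * real n) * (1 / x n) \<le> exp (- c * real n) * (C / x 1 * real (Suc n) powr (\<alpha> + 1))"
        by (rule mult_left_mono) simp
      also have "exp (- c * real n) = exp (- c) ^ n" using exp_of_nat_mult[of n "- c"] by (simp add: mult.commute)
      finally show ?case using exp_of_nat_mult[of n "- c"] by (simp add: mult_ac del: of_nat_Suc)
    qed
  qed
qed

section \<open>Regular variation of the number of arrivals during a service\<close>

context service_time
begin

lemma Fbar_antimono: "antimono Fbar"
  unfolding Fbar_def antimono_def by (auto intro!: finite_measure_mono)

context
  fixes \<alpha> :: real and L :: "real \<Rightarrow> real"
  assumes \<alpha>: "\<alpha> \<ge> 0" and L_pos: "\<And>t. t > 0 \<Longrightarrow> L t > 0"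
    and L_sv: "\<And>x. x > 0 \<Longrightarrow> ((\<lambda>t. L (x * t) / L t) \<longlongrightarrow> 1) at_top"
    and tail: "Fbar \<sim>[at_top] (\<lambda>t. t powr (- \<alpha>) * L t)"
begin

text \<open>Asymptotic equivalence sets the quotient 0/0 to 1; for \<open>t > 0\<close> the
  right-hand side is positive, so it is an ordinary quotient limit.\<close>

lemma Fbar_limit: "((\<lambda>t. Fbar t / (t powr (- \<alpha>) * L t)) \<longlongrightarrow> 1) at_top"
proof (rule Lim_transform_eventually[OF asymp_equivD[OF tail]])
  show "\<forall>\<^sub>F t in at_top. (if Fbar t = 0 \<and> t powr (- \<alpha>) * L t = 0 then 1 else Fbar t / (t powr (- \<alpha>) * L t)) = Fbar t / (t powr (- \<alpha>) * L t)"
    using eventually_gt_at_top[of 0] by eventually_elim (use L_pos in \<open>auto simp: less_le\<close>)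
qed

text \<open>The tail is positive at arbitrarily large arguments by the asymptotics, hence everywhere
  by monotonicity.\<close>

lemma Fbar_pos: "Fbar t > 0"
proof -
  have "\<forall>\<^sub>F t in at_top. Fbar t / (t powr (- \<alpha>) * L t) > 1 / 2"
    by (rule order_tendstoD(1)[OF Fbar_limit]) simp
  then have "\<forall>\<^sub>F s in at_top. Fbar s > 0"
    using eventually_gt_at_top[of 0]
  proof eventually_elim
    case (elim s)
    have "Fbar s \<ge> 0" by (simp add: Fbar_def)
    moreover have "Fbar s \<noteq> 0" using elim by auto
    ultimately show ?case by simp
  qed
  then have "\<forall>\<^sub>F s in at_top. Fbar s > 0 \<and> t \<le> s" using eventually_ge_at_top[of t] by (rule eventually_conj)
  then obtain s where "Fbar s > 0" "t \<le> s" using eventually_happens[of _ "at_top :: real filter"] by auto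
  then show ?thesis using antimonoD[OF Fbar_antimono, of t s] by linarith
qed

lemma Fbar_ratio:
  assumes u: "u > 0"
  shows "((\<lambda>t. Fbar (u * t) / Fbar t) \<longlongrightarrow> u powr -\<alpha>) at_top"
proof -
  let ?G = "\<lambda>t. t powr (- \<alpha>) * L t"
  have ut: "filterlim (\<lambda>t. u * t) at_top at_top"
    using u by (intro filterlim_tendsto_pos_mult_at_top[OF tendsto_const] filterlim_ident) auto
  have "((\<lambda>t. (Fbar (u * t) / ?G (u * t)) * (u powr -\<alpha> * (L (u * t) / L t)) / (Fbar t / ?G t)) \<longlongrightarrow> 1 * (u powr -\<alpha> * 1) / 1) at_top"
    by (intro tendsto_intros filterlim_compose[OF Fbar_limit ut] Fbar_limit L_sv u) auto
  moreover have "\<forall>\<^sub>F t in at_top. (Fbar (u * t) / ?G (u * t)) * (u powr -\<alpha> * (L (u * t) / L t)) / (Fbar t / ?G t) = Fbar (u * t) / Fbar t"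
    using eventually_gt_at_top[of 0]
  proof eventually_elim
    case (elim t)
    have nz: "L t \<noteq> 0" "L (u * t) \<noteq> 0" "Fbar t \<noteq> 0" "t powr -\<alpha> \<noteq> 0" "u powr -\<alpha> \<noteq> 0"
      using L_pos[of t] L_pos[of "u * t"] Fbar_pos[of t] elim u by auto
    have "(u * t) powr -\<alpha> = u powr -\<alpha> * t powr -\<alpha>" by (rule powr_mult)
    then show ?case using nz by simp
  qed
  ultimately show ?thesis using Lim_transform_eventually by fastforce
qed

lemma reg_var_Fbar: "reg_var \<alpha> (\<lambda>n. Fbar (real n))"
  by (rule reg_var_of_antimono[OF Fbar_antimono Fbar_pos Fbar_ratio])

text \<open>A service of length \<open>T\<close> brings about \<open>lam * T\<close> arrivals with
  exponentially small error, so \<open>b n\<close> is squeezed between values of the service tail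
  near \<open>n / lam\<close>; regular variation turns the rescaling into
  \<open>lam powr \<alpha>\<close>.\<close>

lemma b_limit: "(\<lambda>n. b n / Fbar (real n)) \<longlonglongrightarrow> lam powr \<alpha>"
proof (rule LIMSEQ_I)
  fix e :: real assume e: "e > 0"
  have base: "lam powr \<alpha> = (1 / lam) powr -\<alpha>" using powr_one_over[OF lam, of "-\<alpha>"] by simp
  have "((\<lambda>\<epsilon>. ((1 - \<epsilon>) / lam) powr -\<alpha>) \<longlongrightarrow> ((1 - 0) / lam) powr -\<alpha>) (at_right 0)"
    using lam by (intro tendsto_intros) auto
  then have up: "\<forall>\<^sub>F \<epsilon> in at_right 0. ((1 - \<epsilon>) / lam) powr -\<alpha> < lam powr \<alpha> + e"
    by (rule order_tendstoD) (use e in \<open>simp add: base\<close>)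
  have "((\<lambda>\<epsilon>. ((1 + \<epsilon>) / lam) powr -\<alpha>) \<longlongrightarrow> ((1 + 0) / lam) powr -\<alpha>) (at_right 0)"
    using lam by (intro tendsto_intros) auto
  then have lo: "\<forall>\<^sub>F \<epsilon> in at_right 0. ((1 + \<epsilon>) / lam) powr -\<alpha> > lam powr \<alpha> - e"
    by (rule order_tendstoD) (use e in \<open>simp add: base\<close>)
  have "\<forall>\<^sub>F \<epsilon> in at_right 0. \<epsilon> \<in> {0<..<1::real}" by (rule eventually_at_right_real) simp
  from eventually_happens'[OF trivial_limit_at_right_real eventually_conj[OF this eventually_conj[OF up lo]]]
  obtain \<epsilon> where \<epsilon>: "0 < \<epsilon>" "\<epsilon> < 1" and \<epsilon>up: "((1 - \<epsilon>) / lam) powr -\<alpha> < lam powr \<alpha> + e"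
    and \<epsilon>lo: "((1 + \<epsilon>) / lam) powr -\<alpha> > lam powr \<alpha> - e"
    unfolding greaterThanLessThan_iff by blast
  have r: "(\<lambda>n. Fbar (v * real n) / Fbar (real n)) \<longlonglongrightarrow> v powr -\<alpha>" if "v > 0" for v
    by (rule filterlim_compose[OF Fbar_ratio[OF that] filterlim_real_sequentially])
  have um: "(1 - \<epsilon>) / lam > 0" "(1 + \<epsilon>) / lam > 0" using \<epsilon> lam by auto
  have ex: "(\<lambda>n. exp (- (\<epsilon>\<^sup>2 / 4) * real n) / Fbar (real n)) \<longlonglongrightarrow> 0"
    by (rule reg_var_exp_negligible[OF reg_var_Fbar \<alpha>]) (use \<epsilon> in simp)
  have ex1: "(\<lambda>n. exp (- (\<epsilon>\<^sup>2 / 4) * real n)) \<longlonglongrightarrow> 0"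
  proof -
    have "(\<lambda>n. exp (- (\<epsilon>\<^sup>2 / 4)) ^ n) \<longlonglongrightarrow> 0" by (rule LIMSEQ_power_zero) (use \<epsilon> in simp)
    moreover have "exp (- (\<epsilon>\<^sup>2 / 4)) ^ n = exp (- (\<epsilon>\<^sup>2 / 4) * real n)" for n
      using exp_of_nat_mult[of n "- (\<epsilon>\<^sup>2 / 4)"] by (simp add: mult.commute)
    ultimately show ?thesis by simp
  qed
  have "(\<lambda>n. Fbar ((1 - \<epsilon>) / lam * real n) / Fbar (real n) + exp (- (\<epsilon>\<^sup>2 / 4) * real n) / Fbar (real n)) \<longlonglongrightarrow> ((1 - \<epsilon>) / lam) powr -\<alpha> + 0"
    by (intro tendsto_intros r um ex)
  then have evU: "\<forall>\<^sub>F n in sequentially. Fbar ((1 - \<epsilon>) / lam * real n) / Fbar (real n) + exp (- (\<epsilon>\<^sup>2 / 4) * real n) / Fbar (real n) < lam powr \<alpha> + e"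
    by (rule order_tendstoD) (use \<epsilon>up in simp)
  have "(\<lambda>n. Fbar ((1 + \<epsilon>) / lam * real n) / Fbar (real n) * (1 - exp (- (\<epsilon>\<^sup>2 / 4) * real n))) \<longlonglongrightarrow> ((1 + \<epsilon>) / lam) powr -\<alpha> * (1 - 0)"
    by (intro tendsto_intros r um ex1)
  then have evL: "\<forall>\<^sub>F n in sequentially. Fbar ((1 + \<epsilon>) / lam * real n) / Fbar (real n) * (1 - exp (- (\<epsilon>\<^sup>2 / 4) * real n)) > lam powr \<alpha> - e"
    by (rule order_tendstoD) (use \<epsilon>lo in simp)
  have "\<forall>\<^sub>F n in sequentially. norm (b n / Fbar (real n) - lam powr \<alpha>) < e"
    using evU evL
  proof eventually_elim
    case (elim n)
    have Fp: "0 \<le> Fbar (real n)" using Fbar_pos[of n] by simp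
    have "b n / Fbar (real n) \<le> (Fbar ((1 - \<epsilon>) / lam * real n) + exp (- (\<epsilon>\<^sup>2 / 4) * real n)) / Fbar (real n)"
      by (rule divide_right_mono[OF b_upper[OF \<epsilon>] Fp])
    then have "b n / Fbar (real n) < lam powr \<alpha> + e" using elim(1) unfolding add_divide_distrib by linarith
    moreover have "Fbar ((1 + \<epsilon>) / lam * real n) * (1 - exp (- (\<epsilon>\<^sup>2 / 4) * real n)) / Fbar (real n) \<le> b n / Fbar (real n)"
      by (rule divide_right_mono[OF b_lower[OF \<epsilon>] Fp])
    then have "lam powr \<alpha> - e < b n / Fbar (real n)" using elim(2) by simp
    ultimately show ?case unfolding real_norm_def abs_less_iff by linarith
  qed
  then show "\<exists>no. \<forall>n\<ge>no. norm (b n / Fbar (real n) - lam powr \<alpha>) < e" by (simp add: eventually_sequentially)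
qed

lemma b_pos: "b n > 0"
proof -
  have "\<forall>\<^sub>F n in sequentially. b n / Fbar (real n) > 0"
    by (rule order_tendstoD(1)[OF b_limit]) (use lam in simp)
  then have "\<forall>\<^sub>F k in sequentially. b k > 0 \<and> n \<le> k"
    using eventually_ge_at_top[of n]
    by eventually_elim (use Fbar_pos in \<open>auto simp: zero_less_divide_iff dest: less_asym\<close>)
  then obtain k where "b k > 0" "n \<le> k" using eventually_happens[of _ sequentially] by auto
  then show ?thesis using decseqD[OF b_antimono, of n k] by simp
qed

lemma reg_var_b: "reg_var \<alpha> b"
  by (rule reg_var_equiv[OF reg_var_Fbar b_antimono b_pos b_limit]) (use lam in simp)

end

end

section \<open>The stationary law of the queue\<close>

lemma space_queue_space: "space queue_space = queue_states"
  by (simp add: queue_space_def space_restrict_space space_pair_measure)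

text \<open>Dynkin's equation over \<open>[0, 1]\<close> is integrated against the stationary law.
  Invariance removes the difference on the left and makes the integrand on the right constant in
  time. \<open>G\<close> is a measurable function that agrees with the generator on the state space,
  and it makes Fubini applicable.\<close>

lemma stationary_generator_integral:
  fixes f G :: "state \<Rightarrow> real"
  assumes sg: "retrial_queue_semigroup lam q mu B P" and ss: "steady_state_law P D"
    and tf: "test_function lam q mu B f" and f[measurable]: "f \<in> borel_measurable queue_space"
    and G[measurable]: "G \<in> borel_measurable queue_space"
    and eq: "\<And>s. s \<in> queue_states \<Longrightarrow> queue_generator lam q mu B f s = G s"
  shows "(\<integral>s. G s \<partial>D) = 0"
proof -
  have D: "sets D = sets queue_space" "prob_space D"
    using ss by (auto simp: steady_state_law_def space_prob_algebra)
  interpret D: prob_space D by (rule D(2))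
  have spD: "space D = queue_states" using sets_eq_imp_space_eq[OF D(1)] space_queue_space by simp
  have ker: "(\<lambda>(t, s). P t s) \<in> restrict_space borel {0..} \<Otimes>\<^sub>M queue_space \<rightarrow>\<^sub>M prob_algebra queue_space"
    using sg by (simp add: retrial_queue_semigroup_def)
  have kerP: "P t \<in> queue_space \<rightarrow>\<^sub>M prob_algebra queue_space" if "t \<ge> 0" for t
    using measurable_compose_Pair1[OF _ ker, of t] that by (simp add: space_restrict_space)
  have kerS: "P t \<in> D \<rightarrow>\<^sub>M subprob_algebra queue_space" if "t \<ge> 0" for t
    using measurable_prob_algebraD[OF kerP[OF that]] by (simp add: measurable_cong_sets[OF D(1) refl])
  have Pts: "prob_space (P t s)" "sets (P t s) = sets queue_space" "space (P t s) = queue_states"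
    if "t \<ge> 0" "s \<in> queue_states" for t s
  proof -
    have "P t s \<in> space (prob_algebra queue_space)"
      using measurable_space[OF kerP[OF that(1)]] that(2) space_queue_space by simp
    then show "prob_space (P t s)" "sets (P t s) = sets queue_space" by (auto simp: space_prob_algebra)
    then show "space (P t s) = queue_states" using sets_eq_imp_space_eq space_queue_space by metis
  qed
  have inv: "D \<bind> P t = D" if "t \<ge> 0" for t using ss that by (simp add: steady_state_law_def)
  obtain Cf where Cf: "\<And>s. s \<in> queue_states \<Longrightarrow> \<bar>f s\<bar> \<le> Cf"
    using tf unfolding test_function_def bounded_iff by (auto simp: image_iff)
  obtain Cg where Cg: "\<And>s. s \<in> queue_states \<Longrightarrow> \<bar>G s\<bar> \<le> Cg"
  proof -
    have "queue_generator lam q mu B f ` queue_states = G ` queue_states" using eq by (intro image_cong) auto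
    moreover have "bounded (queue_generator lam q mu B f ` queue_states)" using tf by (simp only: test_function_def)
    ultimately have "bounded (G ` queue_states)" by simp
    then show ?thesis using that unfolding bounded_iff by (auto simp: image_iff)
  qed
  have bind_int: "(\<integral>s. g s \<partial>D) = (\<integral>s. (\<integral>z. g z \<partial>P t s) \<partial>D)"
    if t: "t \<ge> 0" and g: "g \<in> borel_measurable queue_space" and C: "\<And>s. s \<in> queue_states \<Longrightarrow> \<bar>g s\<bar> \<le> C" for g :: "state \<Rightarrow> real" and C t
  proof -
    have "(\<integral>s. g s \<partial>(D \<bind> P t)) = (\<integral>s. (\<integral>z. g z \<partial>P t s) \<partial>D)"
    proof (rule integral_bind[OF g _ kerS[OF t], where B = C and B' = 1])
      show "AE s in D. emeasure (P t s) (space (P t s)) \<le> ennreal 1"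
        using Pts(1)[OF t] spD by (auto intro!: AE_I2 simp: prob_space.emeasure_space_1)
    qed (use C spD space_queue_space in \<open>auto intro!: D.finite_measure_axioms\<close>)
    then show ?thesis using inv[OF t] by simp
  qed
  have meas_int: "(\<lambda>s. \<integral>z. g z \<partial>P t s) \<in> borel_measurable D"
    if t: "t \<ge> 0" and g: "g \<in> borel_measurable queue_space" for g :: "state \<Rightarrow> real" and t
    by (rule measurable_compose[OF kerS[OF t] integral_measurable_subprob_algebra[OF g]])
  have bdd_int: "\<bar>\<integral>z. g z \<partial>P t s\<bar> \<le> C"
    if t: "t \<ge> 0" "s \<in> queue_states" and g: "g \<in> borel_measurable queue_space" and C: "\<And>s. s \<in> queue_states \<Longrightarrow> \<bar>g s\<bar> \<le> C" for g :: "state \<Rightarrow> real" and C t s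
  proof -
    interpret Q: prob_space "P t s" by (rule Pts[OF t])
    have gm: "g \<in> borel_measurable (P t s)" using g by (simp add: measurable_cong_sets[OF Pts(2)[OF t] refl])
    have bd: "AE z in P t s. norm (g z) \<le> C" using C Pts(3)[OF t] by (auto intro!: AE_I2)
    have "\<bar>\<integral>z. g z \<partial>P t s\<bar> \<le> (\<integral>z. \<bar>g z\<bar> \<partial>P t s)" by (rule integral_abs_bound)
    also have "\<dots> \<le> C" by (rule Q.integral_le_const) (use Q.integrable_const_bound[OF bd gm] bd in auto)
    finally show ?thesis .
  qed
  \<comment> \<open>The time interval as a measure of total mass 1, so that a function constant in
    time integrates to itself.\<close>
  define R where "R = restrict_space lborel {0..1::real}"
  have R: "finite_measure R" 
    by (rule finite_measureI) (simp add: R_def emeasure_restrict_space space_restrict_space)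
  interpret R: finite_measure R by (rule R)
  have spR: "space R = {0..1}" by (simp add: R_def space_restrict_space)
  have measR: "measure R (space R) = 1" unfolding spR by (simp add: R_def measure_restrict_space)
  define h where "h r s = (\<integral>z. G z \<partial>P r s)" for r s
  have hm: "(\<lambda>(r, s). h r s) \<in> borel_measurable (R \<Otimes>\<^sub>M D)"
  proof -
    have id: "(\<lambda>r. r) \<in> R \<rightarrow>\<^sub>M restrict_space borel {0..}"
      unfolding R_def by (rule measurable_restrict_space3) auto
    have "(\<lambda>(r, s). (r, s)) \<in> R \<Otimes>\<^sub>M D \<rightarrow>\<^sub>M restrict_space borel {0..} \<Otimes>\<^sub>M queue_space"
      unfolding split_beta
      by (rule measurable_Pair, rule measurable_compose[OF measurable_fst id],
          rule measurable_compose[OF measurable_snd]) (simp add: measurable_cong_sets[OF D(1) refl])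
    from measurable_compose[OF this measurable_prob_algebraD[OF ker]]
    have "(\<lambda>(r, s). P r s) \<in> R \<Otimes>\<^sub>M D \<rightarrow>\<^sub>M subprob_algebra queue_space" by (simp add: split_beta)
    from measurable_compose[OF this integral_measurable_subprob_algebra[OF G]]
    show ?thesis by (simp add: h_def split_beta)
  qed
  have hb: "\<bar>h r s\<bar> \<le> Cg" if "0 \<le> r" "s \<in> queue_states" for r s
    unfolding h_def by (rule bdd_int[OF that G Cg])
  have dynkin: "(\<integral>z. f z \<partial>P 1 s) - f s = (\<integral>r. h r s \<partial>R)" if s: "s \<in> queue_states" for s
  proof -
    have "(\<integral>z. f z \<partial>P 1 s) = f s + (LBINT r:{0..1}. (\<integral>z. queue_generator lam q mu B f z \<partial>P r s))"
      using sg tf s by (simp add: retrial_queue_semigroup_def)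
    also have "(LBINT r:{0..1}. (\<integral>z. queue_generator lam q mu B f z \<partial>P r s)) = (LBINT r:{0..1}. h r s)"
      unfolding set_lebesgue_integral_def
    proof (rule Bochner_Integration.integral_cong[OF refl])
      fix r :: real
      show "indicator {0..1} r *\<^sub>R (\<integral>z. queue_generator lam q mu B f z \<partial>P r s) = indicator {0..1} r *\<^sub>R h r s"
      proof (cases "r \<in> {0..1}")
        case True
        then have "space (P r s) = queue_states" using Pts(3)[OF _ s] by simp
        then have "(\<integral>z. queue_generator lam q mu B f z \<partial>P r s) = h r s"
          unfolding h_def by (intro Bochner_Integration.integral_cong[OF refl] eq) simp
        then show ?thesis by simp
      qed simp
    qed
    also have "\<dots> = (\<integral>r. h r s \<partial>R)"
      unfolding R_def set_lebesgue_integral_def by (rule integral_restrict_space[symmetric]) simp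
    finally show ?thesis by simp
  qed
  have fD: "integrable D f" "integrable D (\<lambda>s. \<integral>z. f z \<partial>P 1 s)"
  proof -
    have "f \<in> borel_measurable D" by (simp add: measurable_cong_sets[OF D(1) refl])
    then show "integrable D f" by (rule D.integrable_const_bound[rotated, where B = Cf]) (use Cf spD in \<open>auto intro!: AE_I2\<close>)
    show "integrable D (\<lambda>s. \<integral>z. f z \<partial>P 1 s)"
      by (rule D.integrable_const_bound[where B = Cf]) (use bdd_int[OF _ _ f Cf] meas_int[OF _ f] spD in \<open>auto intro!: AE_I2\<close>)
  qed
  have "0 = (\<integral>s. (\<integral>z. f z \<partial>P 1 s) - f s \<partial>D)"
    using fD bind_int[OF _ f Cf, of 1] by simp
  also have "\<dots> = (\<integral>s. (\<integral>r. h r s \<partial>R) \<partial>D)"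
    by (rule Bochner_Integration.integral_cong[OF refl]) (use dynkin spD in simp)
  also have "\<dots> = (\<integral>r. (\<integral>s. h r s \<partial>D) \<partial>R)"
  proof -
    interpret RD: pair_sigma_finite R D ..
    interpret RDf: finite_measure "R \<Otimes>\<^sub>M D"
      by (rule finite_measure_pair_measure) (rule D.finite_measure_axioms, rule R)
    show ?thesis
    proof (rule RD.Fubini_integral, rule RDf.integrable_const_bound[where B = Cg])
      show "AE x in R \<Otimes>\<^sub>M D. norm (case x of (r, s) \<Rightarrow> h r s) \<le> Cg"
        by (rule AE_I2) (use hb spD spR in \<open>auto simp: space_pair_measure\<close>)
    qed (rule hm)
  qed
  also have "\<dots> = (\<integral>r. (\<integral>s. G s \<partial>D) \<partial>R)"
    by (rule Bochner_Integration.integral_cong[OF refl]) (use bind_int[OF _ G Cg, symmetric] spR in \<open>simp add: h_def\<close>)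
  also have "\<dots> = (\<integral>s. G s \<partial>D)" using measR by simp
  finally show ?thesis by simp
qed

text \<open>Compensates the unbounded retrial rate \<open>n * mu\<close> by the factor
  \<open>z ^ n\<close>; the generator image of the test function is bounded for this reason.\<close>

lemma times_power_bounded:
  fixes z :: real
  assumes "0 \<le> z" "z < 1"
  obtains C where "C \<ge> 0" "\<And>n. real n * z ^ n \<le> C"
proof -
  have "(\<lambda>n. real n * z ^ n) \<longlonglongrightarrow> 0" using powser_times_n_limit_0[of z] assms by simp
  then have "Bseq (\<lambda>n. real n * z ^ n)" by (intro convergent_imp_Bseq) (auto simp: convergent_def)
  then obtain C where "C > 0" "\<And>n. norm (real n * z ^ n) \<le> C" by (auto elim: BseqE)
  then show thesis using that[of C] assms by auto
qed

text \<open>The test function \<open>f (i, m, n, x) = v^m z^n exp (- s x)\<close> satisfies the boundary conditions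
  exactly when \<open>v\<close> is the Laplace-Stieltjes transform of the service time at \<open>s\<close>.\<close>

lemma stationary_balance:
  fixes lam q mu z s v :: real
  assumes sg: "retrial_queue_semigroup lam q mu B P" and ss: "steady_state_law P D"
    and B: "prob_space B" "sets B = sets borel" "AE x in B. x > 0"
    and z: "0 < z" "z < 1" and s: "s > 0" and v: "v = (\<integral>x. exp (- s * x) \<partial>B)"
  shows "(\<integral>\<omega>. (case \<omega> of (i, m, n, x) \<Rightarrow>
     if i = 0 then lam * (v * z ^ n - z ^ n) + real n * mu * (v * z ^ (n - 1) - z ^ n)
     else (s - lam * q * (1 - v) - lam * (1 - q) * (1 - z)) * (v ^ m * z ^ n * exp (- s * x))) \<partial>D) = 0" (is "?A")
    and "(\<lambda>\<omega>. case \<omega> of (i, m, n, x) \<Rightarrow>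
     if i = 0 then lam * (v * z ^ n - z ^ n) + real n * mu * (v * z ^ (n - 1) - z ^ n)
     else (s - lam * q * (1 - v) - lam * (1 - q) * (1 - z)) * (v ^ m * z ^ n * exp (- s * x))) \<in> borel_measurable queue_space" (is "?B")
proof -
  interpret B: prob_space B by (rule B(1))
  have v01: "0 \<le> v" "v \<le> 1"
  proof -
    show "0 \<le> v" unfolding v by (rule integral_nonneg_AE) simp
    have "integrable B (\<lambda>x. exp (- s * x))"
    proof (rule B.integrable_const_bound[where B = 1])
      show "AE x in B. norm (exp (- s * x)) \<le> 1" using B(3) by eventually_elim (use s in simp)
      show "(\<lambda>x. exp (- s * x)) \<in> borel_measurable B" by (simp add: measurable_cong_sets[OF B(2) refl])
    qed
    then have "v \<le> (\<integral>x. 1 \<partial>B)" unfolding v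
    proof (rule integral_mono_AE)
      show "AE x in B. exp (- s * x) \<le> 1" using B(3) by eventually_elim (use s in simp)
    qed simp
    then show "v \<le> 1" by (simp add: B.prob_space)
  qed
  define f :: "state \<Rightarrow> real" where "f = (\<lambda>(i, m, n, x). v ^ m * z ^ n * exp (- s * x))"
  \<comment> \<open>The generator image in closed form: the boundary conditions and the shifts in
    \<open>m\<close> and \<open>n\<close> become multiplications by \<open>v\<close> and
    \<open>z\<close>, so all busy states share one scalar coefficient.\<close>
  define G :: "state \<Rightarrow> real" where "G = (\<lambda>(i, m, n, x).
     if i = 0 then lam * (v * z ^ n - z ^ n) + real n * mu * (v * z ^ (n - 1) - z ^ n)
     else (s - lam * q * (1 - v) - lam * (1 - q) * (1 - z)) * (v ^ m * z ^ n * exp (- s * x)))"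
  have fint: "(\<integral>y. f (i, m, n, y) \<partial>B) = v ^ m * z ^ n * v" for i m n
    unfolding f_def v by simp
  have der: "((\<lambda>u. f (i, m, n, u)) has_real_derivative (- s * f (i, m, n, x))) (at x)" for i m n x
    unfolding f_def by (auto intro!: derivative_eq_intros)
  have deriv_f: "deriv (\<lambda>u. f (i, m, n, u)) x = - s * f (i, m, n, x)" for i m n x
    by (rule DERIV_imp_deriv[OF der])
  have eq: "queue_generator lam q mu B f \<omega> = G \<omega>" if "\<omega> \<in> queue_states" for \<omega>
  proof -
    obtain i m n x where \<omega>: "\<omega> = (i, m, n, x)" by (cases \<omega>) auto
    show ?thesis
    proof (cases "i = 0")
      case True
      then have "m = 0" "x = 0" using that by (auto simp: queue_states_def \<omega>)
      then show ?thesis unfolding \<omega> using True by (simp add: fint G_def) (simp add: f_def mult.commute)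
    next
      case False
      then show ?thesis unfolding \<omega>
        by (simp only: queue_generator.simps if_False deriv_f) (simp add: f_def G_def algebra_simps)
    qed
  qed
  have f_bound: "\<bar>f \<omega>\<bar> \<le> 1" if "\<omega> \<in> queue_states" for \<omega>
  proof -
    obtain i m n x where \<omega>: "\<omega> = (i, m, n, x)" by (cases \<omega>) auto
    have x: "x \<ge> 0" using that by (auto simp: \<omega> queue_states_def)
    have "v ^ m * z ^ n * exp (- s * x) \<le> 1 * 1 * 1"
      using v01 z x s by (intro mult_mono power_le_one) auto
    then show ?thesis using v01 z by (simp add: \<omega> f_def)
  qed
  obtain C where C: "C \<ge> 0" "\<And>n. real n * z ^ n \<le> C" using times_power_bounded[of z] z by auto
  have G_bound: "\<bar>G \<omega>\<bar> \<le> \<bar>lam\<bar> + \<bar>mu\<bar> * (C / z) + \<bar>s - lam * q * (1 - v) - lam * (1 - q) * (1 - z)\<bar>"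
    if "\<omega> \<in> queue_states" for \<omega>
  proof -
    obtain i m n x where \<omega>: "\<omega> = (i, m, n, x)" by (cases \<omega>) auto
    have zn: "0 \<le> z ^ n" "z ^ n \<le> 1" using z by (auto intro: power_le_one)
    have Cz: "C / z \<ge> 0" using C z by simp
    show ?thesis
    proof (cases "i = 0")
      case True
      have "\<bar>lam * (v * z ^ n - z ^ n)\<bar> = \<bar>lam\<bar> * ((1 - v) * z ^ n)"
      proof -
        have "v * z ^ n - z ^ n = - ((1 - v) * z ^ n)" by (simp add: left_diff_distrib)
        then show ?thesis using v01 zn by (simp add: abs_mult)
      qed
      also have "\<dots> \<le> \<bar>lam\<bar> * (1 * 1)" using v01 zn by (intro mult_left_mono mult_mono) auto
      finally have 1: "\<bar>lam * (v * z ^ n - z ^ n)\<bar> \<le> \<bar>lam\<bar>" by simp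
      have "\<bar>real n * mu * (v * z ^ (n - 1) - z ^ n)\<bar> = \<bar>mu\<bar> * \<bar>real n * (v * z ^ (n - 1) - z ^ n)\<bar>"
        by (simp add: abs_mult mult_ac)
      also have "\<bar>real n * (v * z ^ (n - 1) - z ^ n)\<bar> \<le> C / z"
      proof (cases n)
        case (Suc k)
        have "z ^ k * \<bar>v - z\<bar> \<le> z ^ k * 1" using v01 z by (intro mult_left_mono) auto
        then have "real n * (z ^ k * \<bar>v - z\<bar>) \<le> real n * z ^ k" by (intro mult_left_mono) auto
        also have "\<dots> = real n * z ^ n / z" using z Suc by simp
        also have "\<dots> \<le> C / z" using C(2)[of n] z by (intro divide_right_mono) auto
        finally have "real n * (z ^ k * \<bar>v - z\<bar>) \<le> C / z" .
        moreover have "v * z ^ (n - 1) - z ^ n = z ^ k * (v - z)" using Suc by (simp add: algebra_simps)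
        ultimately show ?thesis using z by (simp add: abs_mult)
      qed (use Cz in simp)
      finally have "\<bar>real n * mu * (v * z ^ (n - 1) - z ^ n)\<bar> \<le> \<bar>mu\<bar> * (C / z)" by (simp add: mult_left_mono)
      moreover have "G \<omega> = lam * (v * z ^ n - z ^ n) + real n * mu * (v * z ^ (n - 1) - z ^ n)"
        unfolding \<omega> G_def using True by simp
      moreover have "\<bar>A + A'\<bar> \<le> x + y + \<bar>u\<bar>" if "\<bar>A\<bar> \<le> x" "\<bar>A'\<bar> \<le> y" for A A' x y u :: real
        using that by linarith
      ultimately show ?thesis using 1 by metis
    next
      case False
      have "\<bar>G \<omega>\<bar> = \<bar>s - lam * q * (1 - v) - lam * (1 - q) * (1 - z)\<bar> * \<bar>f \<omega>\<bar>"
        unfolding \<omega> G_def f_def using False by (simp add: abs_mult)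
      also have "\<dots> \<le> \<bar>s - lam * q * (1 - v) - lam * (1 - q) * (1 - z)\<bar> * 1"
        by (rule mult_left_mono[OF f_bound[OF that]]) simp
      finally have Gle: "\<bar>G \<omega>\<bar> \<le> \<bar>s - lam * q * (1 - v) - lam * (1 - q) * (1 - z)\<bar>" by (simp only: mult_1_right)
      have "0 \<le> \<bar>lam\<bar> + \<bar>mu\<bar> * (C / z)" by (intro add_nonneg_nonneg mult_nonneg_nonneg abs_ge_zero Cz)
      from add_mono[OF this Gle] show ?thesis by (simp only: add_0_left)
    qed
  qed
  have cont: "continuous_on A (\<lambda>x. f (i, m, n, x))" for A i m n
    unfolding f_def by (auto intro!: continuous_intros)
  have tf: "test_function lam q mu B f"
    unfolding test_function_def
  proof (intro conjI allI)
    show "bounded (f ` queue_states)"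
    proof (rule boundedI)
      fix y assume "y \<in> f ` queue_states"
      then obtain \<omega> where "\<omega> \<in> queue_states" "y = f \<omega>" by blast
      then show "norm y \<le> 1" using f_bound by simp
    qed
    show "bounded (queue_generator lam q mu B f ` queue_states)"
    proof (rule boundedI)
      fix y assume "y \<in> queue_generator lam q mu B f ` queue_states"
      then obtain \<omega> where "\<omega> \<in> queue_states" "y = G \<omega>" using eq by blast
      then show "norm y \<le> \<bar>lam\<bar> + \<bar>mu\<bar> * (C / z) + \<bar>s - lam * q * (1 - v) - lam * (1 - q) * (1 - z)\<bar>"
        using G_bound by simp
    qed
    fix m n
    show "(\<lambda>x. f (1, m, n, x)) \<in> borel_measurable borel"
      using cont[of UNIV] by (rule borel_measurable_continuous_onI)
    show "continuous_on {0..} (\<lambda>x. f (1, m, n, x))" by (rule cont)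
    show "(\<lambda>x. f (1, m, n, x)) differentiable_on {0<..}"
      unfolding differentiable_on_def real_differentiable_def
      by (intro ballI exI, rule has_field_derivative_at_within[OF der])
    show "continuous_on {0<..} (deriv (\<lambda>x. f (1, m, n, x)))"
    proof -
      have "deriv (\<lambda>x. f (1, m, n, x)) = (\<lambda>x. - s * f (1, m, n, x))" using deriv_f by auto
      then show ?thesis using cont by (auto intro!: continuous_intros)
    qed
    show "f (1, 0, n, 0) = f (0, 0, n, 0)" by (simp add: f_def)
    show "f (1, Suc m, n, 0) = (\<integral>y. f (1, m, n, y) \<partial>B)" unfolding fint by (simp add: f_def)
  qed
  have meas: "f \<in> borel_measurable queue_space" "G \<in> borel_measurable queue_space"
  proof -
    have [measurable]: "(\<lambda>m. c ^ m) \<in> borel_measurable (count_space (UNIV :: nat set))" for c :: real by simp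
    have [measurable]: "(\<lambda>n. lam * (v * z ^ n - z ^ n) + real n * mu * (v * z ^ (n - 1) - z ^ n)) \<in> borel_measurable (count_space (UNIV :: nat set))" by simp
    show "f \<in> borel_measurable queue_space" unfolding f_def queue_space_def
      by (rule measurable_restrict_space1) measurable
    show "G \<in> borel_measurable queue_space" unfolding G_def queue_space_def
      by (rule measurable_restrict_space1) measurable
  qed
  from stationary_generator_integral[OF sg ss tf meas eq] show ?A by (simp add: G_def)
  show ?B using meas(2) by (simp only: G_def)
qed

lemma pmf_of_sums:
  fixes \<omega> :: "nat \<Rightarrow> real"
  assumes "\<And>n. \<omega> n \<ge> 0" "\<omega> sums 1"
  obtains \<xi> where "pmf \<xi> = \<omega>"
proof
  have "(\<integral>\<^sup>+n. ennreal (\<omega> n) \<partial>count_space UNIV) = (\<Sum>n. ennreal (\<omega> n))" by (rule nn_integral_count_space_nat)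
  also have "\<dots> = ennreal 1" using assms by (intro suminf_ennreal_eq) auto
  finally show "pmf (embed_pmf \<omega>) = \<omega>" using assms by (intro ext pmf_embed_pmf) auto
qed

lemma (in prob_space) expectation_nat_on_event_sums:
  fixes g :: "nat \<Rightarrow> real"
  assumes A[measurable]: "A \<in> events" and R[measurable]: "R \<in> M \<rightarrow>\<^sub>M count_space UNIV" and g: "\<And>n. \<bar>g n\<bar> \<le> C"
  shows "(\<lambda>n. prob {\<omega> \<in> A. R \<omega> = n} * g n) sums (\<integral>\<omega>. indicator A \<omega> * g (R \<omega>) \<partial>M)"
proof -
  have m: "{\<omega> \<in> A. R \<omega> = n} \<in> events" for n
  proof -
    have "{\<omega> \<in> A. R \<omega> = n} = A \<inter> (R -` {n} \<inter> space M)" using sets.sets_into_space[OF A] by auto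
    then show ?thesis using measurable_sets[OF R, of "{n}"] by auto
  qed
  have C: "C \<ge> 0" using g[of 0] by linarith
  have gR[measurable]: "(\<lambda>\<omega>. g (R \<omega>)) \<in> borel_measurable M" by (rule measurable_compose[OF R]) simp
  have fin: "(\<Sum>n<k. indicator {\<omega> \<in> A. R \<omega> = n} \<omega> * g n) = (if R \<omega> < k then indicator A \<omega> * g (R \<omega>) else 0)" for k \<omega>
  proof -
    have "(\<Sum>n<k. indicator {\<omega> \<in> A. R \<omega> = n} \<omega> * g n) = (\<Sum>n<k. if n = R \<omega> then indicator A \<omega> * g n else 0)"
      by (rule sum.cong) (auto simp: indicator_def)
    then show ?thesis by (simp add: sum.delta')
  qed
  have "(\<lambda>k. \<integral>\<omega>. (\<Sum>n<k. indicator {\<omega> \<in> A. R \<omega> = n} \<omega> * g n) \<partial>M) \<longlonglongrightarrow> (\<integral>\<omega>. indicator A \<omega> * g (R \<omega>) \<partial>M)"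
  proof (rule integral_dominated_convergence[where w = "\<lambda>_. C"])
    show "AE \<omega> in M. (\<lambda>k. \<Sum>n<k. indicator {\<omega> \<in> A. R \<omega> = n} \<omega> * g n) \<longlonglongrightarrow> indicator A \<omega> * g (R \<omega>)"
      unfolding fin
    proof (rule AE_I2, rule tendsto_eventually)
      fix \<omega>
      show "\<forall>\<^sub>F k in sequentially. (if R \<omega> < k then indicator A \<omega> * g (R \<omega>) else 0) = indicator A \<omega> * g (R \<omega>)"
        using eventually_gt_at_top[of "R \<omega>"] by eventually_elim simp
    qed
    show "AE \<omega> in M. norm (\<Sum>n<k. indicator {\<omega> \<in> A. R \<omega> = n} \<omega> * g n) \<le> C" for k
      unfolding fin using g C by (auto simp: indicator_def)
    show "(\<lambda>\<omega>. \<Sum>n<k. indicator {\<omega> \<in> A. R \<omega> = n} \<omega> * g n) \<in> borel_measurable M" for k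
      using m by (intro borel_measurable_sum borel_measurable_times) auto
  qed auto
  moreover have "(\<integral>\<omega>. (\<Sum>n<k. indicator {\<omega> \<in> A. R \<omega> = n} \<omega> * g n) \<partial>M) = (\<Sum>n<k. prob {\<omega> \<in> A. R \<omega> = n} * g n)" for k
    using m by (subst Bochner_Integration.integral_sum) (auto simp: emeasure_eq_measure)
  ultimately show ?thesis by (simp add: sums_def)
qed

lemma (in prob_space) integral_pos_of_AE_pos:
  fixes f :: "'a \<Rightarrow> real"
  assumes "integrable M f" "AE x in M. f x > 0"
  shows "(\<integral>x. f x \<partial>M) > 0"
proof -
  have nn: "AE x in M. 0 \<le> f x" using assms(2) by eventually_elim simp
  have "(\<integral>x. f x \<partial>M) \<noteq> 0"
  proof
    assume "(\<integral>x. f x \<partial>M) = 0"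
    then have "AE x in M. f x = 0" using integral_nonneg_eq_0_iff_AE[OF assms(1) nn] by simp
    with assms(2) have "AE x in M. False" by eventually_elim simp
    then show False by simp
  qed
  then show ?thesis using integral_nonneg_AE[OF nn] by simp
qed

theorem mainTheorem1:
  fixes lam q mu lam1 lam2 beta1 rho1 rho2 rho a :: real
    and L :: "real \<Rightarrow> real"
    and N :: "'b measure" and T :: "'b \<Rightarrow> real"
    and P :: "real \<Rightarrow> state \<Rightarrow> state measure"
    and M :: "'w measure"
    and I_ser R_que R_orb :: "'w \<Rightarrow> nat" and X_res :: "'w \<Rightarrow> real"
  assumes "lam > 0" and "mu > 0" and "0 < q" and "q < 1"
    \<comment> \<open>the service time\<close>
    and "prob_space N" and "T \<in> borel_measurable N"
    and "\<P>(\<omega> in N. T \<omega> \<le> 0) = 0" and "integrable N T"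
    and "beta1 = (\<integral>\<omega>. T \<omega> \<partial>N)"
    and "lam1 = lam * q" and "lam2 = lam * (1 - q)"
    and "rho1 = lam1 * beta1" and "rho2 = lam2 * beta1" and "rho = rho1 + rho2"
    and "rho < 1"
    \<comment> \<open>the queue in steady state\<close>
    and "retrial_queue_semigroup lam q mu (distr N borel T) P"
    and "prob_space M"
    and "(\<lambda>\<omega>. (I_ser \<omega>, R_que \<omega>, R_orb \<omega>, X_res \<omega>)) \<in> M \<rightarrow>\<^sub>M queue_space"
    and "steady_state_law P
           (distr M queue_space (\<lambda>\<omega>. (I_ser \<omega>, R_que \<omega>, R_orb \<omega>, X_res \<omega>)))"
    \<comment> \<open>the tail of the service time\<close>
    and "a > 1" and "slowly_varying L"
    and "(\<lambda>t. \<P>(\<omega> in N. T \<omega> > t)) \<sim>[at_top] (\<lambda>t. t powr (- a) * L t)"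
  shows "(\<lambda>j::nat. \<P>(\<omega> in M. R_orb \<omega> > j \<bar> I_ser \<omega> = 0)) \<sim>[sequentially]
         (\<lambda>j. lam * lam2 powr a / (a * mu * (1 - rho)\<^sup>2 * (1 - rho1) powr (a - 1)) *
               (real j powr (- a) * L (real j)))"
proof -

  \<comment> \<open>Service time and number of arrivals\<close>
  note lam = assms(1) and mu = assms(2) and q = assms(3,4)
  interpret N: prob_space N by fact
  interpret M: prob_space M by fact
  have T[measurable]: "T \<in> borel_measurable N" by fact
  have T_pos: "AE x in N. T x > 0"
  proof -
    have "AE x in N. \<not> T x \<le> 0"
      using assms(7) by (subst AE_iff_measurable[OF _ refl]) (auto simp: N.emeasure_eq_measure)
    then show ?thesis by eventually_elim simp
  qed
  interpret S: service_time N T lam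
    by unfold_locales (use assms T_pos in auto)
  have L: "\<And>t. t > 0 \<Longrightarrow> L t > 0" "\<And>x. x > 0 \<Longrightarrow> ((\<lambda>t. L (x * t) / L t) \<longlongrightarrow> 1) at_top"
    using \<open>slowly_varying L\<close> by (auto simp: slowly_varying_def)
  have tail: "S.Fbar \<sim>[at_top] (\<lambda>t. t powr (- a) * L t)"
    using assms(22) by (simp add: S.Fbar_def[abs_def])
  have a0: "a \<ge> 0" using \<open>a > 1\<close> by simp
  note b_rv = S.reg_var_b[OF a0 L tail]
  have rho_eq: "rho = lam * beta1" unfolding assms(10-14) by (simp add: algebra_simps)
  have b_sums: "S.b sums rho" using S.b_sums assms(9) rho_eq by simp
  have rho_pos: "rho > 0"
    using b_sums reg_var_pos[OF b_rv] by (auto simp: sums_iff intro!: suminf_pos)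
  define p where "p = 1 - q"
  have p: "p > 0" "p + q = 1" using q by (auto simp: p_def)
  have q\<rho>: "q * rho < 1"
  proof -
    have "q * rho < 1 * 1" using q rho_pos \<open>rho < 1\<close> by (intro mult_strict_mono) auto
    then show ?thesis by simp
  qed
  have rho1: "rho1 = q * rho" using assms(10,12) rho_eq by simp

  \<comment> \<open>Law of the orbit progeny\<close>
  obtain \<omega> where \<omega>: "\<And>n. \<omega> n \<ge> 0" "\<omega> sums 1"
    "\<And>z w. 0 \<le> z \<Longrightarrow> z \<le> 1 \<Longrightarrow> (\<lambda>n. \<omega> n * z ^ n) sums w \<Longrightarrow> w = q * (\<Sum>j. S.a j * w ^ j) + p * z"
  proof (rule exists_progeny_law[OF S.a_nonneg S.a_sums S.a_mean p(1) q(1) p(2)])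
    show "q * (lam * (\<integral>x. T x \<partial>N)) < 1" using q\<rho> rho_eq assms(9) by simp
  qed blast
  obtain \<xi> where \<xi>: "pmf \<xi> = \<omega>" using pmf_of_sums[OF \<omega>(1,2)] by blast
  define A where "A w = (\<integral>x. exp (- (lam * (1 - w)) * T x) \<partial>N)" for w
  have A_eq: "(\<Sum>j. S.a j * w ^ j) = A w" if "0 \<le> w" "w \<le> 1" for w
    using S.a_generating_function[OF that] by (simp add: A_def sums_iff)
  have w_fix: "0 \<le> w" "w < 1" "w = q * A w + p * z" "(1 - w) * (\<Sum>n. S.b n * w ^ n) = 1 - A w"
    if z: "0 \<le> z" "z < 1" and w: "(\<lambda>n. pmf \<xi> n * z ^ n) sums w" for z w
  proof -
    have sp: "summable (pmf \<xi>)" "suminf (pmf \<xi>) = 1" using pmf_nat_sums[of \<xi>] by (auto simp: sums_iff)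
    show w0: "0 \<le> w" using w z by (auto simp: sums_iff intro!: suminf_nonneg)
    have "w \<le> suminf (pmf \<xi>)"
      using w z sp by (intro sums_le[OF _ w summable_sums]) (auto simp: mult_left_le power_le_one)
    then have w1: "w \<le> 1" using sp by simp
    show eq: "w = q * A w + p * z" using \<omega>(3)[of z w] z w A_eq[OF w0 w1] by (simp add: \<xi>)
    show wlt: "w < 1"
    proof (rule ccontr)
      assume "\<not> w < 1"
      then have "w = 1" using w1 by simp
      moreover from this have "A w = 1" by (simp add: A_def N.prob_space)
      ultimately have "1 = q * 1 + p * z" using eq by metis
      then have "p * z = p" using p(2) by linarith
      then show False using p z by simp
    qed
    have "(\<Sum>n. S.b n * w ^ n) = (1 - A w) / (1 - w)"
      using S.b_generating_function[OF w0 wlt] by (simp add: A_def sums_iff)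
    then show "(1 - w) * (\<Sum>n. S.b n * w ^ n) = 1 - A w" using wlt by simp
  qed
  define m where "m = p / (1 - q * rho)"
  interpret Q: progeny S.b a rho p q m \<xi>
  proof
    fix z w :: real assume z: "0 \<le> z" "z < 1" and w: "(\<lambda>n. pmf \<xi> n * z ^ n) sums w"
    note wf = w_fix[OF z w]
    have "(1 - w) * (1 - q * (\<Sum>n. S.b n * w ^ n)) = (1 - w) - q * ((1 - w) * (\<Sum>n. S.b n * w ^ n))"
      by (simp add: algebra_simps)
    also have "\<dots> = 1 - (q * A w + p * z) - q * (1 - A w)" using wf(3,4) by simp
    also have "\<dots> = p * (1 - z)" using p by (simp add: algebra_simps)
    finally show "(1 - w) * (1 - q * (\<Sum>n. S.b n * w ^ n)) = p * (1 - z)" .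
  qed (use b_rv b_sums assms p q m_def in auto)

  \<comment> \<open>Stationary state and balance equation\<close>
  define B where "B = distr N borel T"
  have B: "prob_space B" "sets B = sets borel" "AE x in B. x > 0"
  proof -
    show "prob_space B" unfolding B_def by (rule N.prob_space_distr[OF T])
    show "sets B = sets borel" by (simp add: B_def)
    show "AE x in B. x > 0" unfolding B_def by (subst AE_distr_iff[OF T]) (use T_pos in auto)
  qed
  have LST: "(\<integral>x. exp (- s * x) \<partial>B) = (\<integral>x. exp (- s * T x) \<partial>N)" for s
    unfolding B_def by (subst integral_distr) auto
  define Y where "Y = (\<lambda>\<omega>. (I_ser \<omega>, R_que \<omega>, R_orb \<omega>, X_res \<omega>))"
  have Y: "Y \<in> M \<rightarrow>\<^sub>M queue_space" using assms(18) by (simp add: Y_def)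
  have Y': "Y \<in> M \<rightarrow>\<^sub>M count_space UNIV \<Otimes>\<^sub>M count_space UNIV \<Otimes>\<^sub>M count_space UNIV \<Otimes>\<^sub>M borel"
    using Y unfolding queue_space_def measurable_restrict_space2_iff by blast
  have I[measurable]: "I_ser \<in> M \<rightarrow>\<^sub>M count_space UNIV"
    using measurable_compose[OF Y' measurable_fst] by (simp add: Y_def)
  have R[measurable]: "R_orb \<in> M \<rightarrow>\<^sub>M count_space UNIV"
    using measurable_compose[OF Y' measurable_compose[OF measurable_snd measurable_compose[OF measurable_snd measurable_fst]]]
    by (simp add: Y_def)
  have Yst: "Y \<omega> \<in> queue_states" if "\<omega> \<in> space M" for \<omega>
    using measurable_space[OF Y that] space_queue_space by simp
  have balance: "(\<integral>\<omega>. (if I_ser \<omega> = 0 then lam * (v * z ^ R_orb \<omega> - z ^ R_orb \<omega>) + real (R_orb \<omega>) * mu * (v * z ^ (R_orb \<omega> - 1) - z ^ R_orb \<omega>)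
     else (s - lam * q * (1 - v) - lam * (1 - q) * (1 - z)) * (v ^ R_que \<omega> * z ^ R_orb \<omega> * exp (- s * X_res \<omega>))) \<partial>M) = 0" (is ?A)
    "(\<lambda>\<omega>. (if I_ser \<omega> = 0 then lam * (v * z ^ R_orb \<omega> - z ^ R_orb \<omega>) + real (R_orb \<omega>) * mu * (v * z ^ (R_orb \<omega> - 1) - z ^ R_orb \<omega>)
     else (s - lam * q * (1 - v) - lam * (1 - q) * (1 - z)) * (v ^ R_que \<omega> * z ^ R_orb \<omega> * exp (- s * X_res \<omega>)))) \<in> borel_measurable M" (is ?B)
    if z: "0 < z" "z < 1" and s: "s > 0" and v: "v = (\<integral>x. exp (- s * T x) \<partial>N)" for z s v
  proof -
    have v': "v = (\<integral>x. exp (- s * x) \<partial>B)" using v LST by simp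
    note sb = stationary_balance[OF assms(16)[folded B_def] assms(19)[folded Y_def] B z s v']
    show ?A using sb(1) unfolding integral_distr[OF Y sb(2)] unfolding Y_def prod.case .
    show ?B using measurable_compose[OF Y sb(2)] unfolding Y_def prod.case .
  qed

  \<comment> \<open>Positive probability of an idle server\<close>
  define Z where "Z = {\<omega> \<in> space M. I_ser \<omega> = 0}"
  have Z[measurable]: "Z \<in> M.events" unfolding Z_def by measurable
  define p0 where "p0 = M.prob Z"
  have p0: "p0 > 0"
  proof (rule ccontr)
    assume "\<not> p0 > 0"
    then have "M.prob Z = 0" using measure_nonneg[of M Z] by (simp add: p0_def)
    then have "AE \<omega> in M. \<omega> \<notin> Z" by (intro AE_not_in) (auto simp: M.emeasure_eq_measure null_sets_def)
    then have busy: "AE \<omega> in M. I_ser \<omega> \<noteq> 0" using AE_space by eventually_elim (simp add: Z_def)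
    \<comment> \<open>If the server were almost surely busy, the balance equation would be the
      vanishing integral of \<open>c\<close> times an almost surely positive function. With
      \<open>z = 1/2\<close> and \<open>s = 2 * lam\<close> the coefficient satisfies
      \<open>c > 0\<close>, since the two subtracted terms add up to at most
      \<open>lam\<close>.\<close>
    define s where "s = 2 * lam"
    define v where "v = (\<integral>x. exp (- s * T x) \<partial>N)"
    define c where "c = s - lam * q * (1 - v) - lam * (1 - q) * (1 - 1 / 2)"
    have s: "s > 0" using lam by (simp add: s_def)
    have int: "integrable N (\<lambda>x. exp (- s * T x))"
    proof (rule N.integrable_const_bound[where B = 1])
      show "AE x in N. norm (exp (- s * T x)) \<le> 1" using T_pos by eventually_elim (use s in simp)
    qed simp
    have v: "v > 0" unfolding v_def by (rule N.integral_pos_of_AE_pos[OF int]) simp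
    have v1: "v \<le> 1"
    proof -
      have "v \<le> (\<integral>x. 1 \<partial>N)" unfolding v_def
        by (rule integral_mono_AE[OF int]) (use T_pos s in auto)
      then show ?thesis by (simp add: N.prob_space)
    qed
    have c: "c > 0"
    proof -
      have "lam * q * (1 - v) \<le> lam * q * 1" using lam q v by (intro mult_left_mono) auto
      moreover have "lam * q * 1 + lam * (1 - q) * (1 - 1 / 2) \<le> lam"
      proof -
        have "lam * (1 - q) \<ge> 0" using lam q by simp
        moreover have "lam * (1 - q) * (1 - 1 / 2) = lam * (1 - q) / 2" by simp
        moreover have "lam * (1 - q) = lam - lam * q" by (rule right_diff_distrib[of lam 1 q, simplified])
        ultimately show ?thesis by linarith
      qed
      ultimately show ?thesis using lam unfolding c_def s_def by linarith
    qed
    let ?F = "\<lambda>\<omega>. (if I_ser \<omega> = 0 then lam * (v * (1/2) ^ R_orb \<omega> - (1/2) ^ R_orb \<omega>) + real (R_orb \<omega>) * mu * (v * (1/2) ^ (R_orb \<omega> - 1) - (1/2) ^ R_orb \<omega>)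
     else c * (v ^ R_que \<omega> * (1/2) ^ R_orb \<omega> * exp (- s * X_res \<omega>)))"
    have bal: "(\<integral>\<omega>. ?F \<omega> \<partial>M) = 0" "?F \<in> borel_measurable M"
    proof -
      have half: "0 < (1 / 2 :: real)" "(1 / 2 :: real) < 1" by auto
      show "(\<integral>\<omega>. ?F \<omega> \<partial>M) = 0" "?F \<in> borel_measurable M"
        unfolding c_def by (rule balance[OF half s v_def])+
    qed
    have F: "AE \<omega> in M. ?F \<omega> > 0 \<and> ?F \<omega> \<le> c"
      using busy AE_space
    proof eventually_elim
      case (elim \<omega>)
      have x: "X_res \<omega> > 0" using Yst[OF elim(2)] elim(1) by (auto simp: Y_def queue_states_def)
      have "v ^ R_que \<omega> * (1/2) ^ R_orb \<omega> * exp (- s * X_res \<omega>) \<le> 1 * 1 * 1"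
        using v v1 s x by (intro mult_mono power_le_one) auto
      then have "c * (v ^ R_que \<omega> * (1/2) ^ R_orb \<omega> * exp (- s * X_res \<omega>)) \<le> c * 1"
        using c by (intro mult_left_mono) auto
      then show ?case using elim(1) c v by simp
    qed
    have "integrable M ?F"
      by (rule M.integrable_const_bound[OF _ bal(2), where B = c]) (use F in eventually_elim, auto)
    from M.integral_pos_of_AE_pos[OF this] F bal(1) show False by auto
  qed

  \<comment> \<open>Differential equation in the idle states\<close>
  define ri where "ri n = M.prob {\<omega> \<in> Z. R_orb \<omega> = n}" for n
  have ri_nonneg: "ri n \<ge> 0" for n by (simp add: ri_def)
  have event_sums: "(\<lambda>n. ri n * g n) sums (\<integral>\<omega>. indicator Z \<omega> * g (R_orb \<omega>) \<partial>M)" if "\<And>n. \<bar>g n\<bar> \<le> C" for g C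
    unfolding ri_def by (rule M.expectation_nat_on_event_sums[OF Z R that])
  have ri_sums: "ri sums p0" using event_sums[of "\<lambda>_. 1" 1] by (simp add: p0_def)
  \<comment> \<open>The equation is linear in the generating function, so it can be derived for the
    weights \<open>ri\<close> of total mass \<open>p0\<close> and normalised afterwards.\<close>
  have ode: "(\<lambda>n. real (Suc n) * ri (Suc n) * z ^ n) sums
      (lam / mu * (p * (\<Sum>n. S.b n * w ^ n) / (1 - (\<Sum>n. S.b n * w ^ n))) * (\<Sum>n. ri n * z ^ n))"
    if z: "0 < z" "z < 1" and w: "(\<lambda>n. pmf \<xi> n * z ^ n) sums w" for z w
  proof -
    note wf = w_fix[OF less_imp_le[OF z(1)] z(2) w]
    define b' where "b' = (\<Sum>n. S.b n * w ^ n)"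
    have b': "b' \<le> rho" unfolding b'_def using Q.B_sums[of w] wf by simp
    define v where "v = A w"
    define s where "s = lam * (1 - w)"
    have s: "s > 0" using lam wf by (simp add: s_def)
    have vs: "v = (\<integral>x. exp (- s * T x) \<partial>N)" by (simp add: v_def A_def s_def)
    have "s - lam * q * (1 - v) - lam * (1 - q) * (1 - z) = lam * (q * v + p * z - w)"
      by (simp add: s_def p_def algebra_simps)
    then have zero: "s - lam * q * (1 - v) - lam * (1 - q) * (1 - z) = 0" using wf(3) by (simp add: v_def)
    define g where "g n = lam * (v * z ^ n - z ^ n) + real n * mu * (v * z ^ (n - 1) - z ^ n)" for n
    obtain C where C: "C \<ge> 0" "\<And>n. real n * z ^ n \<le> C" using times_power_bounded[of z] z by auto
    have bd1: "\<bar>z ^ n\<bar> \<le> 1" for n using z by (simp add: power_le_one)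
    have bd2: "\<bar>real n * z ^ n\<bar> \<le> C" for n using C z by simp
    have bd3: "\<bar>real n * z ^ (n - 1)\<bar> \<le> C / z" for n
    proof (cases n)
      case (Suc k)
      have "real n * z ^ (n - 1) = real n * z ^ n / z" using Suc z by simp
      then show ?thesis using C(2)[of n] z by (simp add: divide_right_mono)
    qed (use C z in simp)
    have smr: "summable (\<lambda>n. ri n * z ^ n)" "summable (\<lambda>n. ri n * (real n * z ^ n))" "summable (\<lambda>n. ri n * (real n * z ^ (n - 1)))"
      using event_sums[OF bd1] event_sums[OF bd2] event_sums[OF bd3] by (auto simp: sums_iff)
    define \<phi> where "\<phi> = (\<Sum>n. ri n * z ^ n)"
    define \<psi> where "\<psi> = (\<Sum>n. ri n * (real n * z ^ (n - 1)))"
    have s1: "(\<lambda>n. ri n * z ^ n) sums \<phi>" unfolding \<phi>_def by (rule summable_sums[OF smr(1)])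
    have s3: "(\<lambda>n. ri n * (real n * z ^ (n - 1))) sums \<psi>" unfolding \<psi>_def by (rule summable_sums[OF smr(3)])
    have s2: "(\<lambda>n. ri n * (real n * z ^ n)) sums (z * \<psi>)"
    proof -
      have "(\<lambda>n. z * (ri n * (real n * z ^ (n - 1)))) = (\<lambda>n. ri n * (real n * z ^ n))"
      proof
        show "z * (ri n * (real n * z ^ (n - 1))) = ri n * (real n * z ^ n)" for n by (cases n) auto
      qed
      with sums_mult[OF s3, of z] show ?thesis by (simp only:)
    qed
    \<comment> \<open>Boundedness of \<open>g\<close> allows the expectation over idle states to be
      written as a series in the orbit size.\<close>
    have gbd: "\<bar>g n\<bar> \<le> lam * \<bar>v - 1\<bar> * 1 + mu * (\<bar>v\<bar> * (C / z) + C)" for n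
    proof -
      have "g n = lam * (v - 1) * z ^ n + mu * (v * (real n * z ^ (n - 1)) - real n * z ^ n)"
        by (simp add: g_def algebra_simps)
      also have "\<bar>\<dots>\<bar> \<le> \<bar>lam * (v - 1) * z ^ n\<bar> + \<bar>mu * (v * (real n * z ^ (n - 1)) - real n * z ^ n)\<bar>" by (rule abs_triangle_ineq)
      also have "\<bar>lam * (v - 1) * z ^ n\<bar> \<le> lam * \<bar>v - 1\<bar> * 1"
        unfolding abs_mult using lam bd1[of n] by (intro mult_mono) auto
      also have "\<bar>mu * (v * (real n * z ^ (n - 1)) - real n * z ^ n)\<bar> \<le> mu * (\<bar>v\<bar> * (C / z) + C)"
      proof -
        have "\<bar>v * (real n * z ^ (n - 1)) - real n * z ^ n\<bar> \<le> \<bar>v * (real n * z ^ (n - 1))\<bar> + \<bar>real n * z ^ n\<bar>" by (rule abs_triangle_ineq4)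
        also have "\<bar>v * (real n * z ^ (n - 1))\<bar> \<le> \<bar>v\<bar> * (C / z)" unfolding abs_mult[of v] by (intro mult_left_mono bd3) simp
        also have "\<bar>real n * z ^ n\<bar> \<le> C" by (rule bd2)
        finally show ?thesis using mu by (simp add: abs_mult)
      qed
      finally show ?thesis by simp
    qed
    have "(\<integral>\<omega>. indicator Z \<omega> * g (R_orb \<omega>) \<partial>M) = 0"
    proof -
      have "(\<integral>\<omega>. indicator Z \<omega> * g (R_orb \<omega>) \<partial>M) = (\<integral>\<omega>. (if I_ser \<omega> = 0 then lam * (v * z ^ R_orb \<omega> - z ^ R_orb \<omega>) + real (R_orb \<omega>) * mu * (v * z ^ (R_orb \<omega> - 1) - z ^ R_orb \<omega>)
     else (s - lam * q * (1 - v) - lam * (1 - q) * (1 - z)) * (v ^ R_que \<omega> * z ^ R_orb \<omega> * exp (- s * X_res \<omega>))) \<partial>M)"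
        unfolding zero by (rule Bochner_Integration.integral_cong[OF refl]) (auto simp: Z_def g_def)
      then show ?thesis using balance(1)[OF z s vs] by simp
    qed
    with event_sums[of g, OF gbd] have g0: "(\<lambda>n. ri n * g n) sums 0" by simp
    have "(\<lambda>n. lam * (v - 1) * (ri n * z ^ n) + mu * (v * (ri n * (real n * z ^ (n - 1))) - ri n * (real n * z ^ n)))
        sums (lam * (v - 1) * \<phi> + mu * (v * \<psi> - z * \<psi>))"
      by (intro sums_add sums_mult sums_diff s1 s2 s3)
    moreover have "lam * (v - 1) * (ri n * z ^ n) + mu * (v * (ri n * (real n * z ^ (n - 1))) - ri n * (real n * z ^ n)) = ri n * g n" for n
      by (simp add: g_def algebra_simps)
    ultimately have "lam * (v - 1) * \<phi> + mu * (v * \<psi> - z * \<psi>) = 0" using g0 sums_unique2 by fastforce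
    then have eq1: "mu * (v - z) * \<psi> = lam * (1 - v) * \<phi>" by (simp add: algebra_simps)
    have v_eq: "1 - v = (1 - w) * b'" using wf(4) by (simp add: v_def b'_def)
    \<comment> \<open>With \<open>1 - v = (1 - w) * b'\<close> this shows that
      \<open>(1 - v) / (v - z) = p * b' / (1 - b')\<close>: the common factor \<open>1 - w\<close>,
      nonzero because \<open>w < 1\<close>, cancels in the balance equation.\<close>
    have pvz: "p * (v - z) = (1 - w) * (1 - b')"
    proof -
      have "p * (v - z) = v - (q * v + p * z)" by (simp add: p_def algebra_simps)
      also have "\<dots> = v - w" using wf(3) by (simp add: v_def)
      also have "\<dots> = (1 - w) - (1 - v)" by simp
      also have "\<dots> = (1 - w) * (1 - b')" unfolding v_eq by (simp add: algebra_simps)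
      finally show ?thesis .
    qed
    have "(1 - w) * (mu * (1 - b') * \<psi>) = mu * (p * (v - z)) * \<psi>" unfolding pvz by simp
    also have "\<dots> = p * (mu * (v - z) * \<psi>)" by simp
    also have "\<dots> = (1 - w) * (lam * p * b' * \<phi>)" unfolding eq1 v_eq by simp
    finally have "mu * (1 - b') * \<psi> = lam * p * b' * \<phi>" using wf(2) by simp
    then have "\<psi> = lam * p * b' * \<phi> / (mu * (1 - b'))" using mu b' \<open>rho < 1\<close> by (simp add: eq_divide_eq mult_ac)
    then have \<psi>_eq: "\<psi> = lam / mu * (p * b' / (1 - b')) * \<phi>" by simp
    have "(\<lambda>n. ri (Suc n) * (real (Suc n) * z ^ (Suc n - 1))) sums \<psi>"
      using s3 by (subst sums_Suc_iff) simp
    then show ?thesis unfolding \<psi>_eq \<phi>_def b'_def by (simp add: mult_ac)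
  qed

  \<comment> \<open>Recursion for the coefficients and normalisation\<close>
  have rec_ri: "real (Suc n) * ri (Suc n) = lam / mu * (\<Sum>i\<le>n. Q.\<kappa> i * ri (n - i))" for n
  proof -
    have "real (Suc n) * ri (Suc n) - lam / mu * (\<Sum>i\<le>n. Q.\<kappa> i * ri (n - i)) = 0"
    proof (rule powser_zero_imp_coeff_zero[of "\<lambda>n. real (Suc n) * ri (Suc n) - lam / mu * (\<Sum>i\<le>n. Q.\<kappa> i * ri (n - i))"])
      fix z :: real assume z: "0 < z" "z < 1"
      obtain w where w: "(\<lambda>n. pmf \<xi> n * z ^ n) sums w"
        using Q.w_exists[OF less_imp_le[OF z(1)] less_imp_le[OF z(2)]] by blast
      note \<kappa>s = Q.\<kappa>_sums[OF less_imp_le[OF z(1)] less_imp_le[OF z(2)] w]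
      have zp: "z ^ n \<ge> 0" "\<bar>z ^ n\<bar> \<le> 1" for n using z by (auto simp: power_le_one)
      have rs: "summable (\<lambda>n. ri n * z ^ n)" using event_sums[OF zp(2)] by (auto simp: sums_iff)
      have "(\<lambda>n. \<Sum>i\<le>n. (Q.\<kappa> i * z ^ i) * (ri (n - i) * z ^ (n - i))) sums ((\<Sum>n. Q.\<kappa> n * z ^ n) * (\<Sum>n. ri n * z ^ n))"
        by (rule Cauchy_product_sums) (use \<kappa>s rs zp Q.\<kappa>_nonneg ri_nonneg in \<open>auto simp: sums_iff abs_mult\<close>)
      moreover have "(\<Sum>i\<le>n. (Q.\<kappa> i * z ^ i) * (ri (n - i) * z ^ (n - i))) = (\<Sum>i\<le>n. Q.\<kappa> i * ri (n - i)) * z ^ n" for n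
        unfolding sum_distrib_right by (rule sum.cong) (auto simp: power_add[symmetric])
      ultimately have "(\<lambda>n. (\<Sum>i\<le>n. Q.\<kappa> i * ri (n - i)) * z ^ n) sums ((\<Sum>n. Q.\<kappa> n * z ^ n) * (\<Sum>n. ri n * z ^ n))" by simp
      from sums_diff[OF ode[OF z w] sums_mult[OF this, of "lam / mu"]]
      show "(\<lambda>n. (real (Suc n) * ri (Suc n) - lam / mu * (\<Sum>i\<le>n. Q.\<kappa> i * ri (n - i))) * z ^ n) sums 0"
        unfolding sums_unique[OF \<kappa>s, symmetric] by (simp only: left_diff_distrib mult.assoc diff_self)
    qed
    then show ?thesis by simp
  qed
  define r where "r n = ri n / p0" for n
  have r_nonneg: "r n \<ge> 0" for n using ri_nonneg p0 by (simp add: r_def)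
  have r_sums: "r sums 1" unfolding r_def using sums_divide[OF ri_sums, of p0] p0 by simp
  have rec: "real (Suc n) * r (Suc n) = lam / mu * (\<Sum>i\<le>n. Q.\<kappa> i * r (n - i))" for n
  proof -
    have "real (Suc n) * r (Suc n) = (real (Suc n) * ri (Suc n)) / p0" by (simp add: r_def)
    also have "\<dots> = lam / mu * (\<Sum>i\<le>n. Q.\<kappa> i * ri (n - i)) / p0" unfolding rec_ri ..
    also have "\<dots> = lam / mu * ((\<Sum>i\<le>n. Q.\<kappa> i * ri (n - i)) / p0)" by simp
    also have "(\<Sum>i\<le>n. Q.\<kappa> i * ri (n - i)) / p0 = (\<Sum>i\<le>n. Q.\<kappa> i * r (n - i))"
      unfolding r_def sum_divide_distrib by simp
    finally show ?thesis .
  qed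

  \<comment> \<open>Chain of asymptotic equivalences and the constant\<close>
  define c where "c = p * m powr (a - 1) / (1 - rho)\<^sup>2"
  have a1: "a - 1 > 0" using \<open>a > 1\<close> by simp
  have \<nu>: "lam / mu > 0" using lam mu by simp
  note sz = size_biased_tail[OF Q.X Q.\<kappa>_nonneg Q.summable_\<kappa> Q.K_limit[unfolded Q.K_def] r_nonneg r_sums \<nu> rec]
  have lim1: "(\<lambda>n. tail_sum r (Suc n) / (Q.X n / real n)) \<longlonglongrightarrow> lam / mu * c * (a - 1) / (a - 1 + 1)"
    unfolding c_def using sz r_sums
    by (intro tail_of_size_biased[OF Q.X a1 r_nonneg]) (auto simp: sums_iff)
  define c' where "c' = lam * lam2 powr a / (a * mu * (1 - rho)\<^sup>2 * (1 - rho1) powr (a - 1))"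
  \<comment> \<open>The factors are, in order, the limit for the tail of \<open>r\<close>,
    Karamata's constant for \<open>b\<close>, the passage from \<open>b\<close> to the service tail,
    and the passage to \<open>L\<close>. They match since
    \<open>p * m powr (a - 1) * lam powr a\<close> equals
    \<open>lam2 powr a / (1 - rho1) powr (a - 1)\<close>, and \<open>a - 1\<close> cancels to leave
    \<open>1 / a\<close>.\<close>
  have const: "lam / mu * c * (a - 1) / (a - 1 + 1) * (1 / (a - 1)) * lam powr a * 1 = c'"
  proof -
    have m_powr: "m powr (a - 1) = p powr (a - 1) / (1 - rho1) powr (a - 1)"
      unfolding m_def rho1 using p q\<rho> by (simp add: powr_divide)
    have "p powr a = p powr (1 + (a - 1))" by simp
    also have "\<dots> = p * p powr (a - 1)" using p by (simp only: powr_add) simp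
    finally have p_powr: "p powr a = p * p powr (a - 1)" .
    have "lam2 powr a = lam powr a * p powr a"
      unfolding assms(11) p_def by (rule powr_mult)
    then show ?thesis unfolding c_def c'_def m_powr p_powr using a1 by (simp add: mult_ac)
  qed
  let ?G = "\<lambda>t. t powr (- a) * L t"
  have lim2: "(\<lambda>n. Q.X n / (real n * S.b n)) \<longlonglongrightarrow> 1 / (a - 1)"
    unfolding Q.X_def by (rule reg_var_karamata[OF b_rv \<open>a > 1\<close>])
  have lim4: "(\<lambda>n. S.Fbar (real n) / ?G (real n)) \<longlonglongrightarrow> 1"
    by (rule filterlim_compose[OF S.Fbar_limit[OF a0 L tail] filterlim_real_sequentially])
  have "(\<lambda>n. tail_sum r (Suc n) / (Q.X n / real n) * (Q.X n / (real n * S.b n)) * (S.b n / S.Fbar (real n)) * (S.Fbar (real n) / ?G (real n))) \<longlonglongrightarrow> c'"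
    unfolding const[symmetric] by (intro tendsto_mult lim1 lim2 lim4 S.b_limit[OF a0 L tail])
  moreover have "\<forall>\<^sub>F n in sequentially. tail_sum r (Suc n) / (Q.X n / real n) * (Q.X n / (real n * S.b n)) * (S.b n / S.Fbar (real n)) * (S.Fbar (real n) / ?G (real n))
      = tail_sum r (Suc n) / ?G (real n)"
    using eventually_gt_at_top[of 0]
  proof eventually_elim
    case (elim n)
    have "Q.X n \<noteq> 0" "S.b n \<noteq> 0" "S.Fbar (real n) \<noteq> 0" "real n \<noteq> 0"
      using Q.X_pos[of n] reg_var_pos[OF b_rv, of n] S.Fbar_pos[OF a0 L tail, of "real n"] elim by auto
    then show ?case by simp
  qed
  ultimately have lim: "(\<lambda>n. tail_sum r (Suc n) / ?G (real n)) \<longlonglongrightarrow> c'"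
    by (rule Lim_transform_eventually)

  \<comment> \<open>Identification of the conditional probability\<close>
  have cond: "\<P>(\<omega> in M. R_orb \<omega> > j \<bar> I_ser \<omega> = 0) = tail_sum r (Suc j)" for j
  proof -
    have "(\<lambda>n. ri n * (if j < n then 1 else 0)) sums (\<integral>\<omega>. indicator Z \<omega> * (if j < R_orb \<omega> then 1 else 0 :: real) \<partial>M)"
      by (rule event_sums[of "\<lambda>n. if j < n then 1 else 0" 1]) simp
    moreover have "(\<integral>\<omega>. indicator Z \<omega> * (if j < R_orb \<omega> then 1 else 0 :: real) \<partial>M) = M.prob {\<omega> \<in> space M. j < R_orb \<omega> \<and> I_ser \<omega> = 0}"
    proof -
      have "(\<integral>\<omega>. indicator Z \<omega> * (if j < R_orb \<omega> then 1 else 0 :: real) \<partial>M) = (\<integral>\<omega>. indicator {\<omega> \<in> space M. j < R_orb \<omega> \<and> I_ser \<omega> = 0} \<omega> \<partial>M)"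
        by (rule Bochner_Integration.integral_cong[OF refl]) (auto simp: Z_def indicator_def)
      then show ?thesis by (simp add: M.emeasure_eq_measure)
    qed
    ultimately have "(\<lambda>n. r n * (if j < n then 1 else 0)) sums (M.prob {\<omega> \<in> space M. j < R_orb \<omega> \<and> I_ser \<omega> = 0} / p0)"
      using sums_divide[of "\<lambda>n. ri n * (if j < n then 1 else 0)" _ p0] by (simp add: r_def)
    moreover have "(\<lambda>n. if j < n then r n else 0) sums tail_sum r (Suc j)"
      by (rule suminf_If_greater) (use r_sums in \<open>simp add: sums_iff\<close>)
    moreover have "(\<lambda>n. r n * (if j < n then 1 else 0)) = (\<lambda>n. if j < n then r n else 0)" by auto
    ultimately have "(\<lambda>n. if j < n then r n else 0) sums (M.prob {\<omega> \<in> space M. j < R_orb \<omega> \<and> I_ser \<omega> = 0} / p0)"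
        "(\<lambda>n. if j < n then r n else 0) sums tail_sum r (Suc j)"
      by (simp_all only:)
    then have "M.prob {\<omega> \<in> space M. j < R_orb \<omega> \<and> I_ser \<omega> = 0} / p0 = tail_sum r (Suc j)"
      by (rule sums_unique2)
    then show ?thesis by (simp add: cond_prob_def p0_def Z_def)
  qed
  have c'0: "c' > 0"
  proof -
    have "lam2 > 0" using assms(11) lam q by simp
    moreover have "1 - rho1 > 0" using rho1 q\<rho> by simp
    ultimately show ?thesis unfolding c'_def using lam mu \<open>a > 1\<close> \<open>rho < 1\<close> by simp
  qed
  show ?thesis unfolding c'_def[symmetric] cond
  proof (rule asymp_equivI')
    have "(\<lambda>n. tail_sum r (Suc n) / ?G (real n) / c') \<longlonglongrightarrow> c' / c'"
      by (intro tendsto_divide lim tendsto_const) (use c'0 in simp)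
    then show "(\<lambda>n. tail_sum r (Suc n) / (c' * ?G (real n))) \<longlonglongrightarrow> 1" using c'0 by (simp add: mult.commute)
  qed
qed

end
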